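(* In the setting described in the context, let $(\bar u_{31},\bar u_{32},\bar u_{33})$ be an open-loop Nash equilibrium of the Level 3 game with parameters $\rho_{2ij}$, and let $\hat x$ be the corresponding state, i.e. $$d\hat x=\Big[\hat A\hat x+\sum_{j=1}^3\hat B_{3j}\bar u_{3j}\Big]dt+\Big[\hat C\hat x+\sum_{j=1}^3\hat D_{3j}\bar u_{3j}\Big]dW,\quad\hat x(0)=x_0.$$ If $\bar u_{3j}(t)=u^*_{3j}(t)$ for $t\in[0,T]$ and $j=1,2,3$, then $\hat x(t)=\bar x(t)$ for $t\in[0,T]$, $\mathbb P$-a.s., where $\bar x$ is the team-optimal trajectory.
   Context: Indices: $i\in\{1,2\}$, $j\in\{1,2,3\}$. Fix $T>0$ and a complete filtered probability space $(\Omega,\mathcal F,\mathbb F,\mathbb P)$ with a one-dimensional Brownian motion $W$, $\mathbb F$ its augmented natural filtration. $L^2_{\mathbb F}(0,T;\mathbb H)$ is the space of $\mathbb F$-progressively measurable $\phi$ with $\mathbb E\int_0^T|\phi|^2dt<\infty$. For symmetric matrix functions, $M\gg0$ means $M(t)\ge\delta I$ for some $\delta>0$. State equation: $$dx=\Big[Ax+\sum_iB_{1i}u_{1i}+\sum_{i,j}B_{2ij}u_{2ij}+\sum_{j,i}B_{3ji}u_{3ji}+Ev\Big]dt+\Big[Cx+\sum_iD_{1i}u_{1i}+\sum_{i,j}D_{2ij}u_{2ij}+\sum_{j,i}D_{3ji}u_{3ji}\Big]dW,\quad x(0)=x_0\in\mathbb R^n,$$ with deterministic bounded coefficients on $[0,T]$;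 $u_{1i}\in L^2_{\mathbb F}(0,T;\mathbb R^{m_{1i}})$ are controls of Level 1, $u_{2ij}\in L^2_{\mathbb F}(0,T;\mathbb R^{m_{2ij}})$ of player $i$ of Level 2, $u_{3ji}\in L^2_{\mathbb F}(0,T;\mathbb R^{m_{3ji}})$ of player $j$ of Level 3, $v\in L^2_{\mathbb F}(0,T;\mathbb R^{n_v})$ is the disturbance. Write $u_{3j}=\mathrm{col}[u_{3j1},u_{3j2}]$, $u_{ci}=\mathrm{col}[u_{2i1},u_{2i2},u_{2i3},u_{31i},u_{32i},u_{33i}]$. Costs (deterministic bounded symmetric weights): $J^1=\mathbb E\{\int_0^T[\langle Q_1x,x\rangle+\sum_i\langle R_iu_{1i},u_{1i}\rangle+\sum_{i,j}\langle R_{1ij}u_{2ij},u_{2ij}\rangle+\sum_{j,i}\langle\bar R_{1ji}u_{3ji},u_{3ji}\rangle]dt+\langle G_1x(T),x(T)\rangle\}$; $J^2_i=\mathbb E\{\int_0^T[\langle Q_{2i}x,x\rangle+\langle R_{2i}u_{1i},u_{1i}\rangle+\sum_j\langle R_{2ij}u_{2ij},u_{2ij}\rangle+\sum_j\langle\bar R_{2ji}u_{3ji},u_{3ji}\rangle]dt+\langle G_{2i}x(T),x(T)\rangle\}$; $J^3_j=\mathbb E\{\int_0^T[\langle Q_{3j}x,x\rangle+\sum_i\langle R_{3ij}u_{2ij},u_{2ij}\rangle+\sum_i\langle\bar R_{3ji}u_{3ji},u_{3ji}\rangle]dt+\langle G_{3j}x(T),x(T)\rangle\}$. Standing assumptions: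 $Q_1,Q_{2i},Q_{3j},G_1,G_{2i},G_{3j}\ge0$ and $R_i,R_{1ij},\bar R_{1ji},R_{2i},R_{2ij},\bar R_{2ji},R_{3ij},\bar R_{3ji}\gg0$. Team-optimal strategy and worst-case disturbance ($\gamma>0$ is the disturbance attenuation level). $B_c=[B_{11},B_{12},B_{211},B_{212},B_{213},B_{221},B_{222},B_{223},B_{311},B_{312},B_{321},B_{322},B_{331},B_{332}]$, $D_c$ likewise from the $D$'s, $R_c=\mathrm{blockdiag}(R_1,R_2,R_{111},R_{112},R_{113},R_{121},R_{122},R_{123},\bar R_{111},\bar R_{112},\bar R_{121},\bar R_{122},\bar R_{131},\bar R_{132})$. $P$ denotes the solution (assumed to exist on $[0,T]$, with $I+PD_cR_c^{-1}D_c^\top$ having bounded inverse) of $$\dot P+PA+A^\top P-P(B_cR_c^{-1}B_c^\top-\gamma^{-2}EE^\top)P+Q_1+(C-D_cR_c^{-1}B_c^\top P)^\top(I+PD_cR_c^{-1}D_c^\top)^{-1}P(C-D_cR_c^{-1}B_c^\top P)=0,\ P(T)=G_1,$$ and $\Lambda:=(I+PD_cR_c^{-1}D_c^\top)^{-1}P(C-D_cR_c^{-1}B_c^\top P)$. Put $K_{1i}:=R_i^{-1}(B_{1i}^\top P+D_{1i}^\top\Lambda)$, $K_{2ij}:=R_{1ij}^{-1}(B_{2ij}^\top P+D_{2ij}^\top\Lambda)$, $K_{3ji}:=\bar R_{1ji}^{-1}(B_{3ji}^\top P+D_{3ji}^\top\Lambda)$. The team-optimal trajectory $\bar x$ is the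 state under $u^*_{1i}=-K_{1i}\bar x$, $u^*_{2ij}=-K_{2ij}\bar x$, $u^*_{3ji}=-K_{3ji}\bar x$, $v^*=\gamma^{-2}E^\top P\bar x$, with $\bar x(0)=x_0$; $u^*_{3j}$ and $u^*_{ci}$ are the corresponding stacked vectors. Incentive strategies of Level 1: $\Gamma^*_{1i}=\sum_j\xi^*_{1ij}x+\sum_j\eta^*_{1ij}u_{2ij}+\sum_j\zeta^*_{1ij}u_{3ji}$, with fixed continuous $\eta^*_{1ij}(t)\in\mathbb R^{m_{1i}\times m_{2ij}}$, $\zeta^*_{1ij}(t)\in\mathbb R^{m_{1i}\times m_{3ji}}$ and $\xi^*_{1ij}=-\frac13K_{1i}+\eta^*_{1ij}K_{2ij}+\zeta^*_{1ij}K_{3ji}$, such that the two-player game of Level 2 obtained by substituting $u_{1i}=\Gamma^*_{1i}$ and $v=\gamma^{-2}E^\top Px$ into the state equation and $J^2_i$ (player $i$ choosing $u_{ci}$ to minimize $J^2_i$) has an open-loop Nash equilibrium equal to $(u^*_{c1},u^*_{c2})$. Level 3 game for given continuous $\rho_{2ij}(t)\in\mathbb R^{m_{2ij}\times m_{3ji}}$. Set $\theta_{2ij}:=-K_{2ij}+\rho_{2ij}K_{3ji}$. Level 2 announces $u_{2ij}=\theta_{2ij}x+\rho_{2ij}u_{3ji}$, Level 1 uses $\Gamma^*_{1i}$, and $v=\gamma^{-2}E^\top Px$. Substitution into the state equation gives $dx=[\hat Ax+\sum_j\hat B_{3j}u_{3j}]dt+[\hat Cx+\sum_j\hat D_{3j}u_{3j}]dW$,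 $x(0)=x_0$, with $\hat A=A+\gamma^{-2}EE^\top P+\sum_{i,j}B_{1i}(\xi^*_{1ij}+\eta^*_{1ij}\theta_{2ij})+\sum_{i,j}B_{2ij}\theta_{2ij}$, $\hat C=C+\sum_{i,j}D_{1i}(\xi^*_{1ij}+\eta^*_{1ij}\theta_{2ij})+\sum_{i,j}D_{2ij}\theta_{2ij}$, $\hat B_{3ji}=B_{1i}(\eta^*_{1ij}\rho_{2ij}+\zeta^*_{1ij})+B_{2ij}\rho_{2ij}+B_{3ji}$, $\hat D_{3ji}=D_{1i}(\eta^*_{1ij}\rho_{2ij}+\zeta^*_{1ij})+D_{2ij}\rho_{2ij}+D_{3ji}$, $\hat B_{3j}=(\hat B_{3j1},\hat B_{3j2})$, $\hat D_{3j}=(\hat D_{3j1},\hat D_{3j2})$. $\bar J^3_j(u_{31},u_{32},u_{33};x_0)$ denotes $J^3_j$ after this substitution. A triple of square-integrable adapted controls is an open-loop Nash equilibrium of Level 3 if for each $j$, $\bar J^3_j$ at the triple is $\le$ $\bar J^3_j$ when $\bar u_{3j}$ is replaced by any square-integrable adapted $u_{3j}$. *)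

theory Defs
  imports
    "HOL-Probability.Probability"
    "Jordan_Normal_Form.Matrix"
    "Jordan_Normal_Form.Gauss_Jordan_Elimination"
begin

(* The dimensions of the control spaces depend on the indices i, j, so vectors and matrices are
   taken from Jordan_Normal_Form. The competing HOL-Analysis notation is switched off. *)
no_notation vec_nth (infixl "$" 90)
no_notation inner (infix "\<bullet>" 70)


section \<open>Brownian motion, square-integrable processes, Ito integral\<close>

definition natural_filtration :: "'a measure \<Rightarrow> (real \<Rightarrow> 'a \<Rightarrow> real) \<Rightarrow> real \<Rightarrow> 'a measure" where
  "natural_filtration M W t =
     sigma (space M) {W r -` S \<inter> space M | r S. 0 \<le> r \<and> r \<le> t \<and> S \<in> sets borel}"

definition augmented_filtration :: "'a measure \<Rightarrow> (real \<Rightarrow> 'a \<Rightarrow> real) \<Rightarrow> real \<Rightarrow> 'a measure" where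
  "augmented_filtration M W t =
     sigma (space M)
       ({W r -` S \<inter> space M | r S. 0 \<le> r \<and> r \<le> t \<and> S \<in> sets borel} \<union> null_sets M)"

definition brownian_motion :: "'a measure \<Rightarrow> (real \<Rightarrow> 'a \<Rightarrow> real) \<Rightarrow> bool" where
  "brownian_motion M W \<longleftrightarrow>
     (\<forall>t\<ge>0. W t \<in> borel_measurable M) \<and>
     (AE \<omega> in M. W 0 \<omega> = 0) \<and>
     (AE \<omega> in M. continuous_on {0..} (\<lambda>t. W t \<omega>)) \<and>
     (\<forall>s t. 0 \<le> s \<longrightarrow> s < t \<longrightarrow>
        distributed M lborel (\<lambda>\<omega>. W t \<omega> - W s \<omega>) (normal_density 0 (sqrt (t - s)))) \<and>
     (\<forall>s t. 0 \<le> s \<longrightarrow> s < t \<longrightarrow>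
        prob_space.indep_set M
          {(\<lambda>\<omega>. W t \<omega> - W s \<omega>) -` S \<inter> space M | S. S \<in> sets borel}
          (sets (natural_filtration M W s)))"

definition prog_measurable ::
    "'a measure \<Rightarrow> (real \<Rightarrow> 'a \<Rightarrow> real) \<Rightarrow> real \<Rightarrow> (real \<Rightarrow> 'a \<Rightarrow> real) \<Rightarrow> bool" where
  "prog_measurable M W T \<phi> \<longleftrightarrow>
     (\<forall>t\<in>{0..T}. (\<lambda>(s, \<omega>). \<phi> s \<omega>)
        \<in> borel_measurable (restrict_space borel {0..t} \<Otimes>\<^sub>M augmented_filtration M W t))"

definition L2F ::
    "'a measure \<Rightarrow> (real \<Rightarrow> 'a \<Rightarrow> real) \<Rightarrow> real \<Rightarrow> nat \<Rightarrow> (real \<Rightarrow> 'a \<Rightarrow> real vec) \<Rightarrow> bool" where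
  "L2F M W T d \<phi> \<longleftrightarrow>
     (\<forall>t\<in>{0..T}. \<forall>\<omega>\<in>space M. \<phi> t \<omega> \<in> carrier_vec d) \<and>
     (\<forall>k<d. prog_measurable M W T (\<lambda>t \<omega>. \<phi> t \<omega> $ k)) \<and>
     (\<integral>\<^sup>+\<omega>. (\<integral>\<^sup>+t\<in>{0..T}. ennreal (\<phi> t \<omega> \<bullet> \<phi> t \<omega>) \<partial>lborel) \<partial>M) < \<infinity>"

(* The data (N, \<tau>, \<xi>) stand for the simple process
   \<open>\<Sum>l<N. \<xi> l \<omega> * indicator {\<tau> l<..\<tau> (Suc l)} t\<close>. *)
definition simple_process_data ::
    "'a measure \<Rightarrow> (real \<Rightarrow> 'a \<Rightarrow> real) \<Rightarrow> real \<Rightarrow> nat \<Rightarrow> (nat \<Rightarrow> real) \<Rightarrow> (nat \<Rightarrow> 'a \<Rightarrow> real) \<Rightarrow> bool" where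
  "simple_process_data M W T N \<tau> \<xi> \<longleftrightarrow>
     0 \<le> \<tau> 0 \<and> (\<forall>l<N. \<tau> l \<le> \<tau> (Suc l)) \<and> \<tau> N \<le> T \<and>
     (\<forall>l<N. \<xi> l \<in> borel_measurable (augmented_filtration M W (\<tau> l))) \<and>
     (\<exists>c. \<forall>l<N. \<forall>\<omega>\<in>space M. \<bar>\<xi> l \<omega>\<bar> \<le> c)"

definition simple_process ::
    "nat \<Rightarrow> (nat \<Rightarrow> real) \<Rightarrow> (nat \<Rightarrow> 'a \<Rightarrow> real) \<Rightarrow> real \<Rightarrow> 'a \<Rightarrow> real" where
  "simple_process N \<tau> \<xi> t \<omega> = (\<Sum>l<N. \<xi> l \<omega> * indicator {\<tau> l<..\<tau> (Suc l)} t)"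

definition simple_ito_integral ::
    "(real \<Rightarrow> 'a \<Rightarrow> real) \<Rightarrow> nat \<Rightarrow> (nat \<Rightarrow> real) \<Rightarrow> (nat \<Rightarrow> 'a \<Rightarrow> real) \<Rightarrow> real \<Rightarrow> 'a \<Rightarrow> real" where
  "simple_ito_integral W N \<tau> \<xi> t \<omega> =
     (\<Sum>l<N. \<xi> l \<omega> * (W (min t (\<tau> (Suc l))) \<omega> - W (min t (\<tau> l)) \<omega>))"

(* I is a continuous adapted version of the process \<open>\<integral>\<^sub>0\<^sup>t \<phi> dW\<close>, t \<in> [0,T]: the L2 limit of the
   integrals of simple processes converging to \<phi> in L2([0,T] x \<Omega>). *)
definition has_ito_integral ::
    "'a measure \<Rightarrow> (real \<Rightarrow> 'a \<Rightarrow> real) \<Rightarrow> real \<Rightarrow> (real \<Rightarrow> 'a \<Rightarrow> real) \<Rightarrow> (real \<Rightarrow> 'a \<Rightarrow> real) \<Rightarrow> bool" where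
  "has_ito_integral M W T \<phi> I \<longleftrightarrow>
     prog_measurable M W T \<phi> \<and>
     (\<integral>\<^sup>+\<omega>. (\<integral>\<^sup>+t\<in>{0..T}. ennreal ((\<phi> t \<omega>)\<^sup>2) \<partial>lborel) \<partial>M) < \<infinity> \<and>
     (\<forall>t\<in>{0..T}. I t \<in> borel_measurable (augmented_filtration M W t)) \<and>
     (AE \<omega> in M. continuous_on {0..T} (\<lambda>t. I t \<omega>)) \<and>
     (\<exists>N \<tau> \<xi>.
        (\<forall>k. simple_process_data M W T (N k) (\<tau> k) (\<xi> k)) \<and>
        (\<lambda>k. \<integral>\<^sup>+\<omega>. (\<integral>\<^sup>+t\<in>{0..T}.
              ennreal ((\<phi> t \<omega> - simple_process (N k) (\<tau> k) (\<xi> k) t \<omega>)\<^sup>2) \<partial>lborel) \<partial>M)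
          \<longlonglongrightarrow> 0 \<and>
        (\<forall>t\<in>{0..T}.
           (\<lambda>k. \<integral>\<^sup>+\<omega>. ennreal ((I t \<omega> - simple_ito_integral W (N k) (\<tau> k) (\<xi> k) t \<omega>)\<^sup>2) \<partial>M)
             \<longlonglongrightarrow> 0))"

(* \<open>dx = b dt + s dW\<close> on [0,T], x(0) = x0, for a continuous x \<in> L2F; b and s are the drift and
   diffusion already evaluated along x. *)
definition ito_process ::
    "'a measure \<Rightarrow> (real \<Rightarrow> 'a \<Rightarrow> real) \<Rightarrow> real \<Rightarrow> nat \<Rightarrow> real vec \<Rightarrow>
     (real \<Rightarrow> 'a \<Rightarrow> real vec) \<Rightarrow> (real \<Rightarrow> 'a \<Rightarrow> real vec) \<Rightarrow> (real \<Rightarrow> 'a \<Rightarrow> real vec) \<Rightarrow> bool" where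
  "ito_process M W T d x0 b s x \<longleftrightarrow>
     L2F M W T d x \<and>
     (AE \<omega> in M. \<forall>k<d. continuous_on {0..T} (\<lambda>t. x t \<omega> $ k)) \<and>
     (AE \<omega> in M. \<forall>k<d. set_integrable lborel {0..T} (\<lambda>t. b t \<omega> $ k)) \<and>
     (\<exists>I. (\<forall>k<d. has_ito_integral M W T (\<lambda>t \<omega>. s t \<omega> $ k) (I k)) \<and>
          (AE \<omega> in M. \<forall>t\<in>{0..T}. \<forall>k<d.
             x t \<omega> $ k = x0 $ k + (LINT r:{0..t}|lborel. b r \<omega> $ k) + I k t \<omega>))"


section \<open>Matrices\<close>

(* Only meaningful for invertible A, otherwise unspecified. *)
definition minv :: "real mat \<Rightarrow> real mat" where
  "minv A = the (mat_inverse A)"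

definition hcat :: "nat \<Rightarrow> real mat list \<Rightarrow> real mat" where
  "hcat d Ms = transpose_mat (foldr (\<lambda>X Y. transpose_mat X @\<^sub>r Y) Ms (0\<^sub>m 0 d))"

definition msum :: "nat \<Rightarrow> nat \<Rightarrow> ('i \<Rightarrow> real mat) \<Rightarrow> 'i set \<Rightarrow> real mat" where
  "msum r c F S = mat r c (\<lambda>ab. \<Sum>i\<in>S. F i $$ ab)"

definition vsum :: "nat \<Rightarrow> ('i \<Rightarrow> real vec) \<Rightarrow> 'i set \<Rightarrow> real vec" where
  "vsum d f S = vec d (\<lambda>k. \<Sum>i\<in>S. f i $ k)"

definition qform :: "real mat \<Rightarrow> real vec \<Rightarrow> real" where
  "qform S v = (S *\<^sub>v v) \<bullet> v"

definition symmetric_mat :: "nat \<Rightarrow> real mat \<Rightarrow> bool" where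
  "symmetric_mat d S \<longleftrightarrow> S \<in> carrier_mat d d \<and> transpose_mat S = S"

definition psd :: "nat \<Rightarrow> real mat \<Rightarrow> bool" where
  "psd d S \<longleftrightarrow> symmetric_mat d S \<and> (\<forall>v\<in>carrier_vec d. 0 \<le> qform S v)"

definition bounded_coeff :: "real \<Rightarrow> nat \<Rightarrow> nat \<Rightarrow> (real \<Rightarrow> real mat) \<Rightarrow> bool" where
  "bounded_coeff T r c F \<longleftrightarrow>
     (\<forall>t\<in>{0..T}. F t \<in> carrier_mat r c) \<and>
     (\<forall>a<r. \<forall>b<c. set_borel_measurable borel {0..T} (\<lambda>t. F t $$ (a, b))) \<and>
     (\<exists>\<kappa>. \<forall>t\<in>{0..T}. \<forall>a<r. \<forall>b<c. \<bar>F t $$ (a, b)\<bar> \<le> \<kappa>)"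

definition continuous_coeff :: "real \<Rightarrow> nat \<Rightarrow> nat \<Rightarrow> (real \<Rightarrow> real mat) \<Rightarrow> bool" where
  "continuous_coeff T r c F \<longleftrightarrow>
     (\<forall>t\<in>{0..T}. F t \<in> carrier_mat r c) \<and>
     (\<forall>a<r. \<forall>b<c. continuous_on {0..T} (\<lambda>t. F t $$ (a, b)))"

definition nonneg_weight :: "real \<Rightarrow> nat \<Rightarrow> (real \<Rightarrow> real mat) \<Rightarrow> bool" where
  "nonneg_weight T d S \<longleftrightarrow> bounded_coeff T d d S \<and> (\<forall>t\<in>{0..T}. psd d (S t))"

(* S \<gg> 0 *)
definition pos_weight :: "real \<Rightarrow> nat \<Rightarrow> (real \<Rightarrow> real mat) \<Rightarrow> bool" where
  "pos_weight T d S \<longleftrightarrow>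
     bounded_coeff T d d S \<and>
     (\<forall>t\<in>{0..T}. symmetric_mat d (S t)) \<and>
     (\<exists>\<delta>>0. \<forall>t\<in>{0..T}. psd d (S t - \<delta> \<cdot>\<^sub>m 1\<^sub>m d))"


section \<open>Data of the game\<close>

(* Indices are natural numbers i \<in> {1,2} and j \<in> {1,2,3}.
   wRkl is the weight in the cost of Level k of the controls of Level l:
     wR11 i = R_i,      wR12 i j = R_{1ij},  wR13 j i = Rbar_{1ji},
     wR21 i = R_{2i},   wR22 i j = R_{2ij},  wR23 j i = Rbar_{2ji},
                        wR32 i j = R_{3ij},  wR33 j i = Rbar_{3ji}. *)
record game =
  horizon :: real
  dimx :: nat
  dim1 :: "nat \<Rightarrow> nat"
  dim2 :: "nat \<Rightarrow> nat \<Rightarrow> nat"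
  dim3 :: "nat \<Rightarrow> nat \<Rightarrow> nat"
  dimv :: nat
  init :: "real vec"
  gam :: real
  cA :: "real \<Rightarrow> real mat"
  cB1 :: "nat \<Rightarrow> real \<Rightarrow> real mat"
  cB2 :: "nat \<Rightarrow> nat \<Rightarrow> real \<Rightarrow> real mat"
  cB3 :: "nat \<Rightarrow> nat \<Rightarrow> real \<Rightarrow> real mat"
  cE :: "real \<Rightarrow> real mat"
  cC :: "real \<Rightarrow> real mat"
  cD1 :: "nat \<Rightarrow> real \<Rightarrow> real mat"
  cD2 :: "nat \<Rightarrow> nat \<Rightarrow> real \<Rightarrow> real mat"
  cD3 :: "nat \<Rightarrow> nat \<Rightarrow> real \<Rightarrow> real mat"
  wQ1 :: "real \<Rightarrow> real mat"
  wQ2 :: "nat \<Rightarrow> real \<Rightarrow> real mat"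
  wQ3 :: "nat \<Rightarrow> real \<Rightarrow> real mat"
  wR11 :: "nat \<Rightarrow> real \<Rightarrow> real mat"
  wR12 :: "nat \<Rightarrow> nat \<Rightarrow> real \<Rightarrow> real mat"
  wR13 :: "nat \<Rightarrow> nat \<Rightarrow> real \<Rightarrow> real mat"
  wR21 :: "nat \<Rightarrow> real \<Rightarrow> real mat"
  wR22 :: "nat \<Rightarrow> nat \<Rightarrow> real \<Rightarrow> real mat"
  wR23 :: "nat \<Rightarrow> nat \<Rightarrow> real \<Rightarrow> real mat"
  wR32 :: "nat \<Rightarrow> nat \<Rightarrow> real \<Rightarrow> real mat"
  wR33 :: "nat \<Rightarrow> nat \<Rightarrow> real \<Rightarrow> real mat"
  wG1 :: "real mat"
  wG2 :: "nat \<Rightarrow> real mat"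
  wG3 :: "nat \<Rightarrow> real mat"

definition standing_assumptions :: "game \<Rightarrow> bool" where
  "standing_assumptions g \<longleftrightarrow>
     (let T = horizon g; n = dimx g in
      0 < T \<and> 0 < gam g \<and> init g \<in> carrier_vec n \<and>
      bounded_coeff T n n (cA g) \<and> bounded_coeff T n n (cC g) \<and>
      bounded_coeff T n (dimv g) (cE g) \<and>
      nonneg_weight T n (wQ1 g) \<and> psd n (wG1 g) \<and>
      (\<forall>i\<in>{1..2}.
         bounded_coeff T n (dim1 g i) (cB1 g i) \<and> bounded_coeff T n (dim1 g i) (cD1 g i) \<and>
         nonneg_weight T n (wQ2 g i) \<and> psd n (wG2 g i) \<and>
         pos_weight T (dim1 g i) (wR11 g i) \<and> pos_weight T (dim1 g i) (wR21 g i)) \<and>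
      (\<forall>j\<in>{1..3}. nonneg_weight T n (wQ3 g j) \<and> psd n (wG3 g j)) \<and>
      (\<forall>i\<in>{1..2}. \<forall>j\<in>{1..3}.
         bounded_coeff T n (dim2 g i j) (cB2 g i j) \<and> bounded_coeff T n (dim2 g i j) (cD2 g i j) \<and>
         bounded_coeff T n (dim3 g j i) (cB3 g j i) \<and> bounded_coeff T n (dim3 g j i) (cD3 g j i) \<and>
         pos_weight T (dim2 g i j) (wR12 g i j) \<and> pos_weight T (dim3 g j i) (wR13 g j i) \<and>
         pos_weight T (dim2 g i j) (wR22 g i j) \<and> pos_weight T (dim3 g j i) (wR23 g j i) \<and>
         pos_weight T (dim2 g i j) (wR32 g i j) \<and> pos_weight T (dim3 g j i) (wR33 g j i)))"

definition drift ::
    "game \<Rightarrow> real \<Rightarrow> real vec \<Rightarrow> (nat \<Rightarrow> real vec) \<Rightarrow> (nat \<Rightarrow> nat \<Rightarrow> real vec) \<Rightarrow>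
     (nat \<Rightarrow> nat \<Rightarrow> real vec) \<Rightarrow> real vec \<Rightarrow> real vec" where
  "drift g t x u1 u2 u3 v =
     cA g t *\<^sub>v x
     + vsum (dimx g) (\<lambda>i. cB1 g i t *\<^sub>v u1 i) {1..2}
     + vsum (dimx g) (\<lambda>(i, j). cB2 g i j t *\<^sub>v u2 i j) ({1..2} \<times> {1..3})
     + vsum (dimx g) (\<lambda>(j, i). cB3 g j i t *\<^sub>v u3 j i) ({1..3} \<times> {1..2})
     + cE g t *\<^sub>v v"

definition diffusion ::
    "game \<Rightarrow> real \<Rightarrow> real vec \<Rightarrow> (nat \<Rightarrow> real vec) \<Rightarrow> (nat \<Rightarrow> nat \<Rightarrow> real vec) \<Rightarrow>
     (nat \<Rightarrow> nat \<Rightarrow> real vec) \<Rightarrow> real vec" where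
  "diffusion g t x u1 u2 u3 =
     cC g t *\<^sub>v x
     + vsum (dimx g) (\<lambda>i. cD1 g i t *\<^sub>v u1 i) {1..2}
     + vsum (dimx g) (\<lambda>(i, j). cD2 g i j t *\<^sub>v u2 i j) ({1..2} \<times> {1..3})
     + vsum (dimx g) (\<lambda>(j, i). cD3 g j i t *\<^sub>v u3 j i) ({1..3} \<times> {1..2})"

definition is_state ::
    "game \<Rightarrow> 'a measure \<Rightarrow> (real \<Rightarrow> 'a \<Rightarrow> real) \<Rightarrow>
     (nat \<Rightarrow> real \<Rightarrow> 'a \<Rightarrow> real vec) \<Rightarrow> (nat \<Rightarrow> nat \<Rightarrow> real \<Rightarrow> 'a \<Rightarrow> real vec) \<Rightarrow>
     (nat \<Rightarrow> nat \<Rightarrow> real \<Rightarrow> 'a \<Rightarrow> real vec) \<Rightarrow> (real \<Rightarrow> 'a \<Rightarrow> real vec) \<Rightarrow>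
     (real \<Rightarrow> 'a \<Rightarrow> real vec) \<Rightarrow> bool" where
  "is_state g M W u1 u2 u3 v x \<longleftrightarrow>
     ito_process M W (horizon g) (dimx g) (init g)
       (\<lambda>t \<omega>. drift g t (x t \<omega>) (\<lambda>i. u1 i t \<omega>) (\<lambda>i j. u2 i j t \<omega>) (\<lambda>j i. u3 j i t \<omega>) (v t \<omega>))
       (\<lambda>t \<omega>. diffusion g t (x t \<omega>) (\<lambda>i. u1 i t \<omega>) (\<lambda>i j. u2 i j t \<omega>) (\<lambda>j i. u3 j i t \<omega>))
       x"

definition cost2 ::
    "game \<Rightarrow> 'a measure \<Rightarrow> nat \<Rightarrow> (nat \<Rightarrow> real \<Rightarrow> 'a \<Rightarrow> real vec) \<Rightarrow>
     (nat \<Rightarrow> nat \<Rightarrow> real \<Rightarrow> 'a \<Rightarrow> real vec) \<Rightarrow> (nat \<Rightarrow> nat \<Rightarrow> real \<Rightarrow> 'a \<Rightarrow> real vec) \<Rightarrow>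
     (real \<Rightarrow> 'a \<Rightarrow> real vec) \<Rightarrow> real" where
  "cost2 g M i u1 u2 u3 x =
     (LINT \<omega>|M.
        (LINT t:{0..horizon g}|lborel.
           qform (wQ2 g i t) (x t \<omega>) + qform (wR21 g i t) (u1 i t \<omega>)
           + (\<Sum>j=1..3. qform (wR22 g i j t) (u2 i j t \<omega>))
           + (\<Sum>j=1..3. qform (wR23 g j i t) (u3 j i t \<omega>)))
        + qform (wG2 g i) (x (horizon g) \<omega>))"

definition cost3 ::
    "game \<Rightarrow> 'a measure \<Rightarrow> nat \<Rightarrow>
     (nat \<Rightarrow> nat \<Rightarrow> real \<Rightarrow> 'a \<Rightarrow> real vec) \<Rightarrow> (nat \<Rightarrow> nat \<Rightarrow> real \<Rightarrow> 'a \<Rightarrow> real vec) \<Rightarrow>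
     (real \<Rightarrow> 'a \<Rightarrow> real vec) \<Rightarrow> real" where
  "cost3 g M j u2 u3 x =
     (LINT \<omega>|M.
        (LINT t:{0..horizon g}|lborel.
           qform (wQ3 g j t) (x t \<omega>)
           + (\<Sum>i=1..2. qform (wR32 g i j t) (u2 i j t \<omega>))
           + (\<Sum>i=1..2. qform (wR33 g j i t) (u3 j i t \<omega>)))
        + qform (wG3 g j) (x (horizon g) \<omega>))"


section \<open>Riccati equation and team-optimal strategy\<close>

definition Bc :: "game \<Rightarrow> real \<Rightarrow> real mat" where
  "Bc g t = hcat (dimx g)
     [cB1 g 1 t, cB1 g 2 t,
      cB2 g 1 1 t, cB2 g 1 2 t, cB2 g 1 3 t, cB2 g 2 1 t, cB2 g 2 2 t, cB2 g 2 3 t,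
      cB3 g 1 1 t, cB3 g 1 2 t, cB3 g 2 1 t, cB3 g 2 2 t, cB3 g 3 1 t, cB3 g 3 2 t]"

definition Dc :: "game \<Rightarrow> real \<Rightarrow> real mat" where
  "Dc g t = hcat (dimx g)
     [cD1 g 1 t, cD1 g 2 t,
      cD2 g 1 1 t, cD2 g 1 2 t, cD2 g 1 3 t, cD2 g 2 1 t, cD2 g 2 2 t, cD2 g 2 3 t,
      cD3 g 1 1 t, cD3 g 1 2 t, cD3 g 2 1 t, cD3 g 2 2 t, cD3 g 3 1 t, cD3 g 3 2 t]"

definition Rc :: "game \<Rightarrow> real \<Rightarrow> real mat" where
  "Rc g t = diag_block_mat
     [wR11 g 1 t, wR11 g 2 t,
      wR12 g 1 1 t, wR12 g 1 2 t, wR12 g 1 3 t, wR12 g 2 1 t, wR12 g 2 2 t, wR12 g 2 3 t,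
      wR13 g 1 1 t, wR13 g 1 2 t, wR13 g 2 1 t, wR13 g 2 2 t, wR13 g 3 1 t, wR13 g 3 2 t]"

definition gamEE :: "game \<Rightarrow> real \<Rightarrow> real mat" where
  "gamEE g t = (1 / (gam g)\<^sup>2) \<cdot>\<^sub>m (cE g t * transpose_mat (cE g t))"

definition Nmat :: "game \<Rightarrow> (real \<Rightarrow> real mat) \<Rightarrow> real \<Rightarrow> real mat" where
  "Nmat g P t = 1\<^sub>m (dimx g) + P t * Dc g t * minv (Rc g t) * transpose_mat (Dc g t)"

definition Smat :: "game \<Rightarrow> (real \<Rightarrow> real mat) \<Rightarrow> real \<Rightarrow> real mat" where
  "Smat g P t = cC g t - Dc g t * minv (Rc g t) * transpose_mat (Bc g t) * P t"

definition Lam :: "game \<Rightarrow> (real \<Rightarrow> real mat) \<Rightarrow> real \<Rightarrow> real mat" where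
  "Lam g P t = minv (Nmat g P t) * P t * Smat g P t"

definition riccati_rhs :: "game \<Rightarrow> (real \<Rightarrow> real mat) \<Rightarrow> real \<Rightarrow> real mat" where
  "riccati_rhs g P t =
     P t * cA g t + transpose_mat (cA g t) * P t
     - P t * (Bc g t * minv (Rc g t) * transpose_mat (Bc g t) - gamEE g t) * P t
     + wQ1 g t
     + transpose_mat (Smat g P t) * minv (Nmat g P t) * P t * Smat g P t"

(* The coefficients are only bounded and measurable in t, hence the Riccati equation
   \<open>P' + riccati_rhs = 0\<close>, P(T) = G1, is understood in the Caratheodory sense, i.e. in integrated form. *)
definition riccati_solution :: "game \<Rightarrow> (real \<Rightarrow> real mat) \<Rightarrow> bool" where
  "riccati_solution g P \<longleftrightarrow>
     (let T = horizon g; n = dimx g in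
      continuous_coeff T n n P \<and>
      (\<forall>t\<in>{0..T}. invertible_mat (Nmat g P t)) \<and>
      (\<exists>\<kappa>. \<forall>t\<in>{0..T}. \<forall>a<n. \<forall>b<n. \<bar>minv (Nmat g P t) $$ (a, b)\<bar> \<le> \<kappa>) \<and>
      (\<forall>a<n. \<forall>b<n. set_integrable lborel {0..T} (\<lambda>t. riccati_rhs g P t $$ (a, b))) \<and>
      (\<forall>t\<in>{0..T}. \<forall>a<n. \<forall>b<n.
         P t $$ (a, b) = wG1 g $$ (a, b) + (LINT r:{t..T}|lborel. riccati_rhs g P r $$ (a, b))))"

definition K1 :: "game \<Rightarrow> (real \<Rightarrow> real mat) \<Rightarrow> nat \<Rightarrow> real \<Rightarrow> real mat" where
  "K1 g P i t = minv (wR11 g i t) *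
     (transpose_mat (cB1 g i t) * P t + transpose_mat (cD1 g i t) * Lam g P t)"

definition K2 :: "game \<Rightarrow> (real \<Rightarrow> real mat) \<Rightarrow> nat \<Rightarrow> nat \<Rightarrow> real \<Rightarrow> real mat" where
  "K2 g P i j t = minv (wR12 g i j t) *
     (transpose_mat (cB2 g i j t) * P t + transpose_mat (cD2 g i j t) * Lam g P t)"

definition K3 :: "game \<Rightarrow> (real \<Rightarrow> real mat) \<Rightarrow> nat \<Rightarrow> nat \<Rightarrow> real \<Rightarrow> real mat" where
  "K3 g P j i t = minv (wR13 g j i t) *
     (transpose_mat (cB3 g j i t) * P t + transpose_mat (cD3 g j i t) * Lam g P t)"

definition worst_v ::
    "game \<Rightarrow> (real \<Rightarrow> real mat) \<Rightarrow> (real \<Rightarrow> 'a \<Rightarrow> real vec) \<Rightarrow> real \<Rightarrow> 'a \<Rightarrow> real vec" where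
  "worst_v g P x t \<omega> = ((1 / (gam g)\<^sup>2) \<cdot>\<^sub>m (transpose_mat (cE g t) * P t)) *\<^sub>v x t \<omega>"

(* team_u1, team_u2, team_u3 applied to the team-optimal trajectory are the team-optimal controls *)
definition team_u1 ::
    "game \<Rightarrow> (real \<Rightarrow> real mat) \<Rightarrow> (real \<Rightarrow> 'a \<Rightarrow> real vec) \<Rightarrow> nat \<Rightarrow> real \<Rightarrow> 'a \<Rightarrow> real vec" where
  "team_u1 g P x i t \<omega> = - (K1 g P i t *\<^sub>v x t \<omega>)"

definition team_u2 ::
    "game \<Rightarrow> (real \<Rightarrow> real mat) \<Rightarrow> (real \<Rightarrow> 'a \<Rightarrow> real vec) \<Rightarrow> nat \<Rightarrow> nat \<Rightarrow> real \<Rightarrow> 'a \<Rightarrow> real vec" where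
  "team_u2 g P x i j t \<omega> = - (K2 g P i j t *\<^sub>v x t \<omega>)"

definition team_u3 ::
    "game \<Rightarrow> (real \<Rightarrow> real mat) \<Rightarrow> (real \<Rightarrow> 'a \<Rightarrow> real vec) \<Rightarrow> nat \<Rightarrow> nat \<Rightarrow> real \<Rightarrow> 'a \<Rightarrow> real vec" where
  "team_u3 g P x j i t \<omega> = - (K3 g P j i t *\<^sub>v x t \<omega>)"

definition team_trajectory ::
    "game \<Rightarrow> (real \<Rightarrow> real mat) \<Rightarrow> 'a measure \<Rightarrow> (real \<Rightarrow> 'a \<Rightarrow> real) \<Rightarrow>
     (real \<Rightarrow> 'a \<Rightarrow> real vec) \<Rightarrow> bool" where
  "team_trajectory g P M W x \<longleftrightarrow>
     is_state g M W (team_u1 g P x) (team_u2 g P x) (team_u3 g P x) (worst_v g P x) x"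


section \<open>Incentive strategies of Level 1 and the game of Level 2\<close>

definition xi ::
    "game \<Rightarrow> (real \<Rightarrow> real mat) \<Rightarrow> (nat \<Rightarrow> nat \<Rightarrow> real \<Rightarrow> real mat) \<Rightarrow>
     (nat \<Rightarrow> nat \<Rightarrow> real \<Rightarrow> real mat) \<Rightarrow> nat \<Rightarrow> nat \<Rightarrow> real \<Rightarrow> real mat" where
  "xi g P \<eta> \<zeta> i j t =
     (- (1 / 3)) \<cdot>\<^sub>m K1 g P i t + \<eta> i j t * K2 g P i j t + \<zeta> i j t * K3 g P j i t"

definition incentive ::
    "game \<Rightarrow> (real \<Rightarrow> real mat) \<Rightarrow> (nat \<Rightarrow> nat \<Rightarrow> real \<Rightarrow> real mat) \<Rightarrow>
     (nat \<Rightarrow> nat \<Rightarrow> real \<Rightarrow> real mat) \<Rightarrow>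
     (nat \<Rightarrow> nat \<Rightarrow> real \<Rightarrow> 'a \<Rightarrow> real vec) \<Rightarrow> (nat \<Rightarrow> nat \<Rightarrow> real \<Rightarrow> 'a \<Rightarrow> real vec) \<Rightarrow>
     (real \<Rightarrow> 'a \<Rightarrow> real vec) \<Rightarrow> nat \<Rightarrow> real \<Rightarrow> 'a \<Rightarrow> real vec" where
  "incentive g P \<eta> \<zeta> u2 u3 x i t \<omega> =
     vsum (dim1 g i) (\<lambda>j. xi g P \<eta> \<zeta> i j t *\<^sub>v x t \<omega>) {1..3}
     + vsum (dim1 g i) (\<lambda>j. \<eta> i j t *\<^sub>v u2 i j t \<omega>) {1..3}
     + vsum (dim1 g i) (\<lambda>j. \<zeta> i j t *\<^sub>v u3 j i t \<omega>) {1..3}"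

definition level2_state ::
    "game \<Rightarrow> (real \<Rightarrow> real mat) \<Rightarrow> (nat \<Rightarrow> nat \<Rightarrow> real \<Rightarrow> real mat) \<Rightarrow>
     (nat \<Rightarrow> nat \<Rightarrow> real \<Rightarrow> real mat) \<Rightarrow> 'a measure \<Rightarrow> (real \<Rightarrow> 'a \<Rightarrow> real) \<Rightarrow>
     (nat \<Rightarrow> nat \<Rightarrow> real \<Rightarrow> 'a \<Rightarrow> real vec) \<Rightarrow> (nat \<Rightarrow> nat \<Rightarrow> real \<Rightarrow> 'a \<Rightarrow> real vec) \<Rightarrow>
     (real \<Rightarrow> 'a \<Rightarrow> real vec) \<Rightarrow> bool" where
  "level2_state g P \<eta> \<zeta> M W u2 u3 x \<longleftrightarrow>
     is_state g M W (incentive g P \<eta> \<zeta> u2 u3 x) u2 u3 (worst_v g P x) x"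

definition level2_cost ::
    "game \<Rightarrow> (real \<Rightarrow> real mat) \<Rightarrow> (nat \<Rightarrow> nat \<Rightarrow> real \<Rightarrow> real mat) \<Rightarrow>
     (nat \<Rightarrow> nat \<Rightarrow> real \<Rightarrow> real mat) \<Rightarrow> 'a measure \<Rightarrow> nat \<Rightarrow>
     (nat \<Rightarrow> nat \<Rightarrow> real \<Rightarrow> 'a \<Rightarrow> real vec) \<Rightarrow> (nat \<Rightarrow> nat \<Rightarrow> real \<Rightarrow> 'a \<Rightarrow> real vec) \<Rightarrow>
     (real \<Rightarrow> 'a \<Rightarrow> real vec) \<Rightarrow> real" where
  "level2_cost g P \<eta> \<zeta> M i u2 u3 x = cost2 g M i (incentive g P \<eta> \<zeta> u2 u3 x) u2 u3 x"

definition admissible2 ::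
    "game \<Rightarrow> 'a measure \<Rightarrow> (real \<Rightarrow> 'a \<Rightarrow> real) \<Rightarrow> (nat \<Rightarrow> nat \<Rightarrow> real \<Rightarrow> 'a \<Rightarrow> real vec) \<Rightarrow> nat \<Rightarrow> bool" where
  "admissible2 g M W u2 i \<longleftrightarrow> (\<forall>j\<in>{1..3}. L2F M W (horizon g) (dim2 g i j) (u2 i j))"

definition admissible3 ::
    "game \<Rightarrow> 'a measure \<Rightarrow> (real \<Rightarrow> 'a \<Rightarrow> real) \<Rightarrow> (nat \<Rightarrow> nat \<Rightarrow> real \<Rightarrow> 'a \<Rightarrow> real vec) \<Rightarrow>
     nat \<Rightarrow> nat \<Rightarrow> bool" where
  "admissible3 g M W u3 j i \<longleftrightarrow> L2F M W (horizon g) (dim3 g j i) (u3 j i)"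

(* Player i of Level 2 controls u_ci, i.e. u2 i j and u3 j i for j \<in> {1,2,3}; a deviation (w2, w3)
   replaces exactly these components. The cost of a profile is the cost along its state, which is
   unique up to indistinguishability. *)
definition level2_nash ::
    "game \<Rightarrow> (real \<Rightarrow> real mat) \<Rightarrow> (nat \<Rightarrow> nat \<Rightarrow> real \<Rightarrow> real mat) \<Rightarrow>
     (nat \<Rightarrow> nat \<Rightarrow> real \<Rightarrow> real mat) \<Rightarrow> 'a measure \<Rightarrow> (real \<Rightarrow> 'a \<Rightarrow> real) \<Rightarrow>
     (nat \<Rightarrow> nat \<Rightarrow> real \<Rightarrow> 'a \<Rightarrow> real vec) \<Rightarrow> (nat \<Rightarrow> nat \<Rightarrow> real \<Rightarrow> 'a \<Rightarrow> real vec) \<Rightarrow> bool" where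
  "level2_nash g P \<eta> \<zeta> M W u2 u3 \<longleftrightarrow>
     (\<forall>i\<in>{1..2}. admissible2 g M W u2 i \<and> (\<forall>j\<in>{1..3}. admissible3 g M W u3 j i)) \<and>
     (\<forall>i\<in>{1..2}. \<forall>w2 w3 x y.
        admissible2 g M W w2 i \<longrightarrow> (\<forall>j\<in>{1..3}. admissible3 g M W w3 j i) \<longrightarrow>
        (let u2' = u2(i := w2 i);
             u3' = (\<lambda>j i'. if i' = i then w3 j i' else u3 j i') in
         level2_state g P \<eta> \<zeta> M W u2 u3 x \<longrightarrow>
         level2_state g P \<eta> \<zeta> M W u2' u3' y \<longrightarrow>
         level2_cost g P \<eta> \<zeta> M i u2 u3 x \<le> level2_cost g P \<eta> \<zeta> M i u2' u3' y))"


section \<open>The game of Level 3\<close>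

definition theta ::
    "game \<Rightarrow> (real \<Rightarrow> real mat) \<Rightarrow> (nat \<Rightarrow> nat \<Rightarrow> real \<Rightarrow> real mat) \<Rightarrow>
     nat \<Rightarrow> nat \<Rightarrow> real \<Rightarrow> real mat" where
  "theta g P \<rho> i j t = - K2 g P i j t + \<rho> i j t * K3 g P j i t"

definition A_hat where
  "A_hat g P \<eta> \<zeta> \<rho> t =
     cA g t + gamEE g t * P t
     + msum (dimx g) (dimx g)
         (\<lambda>(i, j). cB1 g i t * (xi g P \<eta> \<zeta> i j t + \<eta> i j t * theta g P \<rho> i j t)) ({1..2} \<times> {1..3})
     + msum (dimx g) (dimx g)
         (\<lambda>(i, j). cB2 g i j t * theta g P \<rho> i j t) ({1..2} \<times> {1..3})"

definition C_hat where
  "C_hat g P \<eta> \<zeta> \<rho> t =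
     cC g t
     + msum (dimx g) (dimx g)
         (\<lambda>(i, j). cD1 g i t * (xi g P \<eta> \<zeta> i j t + \<eta> i j t * theta g P \<rho> i j t)) ({1..2} \<times> {1..3})
     + msum (dimx g) (dimx g)
         (\<lambda>(i, j). cD2 g i j t * theta g P \<rho> i j t) ({1..2} \<times> {1..3})"

definition B3_hat ::
    "game \<Rightarrow> (nat \<Rightarrow> nat \<Rightarrow> real \<Rightarrow> real mat) \<Rightarrow> (nat \<Rightarrow> nat \<Rightarrow> real \<Rightarrow> real mat) \<Rightarrow>
     (nat \<Rightarrow> nat \<Rightarrow> real \<Rightarrow> real mat) \<Rightarrow> nat \<Rightarrow> nat \<Rightarrow> real \<Rightarrow> real mat" where
  "B3_hat g \<eta> \<zeta> \<rho> j i t =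
     cB1 g i t * (\<eta> i j t * \<rho> i j t + \<zeta> i j t) + cB2 g i j t * \<rho> i j t + cB3 g j i t"

definition D3_hat ::
    "game \<Rightarrow> (nat \<Rightarrow> nat \<Rightarrow> real \<Rightarrow> real mat) \<Rightarrow> (nat \<Rightarrow> nat \<Rightarrow> real \<Rightarrow> real mat) \<Rightarrow>
     (nat \<Rightarrow> nat \<Rightarrow> real \<Rightarrow> real mat) \<Rightarrow> nat \<Rightarrow> nat \<Rightarrow> real \<Rightarrow> real mat" where
  "D3_hat g \<eta> \<zeta> \<rho> j i t =
     cD1 g i t * (\<eta> i j t * \<rho> i j t + \<zeta> i j t) + cD2 g i j t * \<rho> i j t + cD3 g j i t"

(* B3_hat_row j acts on the stacked control u_3j = col[u_3j1, u_3j2]. *)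
definition B3_hat_row where
  "B3_hat_row g \<eta> \<zeta> \<rho> j t = hcat (dimx g) [B3_hat g \<eta> \<zeta> \<rho> j 1 t, B3_hat g \<eta> \<zeta> \<rho> j 2 t]"

definition D3_hat_row where
  "D3_hat_row g \<eta> \<zeta> \<rho> j t = hcat (dimx g) [D3_hat g \<eta> \<zeta> \<rho> j 1 t, D3_hat g \<eta> \<zeta> \<rho> j 2 t]"

definition stack3 ::
    "(nat \<Rightarrow> nat \<Rightarrow> real \<Rightarrow> 'a \<Rightarrow> real vec) \<Rightarrow> nat \<Rightarrow> real \<Rightarrow> 'a \<Rightarrow> real vec" where
  "stack3 u3 j t \<omega> = u3 j 1 t \<omega> @\<^sub>v u3 j 2 t \<omega>"

definition level3_state ::
    "game \<Rightarrow> (real \<Rightarrow> real mat) \<Rightarrow> (nat \<Rightarrow> nat \<Rightarrow> real \<Rightarrow> real mat) \<Rightarrow>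
     (nat \<Rightarrow> nat \<Rightarrow> real \<Rightarrow> real mat) \<Rightarrow> (nat \<Rightarrow> nat \<Rightarrow> real \<Rightarrow> real mat) \<Rightarrow>
     'a measure \<Rightarrow> (real \<Rightarrow> 'a \<Rightarrow> real) \<Rightarrow>
     (nat \<Rightarrow> nat \<Rightarrow> real \<Rightarrow> 'a \<Rightarrow> real vec) \<Rightarrow> (real \<Rightarrow> 'a \<Rightarrow> real vec) \<Rightarrow> bool" where
  "level3_state g P \<eta> \<zeta> \<rho> M W u3 x \<longleftrightarrow>
     ito_process M W (horizon g) (dimx g) (init g)
       (\<lambda>t \<omega>. A_hat g P \<eta> \<zeta> \<rho> t *\<^sub>v x t \<omega>
          + vsum (dimx g) (\<lambda>j. B3_hat_row g \<eta> \<zeta> \<rho> j t *\<^sub>v stack3 u3 j t \<omega>) {1..3})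
       (\<lambda>t \<omega>. C_hat g P \<eta> \<zeta> \<rho> t *\<^sub>v x t \<omega>
          + vsum (dimx g) (\<lambda>j. D3_hat_row g \<eta> \<zeta> \<rho> j t *\<^sub>v stack3 u3 j t \<omega>) {1..3})
       x"

definition level2_announced ::
    "game \<Rightarrow> (real \<Rightarrow> real mat) \<Rightarrow> (nat \<Rightarrow> nat \<Rightarrow> real \<Rightarrow> real mat) \<Rightarrow>
     (nat \<Rightarrow> nat \<Rightarrow> real \<Rightarrow> 'a \<Rightarrow> real vec) \<Rightarrow> (real \<Rightarrow> 'a \<Rightarrow> real vec) \<Rightarrow>
     nat \<Rightarrow> nat \<Rightarrow> real \<Rightarrow> 'a \<Rightarrow> real vec" where
  "level2_announced g P \<rho> u3 x i j t \<omega> =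
     theta g P \<rho> i j t *\<^sub>v x t \<omega> + \<rho> i j t *\<^sub>v u3 j i t \<omega>"

definition level3_cost ::
    "game \<Rightarrow> (real \<Rightarrow> real mat) \<Rightarrow> (nat \<Rightarrow> nat \<Rightarrow> real \<Rightarrow> real mat) \<Rightarrow> 'a measure \<Rightarrow> nat \<Rightarrow>
     (nat \<Rightarrow> nat \<Rightarrow> real \<Rightarrow> 'a \<Rightarrow> real vec) \<Rightarrow> (real \<Rightarrow> 'a \<Rightarrow> real vec) \<Rightarrow> real" where
  "level3_cost g P \<rho> M j u3 x = cost3 g M j (level2_announced g P \<rho> u3 x) u3 x"

definition level3_nash ::
    "game \<Rightarrow> (real \<Rightarrow> real mat) \<Rightarrow> (nat \<Rightarrow> nat \<Rightarrow> real \<Rightarrow> real mat) \<Rightarrow>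
     (nat \<Rightarrow> nat \<Rightarrow> real \<Rightarrow> real mat) \<Rightarrow> (nat \<Rightarrow> nat \<Rightarrow> real \<Rightarrow> real mat) \<Rightarrow>
     'a measure \<Rightarrow> (real \<Rightarrow> 'a \<Rightarrow> real) \<Rightarrow> (nat \<Rightarrow> nat \<Rightarrow> real \<Rightarrow> 'a \<Rightarrow> real vec) \<Rightarrow> bool" where
  "level3_nash g P \<eta> \<zeta> \<rho> M W u3 \<longleftrightarrow>
     (\<forall>j\<in>{1..3}. \<forall>i\<in>{1..2}. admissible3 g M W u3 j i) \<and>
     (\<forall>j\<in>{1..3}. \<forall>w3 x y.
        (\<forall>i\<in>{1..2}. admissible3 g M W w3 j i) \<longrightarrow>
        level3_state g P \<eta> \<zeta> \<rho> M W u3 x \<longrightarrow>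
        level3_state g P \<eta> \<zeta> \<rho> M W (u3(j := w3 j)) y \<longrightarrow>
        level3_cost g P \<rho> M j u3 x \<le> level3_cost g P \<rho> M j (u3(j := w3 j)) y)"

end

(* Along the team controls the incentive terms cancel: replacing u_{3ji} by -K_{3ji} y in the Level 3
   dynamics gives exactly the drift and the diffusion of the team dynamics at y. Hence the hat state
   and the team state solve two Ito equations with the same initial value whose coefficients
   differ by A_hat (x - y) and C_hat (x - y), and A_hat, C_hat are bounded. Uniqueness follows from
   the Ito isometry, the Cauchy-Schwarz inequality and Gronwall's lemma. The isometry is only needed for differences of
   simple processes; it is read off from the covariances of the terms xi (W_b - W_a), which avoids
   common refinements of partitions. *)
theory Submission
  imports Defs "Jordan_Normal_Form.Determinant"
begin

section \<open>Isometry for simple integrands\<close>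

text \<open>Three gaps in the data shape the proof. First, \<open>has_ito_integral\<close> describes
  an integral only through some approximating sequence, and the two states bring unrelated sequences
  on unrelated partitions. The difference of the integrals is therefore compared with that of the
  integrands through the triangle inequality; this loses a constant factor, which Gronwall's lemma
  tolerates. Second, \<open>brownian_motion\<close> states independence of the natural filtration,
  while integrands are adapted to the augmented one, so null sets must be disposed of. Third, the
  controls agree almost surely at each fixed time, which says nothing about a single path; Fubini
  turns this into agreement at almost every time along almost every path. This is why the uniqueness
  statement asks for its Lipschitz bound at almost every time only. The bounds on
  \<open>A_hat\<close> and \<open>C_hat\<close> reduce to bounds on inverses: for the weights they
  come from uniform positivity, for \<open>Nmat\<close> from \<open>riccati_solution\<close>. The
  Nash hypotheses supply the measurability of the controls that Fubini requires.\<close>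

lemma space_augmented [simp]: "space (augmented_filtration M W t) = space M"
  unfolding augmented_filtration_def by (rule space_measure_of_conv)

lemma space_natural [simp]: "space (natural_filtration M W t) = space M"
  unfolding natural_filtration_def by (rule space_measure_of_conv)

lemma augmented_generator_Pow:
  "{W r -` S \<inter> space M |r S. 0 \<le> r \<and> r \<le> t \<and> S \<in> sets borel} \<union> null_sets M \<subseteq> Pow (space M)"
  using sets.sets_into_space by (fastforce simp: null_sets_def)

lemma sets_augmented:
  "sets (augmented_filtration M W t) = sigma_sets (space M)
     ({W r -` S \<inter> space M |r S. 0 \<le> r \<and> r \<le> t \<and> S \<in> sets borel} \<union> null_sets M)"
  unfolding augmented_filtration_def by (rule sets_measure_of[OF augmented_generator_Pow])

lemma sets_natural:
  "sets (natural_filtration M W t) = sigma_sets (space M)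
     {W r -` S \<inter> space M |r S. 0 \<le> r \<and> r \<le> t \<and> S \<in> sets borel}"
  unfolding natural_filtration_def by (rule sets_measure_of) auto

lemma sets_augmented_mono:
  assumes "s \<le> t"
  shows "sets (augmented_filtration M W s) \<subseteq> sets (augmented_filtration M W t)"
  unfolding sets_augmented by (rule sigma_sets_mono') (use assms order_trans in blast)

section \<open>Increments and the augmented past\<close>

locale brownian = prob_space M for M :: "'a measure" +
  fixes W :: "real \<Rightarrow> 'a \<Rightarrow> real"
  assumes bm: "brownian_motion M W"
begin

abbreviation F where "F t \<equiv> augmented_filtration M W t"

lemma W_measurable [measurable]: "0 \<le> t \<Longrightarrow> W t \<in> borel_measurable M"
  using bm unfolding brownian_motion_def by blast

lemma sets_F_le: "sets (F t) \<subseteq> sets M"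
proof -
  have "{W r -` S \<inter> space M |r S. 0 \<le> r \<and> r \<le> t \<and> S \<in> sets borel} \<union> null_sets M \<subseteq> sets M"
    using W_measurable measurable_sets by (fastforce simp: null_sets_def)
  thus ?thesis unfolding sets_augmented by (rule sets.sigma_sets_subset)
qed

lemma measurable_F_le: "Z \<in> measurable (F t) N \<Longrightarrow> Z \<in> measurable M N"
  using sets_F_le by (auto simp: measurable_def)

lemma measurable_F_mono: "s \<le> t \<Longrightarrow> Z \<in> measurable (F s) N \<Longrightarrow> Z \<in> measurable (F t) N"
  using sets_augmented_mono[of s t M W] by (auto simp: measurable_def)

lemma W_measurable_F: "0 \<le> r \<Longrightarrow> r \<le> t \<Longrightarrow> W r \<in> borel_measurable (F t)"
proof (rule measurableI)
  fix A :: "real set" assume "0 \<le> r" "r \<le> t" "A \<in> sets borel"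
  thus "W r -` A \<inter> space (F t) \<in> sets (F t)"
    unfolding sets_augmented space_augmented by (intro sigma_sets.Basic) blast
qed simp

text \<open>The sets that agree almost everywhere with a set of the natural filtration form a
  sigma-algebra, and both kinds of generators belong to it: a null set agrees with the empty set.
  This lets independence pass from the natural to the augmented filtration.\<close>

lemma augmented_eq_natural_AE:
  assumes "A \<in> sets (F s)"
  shows "\<exists>B\<in>sets (natural_filtration M W s). AE \<omega> in M. \<omega> \<in> A \<longleftrightarrow> \<omega> \<in> B"
  using assms unfolding sets_augmented
proof (induction rule: sigma_sets.induct)
  case (Basic a)
  show ?case
  proof (cases "a \<in> null_sets M")
    case True
    hence "AE \<omega> in M. \<omega> \<in> a \<longleftrightarrow> \<omega> \<in> {}" by (simp add: AE_not_in)
    thus ?thesis by (intro bexI[of _ "{}"]) auto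
  next
    case False
    hence "a \<in> sets (natural_filtration M W s)"
      using Basic unfolding sets_natural by (intro sigma_sets.Basic) blast
    thus ?thesis by auto
  qed
next
  case Empty
  show ?case by (intro bexI[of _ "{}"]) auto
next
  case (Compl a)
  then obtain B where B: "B \<in> sets (natural_filtration M W s)" "AE \<omega> in M. \<omega> \<in> a \<longleftrightarrow> \<omega> \<in> B" by blast
  have "space M - B \<in> sets (natural_filtration M W s)"
    using sets.compl_sets[OF B(1)] by simp
  moreover have "AE \<omega> in M. \<omega> \<in> space M - a \<longleftrightarrow> \<omega> \<in> space M - B" using B(2) by eventually_elim auto
  ultimately show ?case by blast
next
  case (Union a)
  hence "\<forall>i. \<exists>B. B \<in> sets (natural_filtration M W s) \<and> (AE \<omega> in M. \<omega> \<in> a i \<longleftrightarrow> \<omega> \<in> B)" by blast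
  then obtain B where B: "\<And>i. B i \<in> sets (natural_filtration M W s)"
      "\<And>i::nat. AE \<omega> in M. \<omega> \<in> a i \<longleftrightarrow> \<omega> \<in> B i" by metis
  have "AE \<omega> in M. \<forall>i. \<omega> \<in> a i \<longleftrightarrow> \<omega> \<in> B i" using B(2) by (simp add: AE_all_countable)
  hence "AE \<omega> in M. \<omega> \<in> (\<Union>i. a i) \<longleftrightarrow> \<omega> \<in> (\<Union>i. B i)" by eventually_elim auto
  moreover have "(\<Union>i. B i) \<in> sets (natural_filtration M W s)" using B(1) by blast
  ultimately show ?case by blast
qed

lemma sets_natural_le: "sets (natural_filtration M W s) \<subseteq> sets (F s)"
  unfolding sets_natural sets_augmented by (rule sigma_sets_mono') auto

text \<open>Probabilities of \<open>a\<close> and \<open>a \<inter> b\<close> do not change when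
  \<open>a\<close> is replaced by an almost everywhere equal set of the natural filtration, for
  which \<open>brownian_motion\<close> gives independence. Measurability with respect to
  \<open>F s\<close> is what \<open>simple_process_data\<close> offers for the coefficients.\<close>

lemma indep_increment:
  assumes "0 \<le> s" "s < t" and Z: "Z \<in> borel_measurable (F s)"
  shows "indep_var borel Z borel (\<lambda>\<omega>. W t \<omega> - W s \<omega>)"
proof -
  let ?D = "\<lambda>\<omega>. W t \<omega> - W s \<omega>"
  let ?I = "{?D -` S \<inter> space M | S. S \<in> sets borel}"
  have ind: "indep_set ?I (sets (natural_filtration M W s))"
    using bm assms unfolding brownian_motion_def by blast
  have mD: "?D \<in> borel_measurable M" using assms by (intro borel_measurable_diff W_measurable) auto
  \<comment> \<open>The preimages under \<open>?D\<close> already form a sigma-algebra, so the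
    generated one that \<open>indep_var_eq\<close> asks for is \<open>?I\<close> itself.\<close>
  have sD: "sigma_sets (space M) ?I = ?I"
  proof -
    have "?I = sets (vimage_algebra (space M) ?D borel)"
      by (auto simp: sets_vimage_algebra2)
    thus ?thesis using sets.sigma_sets_eq[of "vimage_algebra (space M) ?D borel"] by simp
  qed
  have sZ: "sigma_sets (space M) {Z -` S \<inter> space M | S. S \<in> sets borel} \<subseteq> sets (F s)"
    using sets.sigma_sets_subset[of "{Z -` S \<inter> space M | S. S \<in> sets borel}" "F s"]
      measurable_sets[OF Z] by auto
  have "indep_set (sets (F s)) ?I"
  proof (subst indep_sets2_eq, intro conjI ballI)
    show "sets (F s) \<subseteq> events" by (rule sets_F_le)
    show "?I \<subseteq> events" using measurable_sets[OF mD] by auto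
    fix a b assume a: "a \<in> sets (F s)" and b: "b \<in> ?I"
    obtain B where B: "B \<in> sets (natural_filtration M W s)" "AE \<omega> in M. \<omega> \<in> a \<longleftrightarrow> \<omega> \<in> B"
      using augmented_eq_natural_AE[OF a] by blast
    have m: "a \<in> events" "B \<in> events" "b \<in> events"
      using a B sets_F_le[of s] sets_natural_le[of s] b measurable_sets[OF mD] by auto
    have "prob (a \<inter> b) = prob (B \<inter> b)"
      by (rule finite_measure_eq_AE) (use B m in auto)
    also have "\<dots> = prob B * prob b"
      using indep_setD[OF ind b B(1)] by (simp add: Int_commute mult.commute)
    also have "prob B = prob a" by (rule finite_measure_eq_AE) (use B m in auto)
    finally show "prob (a \<inter> b) = prob a * prob b" .
  qed
  hence "indep_set (sigma_sets (space M) {Z -` S \<inter> space M | S. S \<in> sets borel}) (sigma_sets (space M) ?I)"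
    unfolding sD unfolding indep_set_def
    by (rule indep_sets_mono_sets) (use sZ in \<open>auto split: bool.splits\<close>)
  thus ?thesis unfolding indep_var_eq using mD measurable_F_le[OF Z] by auto
qed

text \<open>\<open>brownian_motion\<close> gives the Gaussian law for \<open>s < t\<close> only; the
  degenerate increment is treated in \<open>mult_increment\<close>.\<close>

lemma increment_moments:
  assumes "0 \<le> s" "s < t"
  shows "integrable M (\<lambda>\<omega>. (W t \<omega> - W s \<omega>) ^ k)"
    and "expectation (\<lambda>\<omega>. W t \<omega> - W s \<omega>) = 0"
    and "expectation (\<lambda>\<omega>. (W t \<omega> - W s \<omega>)\<^sup>2) = t - s"
proof -
  have D: "distributed M lborel (\<lambda>\<omega>. W t \<omega> - W s \<omega>) (normal_density 0 (sqrt (t - s)))"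
    using bm assms unfolding brownian_motion_def by blast
  have "0 < sqrt (t - s)" using assms by simp
  note [simp] = this
  show "integrable M (\<lambda>\<omega>. (W t \<omega> - W s \<omega>) ^ k)"
  proof -
    have "integrable lborel (\<lambda>x. normal_density 0 (sqrt (t - s)) x * x ^ k)"
      using integrable_normal_moment[of "sqrt (t - s)" 0 k] assms by simp
    thus ?thesis using distributed_integrable[OF D, of "\<lambda>x. x ^ k"] by simp
  qed
  show "expectation (\<lambda>\<omega>. W t \<omega> - W s \<omega>) = 0"
    using normal_distributed_expectation[OF _ D] assms by simp
  show "expectation (\<lambda>\<omega>. (W t \<omega> - W s \<omega>)\<^sup>2) = t - s"
    using normal_distributed_variance[OF _ D] normal_distributed_expectation[OF _ D] assms by simp
qed

lemma mult_increment:
  assumes st: "0 \<le> s" "s \<le> t" and Z: "Z \<in> borel_measurable (F s)" "integrable M Z"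
  shows "integrable M (\<lambda>\<omega>. Z \<omega> * (W t \<omega> - W s \<omega>))"
    and "integrable M (\<lambda>\<omega>. Z \<omega> * (W t \<omega> - W s \<omega>)\<^sup>2)"
    and "expectation (\<lambda>\<omega>. Z \<omega> * (W t \<omega> - W s \<omega>)) = 0"
    and "expectation (\<lambda>\<omega>. Z \<omega> * (W t \<omega> - W s \<omega>)\<^sup>2) = expectation Z * (t - s)"
proof -
  let ?D = "\<lambda>\<omega>. W t \<omega> - W s \<omega>"
  have "integrable M (\<lambda>\<omega>. Z \<omega> * ?D \<omega>) \<and> integrable M (\<lambda>\<omega>. Z \<omega> * (?D \<omega>)\<^sup>2)
    \<and> expectation (\<lambda>\<omega>. Z \<omega> * ?D \<omega>) = 0 \<and> expectation (\<lambda>\<omega>. Z \<omega> * (?D \<omega>)\<^sup>2) = expectation Z * (t - s)"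
  proof (cases "s = t")
    case False
    hence st': "s < t" using st by simp
    have i1: "indep_var borel Z borel ?D" by (rule indep_increment[OF st(1) st' Z(1)])
    have "indep_var borel ((\<lambda>x. x) \<circ> Z) borel ((\<lambda>x. x\<^sup>2) \<circ> ?D)"
      by (rule indep_var_compose[OF i1]) auto
    hence i2: "indep_var borel Z borel (\<lambda>\<omega>. (?D \<omega>)\<^sup>2)" by (simp add: comp_def)
    note m = increment_moments[OF st(1) st']
    have m1: "integrable M ?D" using m(1)[of 1] by simp
    show ?thesis
      using indep_var_integrable[OF i1 Z(2) m1] indep_var_integrable[OF i2 Z(2) m(1)[of 2]]
        indep_var_lebesgue_integral[OF i1 Z(2) m1] indep_var_lebesgue_integral[OF i2 Z(2) m(1)[of 2]] m
      by simp
  qed simp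
  thus "integrable M (\<lambda>\<omega>. Z \<omega> * (W t \<omega> - W s \<omega>))"
    and "integrable M (\<lambda>\<omega>. Z \<omega> * (W t \<omega> - W s \<omega>)\<^sup>2)"
    and "expectation (\<lambda>\<omega>. Z \<omega> * (W t \<omega> - W s \<omega>)) = 0"
    and "expectation (\<lambda>\<omega>. Z \<omega> * (W t \<omega> - W s \<omega>)\<^sup>2) = expectation Z * (t - s)" by auto
qed

section \<open>Covariances of weighted increments\<close>

definition adapted_bounded :: "real \<Rightarrow> ('a \<Rightarrow> real) \<Rightarrow> bool" where
  "adapted_bounded a \<xi> \<longleftrightarrow> \<xi> \<in> borel_measurable (F a) \<and> (\<exists>c. \<forall>\<omega>\<in>space M. \<bar>\<xi> \<omega>\<bar> \<le> c)"

lemma adapted_bounded_mult: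
  assumes "adapted_bounded a f" "adapted_bounded a g"
  shows "adapted_bounded a (\<lambda>\<omega>. f \<omega> * g \<omega>)"
proof -
  obtain c d where c: "\<And>\<omega>. \<omega> \<in> space M \<Longrightarrow> \<bar>f \<omega>\<bar> \<le> c" "\<And>\<omega>. \<omega> \<in> space M \<Longrightarrow> \<bar>g \<omega>\<bar> \<le> d"
    using assms unfolding adapted_bounded_def by blast
  have "\<bar>f \<omega> * g \<omega>\<bar> \<le> c * d" if "\<omega> \<in> space M" for \<omega>
    unfolding abs_mult using c[OF that] by (intro mult_mono) auto
  thus ?thesis using assms unfolding adapted_bounded_def by auto
qed

lemma adapted_bounded_mono: "adapted_bounded a f \<Longrightarrow> a \<le> b \<Longrightarrow> adapted_bounded b f"
  unfolding adapted_bounded_def using measurable_F_mono by blast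

lemma adapted_bounded_integrable:
  assumes "adapted_bounded a f" "integrable M g"
  shows "integrable M (\<lambda>\<omega>. f \<omega> * g \<omega>)"
proof -
  obtain c where c: "\<And>\<omega>. \<omega> \<in> space M \<Longrightarrow> \<bar>f \<omega>\<bar> \<le> c"
    using assms unfolding adapted_bounded_def by blast
  have m [measurable]: "f \<in> borel_measurable M" "g \<in> borel_measurable M"
    using assms measurable_F_le unfolding adapted_bounded_def by auto
  show ?thesis
  proof (rule Bochner_Integration.integrable_bound[of _ "\<lambda>\<omega>. c * g \<omega>"])
    show "AE \<omega> in M. norm (f \<omega> * g \<omega>) \<le> norm (c * g \<omega>)"
    proof (rule AE_I2)
      fix \<omega> assume "\<omega> \<in> space M"
      hence "\<bar>f \<omega>\<bar> \<le> \<bar>c\<bar>" using c by fastforce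
      thus "norm (f \<omega> * g \<omega>) \<le> norm (c * g \<omega>)" by (simp add: abs_mult mult_right_mono)
    qed
  qed (use assms in auto)
qed

lemma adapted_bounded_integrable': "adapted_bounded a f \<Longrightarrow> integrable M f"
  using adapted_bounded_integrable[of a f "\<lambda>_. 1"] by simp

lemma adapted_boundedD: "adapted_bounded a f \<Longrightarrow> f \<in> borel_measurable (F a)"
  unfolding adapted_bounded_def by blast

text \<open>The square of \<xi> is again bounded and adapted, so this is the second-moment case of
  \<open>mult_increment\<close>.\<close>

lemma increment_term_sq_integrable:
  assumes "0 \<le> a" "a \<le> b" "adapted_bounded a \<xi>"
  shows "integrable M (\<lambda>\<omega>. (\<xi> \<omega> * (W b \<omega> - W a \<omega>))\<^sup>2)"
proof -
  have "adapted_bounded a (\<lambda>\<omega>. \<xi> \<omega> * \<xi> \<omega>)" by (rule adapted_bounded_mult[OF assms(3,3)])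
  hence "integrable M (\<lambda>\<omega>. (\<xi> \<omega> * \<xi> \<omega>) * (W b \<omega> - W a \<omega>)\<^sup>2)"
    by (intro mult_increment(2) assms(1,2) adapted_boundedD adapted_bounded_integrable')
  thus ?thesis by (simp add: power_mult_distrib power2_eq_square ac_simps)
qed

lemma integrable_mult_of_squares:
  fixes f g :: "'a \<Rightarrow> real"
  assumes [measurable]: "f \<in> borel_measurable M" "g \<in> borel_measurable M"
    and "integrable M (\<lambda>x. (f x)\<^sup>2)" "integrable M (\<lambda>x. (g x)\<^sup>2)"
  shows "integrable M (\<lambda>x. f x * g x)"
proof (rule Bochner_Integration.integrable_bound[of _ "\<lambda>x. (f x)\<^sup>2 + (g x)\<^sup>2"])
  have "\<bar>a * b\<bar> \<le> a\<^sup>2 + b\<^sup>2" for a b :: real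
  proof -
    have "2 * \<bar>a * b\<bar> \<le> a\<^sup>2 + b\<^sup>2" using sum_squares_bound[of "\<bar>a\<bar>" "\<bar>b\<bar>"] by (simp add: abs_mult)
    thus ?thesis using abs_ge_zero[of "a * b"] by linarith
  qed
  thus "AE x in M. norm (f x * g x) \<le> norm ((f x)\<^sup>2 + (g x)\<^sup>2)" by (intro AE_I2) simp
qed (use assms in auto)

lemma increment_term_measurable:
  assumes "0 \<le> a" "a \<le> b" "adapted_bounded a \<xi>"
  shows "(\<lambda>\<omega>. \<xi> \<omega> * (W b \<omega> - W a \<omega>)) \<in> borel_measurable M"
proof -
  show ?thesis using assms
    by (intro borel_measurable_times borel_measurable_diff W_measurable
        measurable_F_le[OF adapted_boundedD]) auto
qed

lemma increment_terms_integrable: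
  assumes "0 \<le> a" "a \<le> b" "adapted_bounded a \<xi>" "0 \<le> a'" "a' \<le> b'" "adapted_bounded a' \<xi>'"
  shows "integrable M (\<lambda>\<omega>. (\<xi> \<omega> * (W b \<omega> - W a \<omega>)) * (\<xi>' \<omega> * (W b' \<omega> - W a' \<omega>)))"
  by (intro integrable_mult_of_squares increment_term_sq_integrable increment_term_measurable assms)

text \<open>Cutting the increments at \<open>a'\<close> and at the smaller right end leaves the
  square of the increment over the overlap, whose expectation produces the length
  \<open>max 0 (min b b' - a')\<close>, and mixed terms in which the later increment has mean zero
  given everything before it.\<close>

lemma increment_covariance_ordered:
  assumes a: "0 \<le> a" "a \<le> b" "adapted_bounded a \<xi>" and a': "a' \<le> b'" "adapted_bounded a' \<xi>'"
    and le: "a \<le> a'"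
  shows "expectation (\<lambda>\<omega>. (\<xi> \<omega> * (W b \<omega> - W a \<omega>)) * (\<xi>' \<omega> * (W b' \<omega> - W a' \<omega>)))
    = expectation (\<lambda>\<omega>. \<xi> \<omega> * \<xi>' \<omega>) * max 0 (min b b' - a')"
proof -
  have a'0: "0 \<le> a'" using a le by simp
  let ?e = "\<lambda>\<omega>. \<xi> \<omega> * \<xi>' \<omega>"
  have e: "adapted_bounded a' ?e" by (rule adapted_bounded_mult[OF adapted_bounded_mono[OF a(3) le] a'(2)])
  \<comment> \<open>The part of the first increment before \<open>a'\<close> is orthogonal to the
    second one. This is used with \<open>c = b\<close> for disjoint intervals and with
    \<open>c = a'\<close> for overlapping ones.\<close>
  have before: "integrable M (\<lambda>\<omega>. (?e \<omega> * (W c \<omega> - W a \<omega>)) * (W b' \<omega> - W a' \<omega>))"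
      "expectation (\<lambda>\<omega>. (?e \<omega> * (W c \<omega> - W a \<omega>)) * (W b' \<omega> - W a' \<omega>)) = 0"
    if c: "a \<le> c" "c \<le> a'" for c
  proof -
    have m: "(\<lambda>\<omega>. ?e \<omega> * (W c \<omega> - W a \<omega>)) \<in> borel_measurable (F a')"
    proof -
      have [measurable]: "?e \<in> borel_measurable (F a')" by (rule adapted_boundedD[OF e])
      have [measurable]: "W c \<in> borel_measurable (F a')" "W a \<in> borel_measurable (F a')"
        using c a by (intro W_measurable_F; simp)+
      show ?thesis by measurable
    qed
    have "integrable M (\<lambda>\<omega>. \<xi> \<omega> * (W c \<omega> - W a \<omega>))"
      by (rule mult_increment(1)[OF a(1) c(1) adapted_boundedD[OF a(3)] adapted_bounded_integrable'[OF a(3)]])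
    hence "integrable M (\<lambda>\<omega>. \<xi>' \<omega> * (\<xi> \<omega> * (W c \<omega> - W a \<omega>)))"
      by (rule adapted_bounded_integrable[OF a'(2)])
    hence i: "integrable M (\<lambda>\<omega>. ?e \<omega> * (W c \<omega> - W a \<omega>))"
      by (simp add: ac_simps)
    show "integrable M (\<lambda>\<omega>. (?e \<omega> * (W c \<omega> - W a \<omega>)) * (W b' \<omega> - W a' \<omega>))"
      "expectation (\<lambda>\<omega>. (?e \<omega> * (W c \<omega> - W a \<omega>)) * (W b' \<omega> - W a' \<omega>)) = 0"
      by (rule mult_increment[OF a'0 a'(1) m i])+
  qed
  show ?thesis
  proof (cases "b \<le> a'")
    case True
    have "(\<lambda>\<omega>. (\<xi> \<omega> * (W b \<omega> - W a \<omega>)) * (\<xi>' \<omega> * (W b' \<omega> - W a' \<omega>)))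
        = (\<lambda>\<omega>. (?e \<omega> * (W b \<omega> - W a \<omega>)) * (W b' \<omega> - W a' \<omega>))" by (simp add: ac_simps)
    thus ?thesis using before[of b] a True by simp
  next
    case False
    define c d where "c = min b b'" and "d = max b b'"
    have cd: "a' \<le> c" "c \<le> d" "0 \<le> c" using False a' a'0 unfolding c_def d_def by auto
    \<comment> \<open>Past \<open>a'\<close> the two increments run up to \<open>c\<close> and up to
      \<open>d\<close>, in either order; the longer one is split at \<open>c\<close>.\<close>
    have eq: "(\<lambda>\<omega>. (\<xi> \<omega> * (W b \<omega> - W a \<omega>)) * (\<xi>' \<omega> * (W b' \<omega> - W a' \<omega>)))
        = (\<lambda>\<omega>. (?e \<omega> * (W a' \<omega> - W a \<omega>)) * (W b' \<omega> - W a' \<omega>) + ?e \<omega> * (W c \<omega> - W a' \<omega>)\<^sup>2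
              + (?e \<omega> * (W c \<omega> - W a' \<omega>)) * (W d \<omega> - W c \<omega>))"
      by (rule ext, cases "b \<le> b'") (simp_all add: c_def d_def algebra_simps power2_eq_square min_def max_def)
    have m: "(\<lambda>\<omega>. ?e \<omega> * (W c \<omega> - W a' \<omega>)) \<in> borel_measurable (F c)"
    proof -
      have [measurable]: "?e \<in> borel_measurable (F c)"
        by (rule adapted_boundedD[OF adapted_bounded_mono[OF e cd(1)]])
      have [measurable]: "W c \<in> borel_measurable (F c)" "W a' \<in> borel_measurable (F c)"
        using cd a'0 by (intro W_measurable_F; simp)+
      show ?thesis by measurable
    qed
    have em: "?e \<in> borel_measurable (F a')" "integrable M ?e"
      by (rule adapted_boundedD[OF e], rule adapted_bounded_integrable'[OF e])
    note m1 = mult_increment[OF a'0 cd(1) em]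
    note m2 = mult_increment[OF cd(3) cd(2) m m1(1)]
    note m0 = before[OF le order_refl]
    have "expectation (\<lambda>\<omega>. (\<xi> \<omega> * (W b \<omega> - W a \<omega>)) * (\<xi>' \<omega> * (W b' \<omega> - W a' \<omega>)))
       = 0 + expectation ?e * (c - a') + 0"
      unfolding eq using m0 m1 m2 by simp
    moreover have "max 0 (min b b' - a') = c - a'" using cd unfolding c_def by simp
    ultimately show ?thesis by simp
  qed
qed

lemma increment_covariance:
  assumes "0 \<le> a" "a \<le> b" "adapted_bounded a \<xi>" "0 \<le> a'" "a' \<le> b'" "adapted_bounded a' \<xi>'"
  shows "expectation (\<lambda>\<omega>. (\<xi> \<omega> * (W b \<omega> - W a \<omega>)) * (\<xi>' \<omega> * (W b' \<omega> - W a' \<omega>)))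
    = expectation (\<lambda>\<omega>. \<xi> \<omega> * \<xi>' \<omega>) * max 0 (min b b' - max a a')"
proof (cases "a \<le> a'")
  case True
  thus ?thesis using increment_covariance_ordered[OF assms(1-3,5,6)] by (simp add: max_def)
next
  case False
  thus ?thesis using increment_covariance_ordered[OF assms(4-6) assms(2,3)]
    by (simp add: max_def min.commute mult.commute)
qed

text \<open>Both sides expand into the double sum of the expectations of
  \<open>\<xi> i * \<xi> j\<close> times the overlap lengths: on the left by
  \<open>increment_covariance\<close>, on the right because a product of interval indicators is the
  indicator of the intersection. The intervals may overlap arbitrarily, so that the difference of
  two simple integrals is a single instance.\<close>

lemma increment_isometry:
  assumes L: "finite L"
    and l: "\<And>l. l \<in> L \<Longrightarrow> 0 \<le> a l \<and> a l \<le> b l \<and> adapted_bounded (a l) (\<xi> l)"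
  shows "(\<integral>\<^sup>+\<omega>. ennreal ((\<Sum>l\<in>L. \<xi> l \<omega> * (W (b l) \<omega> - W (a l) \<omega>))\<^sup>2) \<partial>M)
    = (\<integral>\<^sup>+\<omega>. (\<integral>\<^sup>+t. ennreal ((\<Sum>l\<in>L. \<xi> l \<omega> * indicator {a l<..b l} t)\<^sup>2) \<partial>lborel) \<partial>M)"
proof -
  let ?m = "\<lambda>i j. max 0 (min (b i) (b j) - max (a i) (a j))"
  let ?t = "\<lambda>l \<omega>. \<xi> l \<omega> * (W (b l) \<omega> - W (a l) \<omega>)"
  have ti: "integrable M (\<lambda>\<omega>. ?t i \<omega> * ?t j \<omega>)" if "i \<in> L" "j \<in> L" for i j
    using increment_terms_integrable l that by blast
  have xi: "integrable M (\<lambda>\<omega>. \<xi> i \<omega> * \<xi> j \<omega>)" if "i \<in> L" "j \<in> L" for i j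
    using adapted_bounded_integrable adapted_bounded_integrable' l that by blast
  have sq: "(\<lambda>\<omega>. (\<Sum>l\<in>L. ?t l \<omega>)\<^sup>2) = (\<lambda>\<omega>. \<Sum>i\<in>L. \<Sum>j\<in>L. ?t i \<omega> * ?t j \<omega>)"
    by (simp add: power2_eq_square sum_product)
  have "(\<integral>\<^sup>+\<omega>. ennreal ((\<Sum>l\<in>L. ?t l \<omega>)\<^sup>2) \<partial>M) = ennreal (expectation (\<lambda>\<omega>. (\<Sum>l\<in>L. ?t l \<omega>)\<^sup>2))"
    by (rule nn_integral_eq_integral) (use ti in \<open>auto simp: sq\<close>)
  also have "expectation (\<lambda>\<omega>. (\<Sum>l\<in>L. ?t l \<omega>)\<^sup>2) = (\<Sum>i\<in>L. \<Sum>j\<in>L. expectation (\<lambda>\<omega>. ?t i \<omega> * ?t j \<omega>))"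
    unfolding sq using ti by (simp add: Bochner_Integration.integral_sum)
  also have "\<dots> = (\<Sum>i\<in>L. \<Sum>j\<in>L. expectation (\<lambda>\<omega>. \<xi> i \<omega> * \<xi> j \<omega>) * ?m i j)"
    by (intro sum.cong refl increment_covariance) (use l in auto)
  also have "\<dots> = expectation (\<lambda>\<omega>. \<Sum>i\<in>L. \<Sum>j\<in>L. \<xi> i \<omega> * \<xi> j \<omega> * ?m i j)"
    using xi by (simp add: Bochner_Integration.integral_sum)
  finally have 1: "(\<integral>\<^sup>+\<omega>. ennreal ((\<Sum>l\<in>L. ?t l \<omega>)\<^sup>2) \<partial>M)
      = ennreal (expectation (\<lambda>\<omega>. \<Sum>i\<in>L. \<Sum>j\<in>L. \<xi> i \<omega> * \<xi> j \<omega> * ?m i j))" .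
  have inner: "(\<integral>\<^sup>+t. ennreal ((\<Sum>l\<in>L. \<xi> l \<omega> * indicator {a l<..b l} t)\<^sup>2) \<partial>lborel)
      = ennreal (\<Sum>i\<in>L. \<Sum>j\<in>L. \<xi> i \<omega> * \<xi> j \<omega> * ?m i j)"
    and inner_nn: "0 \<le> (\<Sum>i\<in>L. \<Sum>j\<in>L. \<xi> i \<omega> * \<xi> j \<omega> * ?m i j)" for \<omega>
  proof -
    have eq: "(\<lambda>t::real. (\<Sum>l\<in>L. \<xi> l \<omega> * indicator {a l<..b l} t)\<^sup>2)
        = (\<lambda>t. \<Sum>i\<in>L. \<Sum>j\<in>L. \<xi> i \<omega> * \<xi> j \<omega> * indicator {max (a i) (a j)<..min (b i) (b j)} t)"
      by (rule ext) (auto simp: power2_eq_square sum_product indicator_def intro!: sum.cong)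
    have int: "integrable lborel (indicator {p<..q} :: real \<Rightarrow> real)"
      and val: "measure lborel {p<..q} = max 0 (q - p)" for p q :: real
      by (cases "p \<le> q"; simp add: max_def)+
    have I: "integral\<^sup>L lborel (\<lambda>t. (\<Sum>l\<in>L. \<xi> l \<omega> * indicator {a l<..b l} t)\<^sup>2)
        = (\<Sum>i\<in>L. \<Sum>j\<in>L. \<xi> i \<omega> * \<xi> j \<omega> * ?m i j)"
      unfolding eq using int by (simp add: Bochner_Integration.integral_sum val)
    show "(\<integral>\<^sup>+t. ennreal ((\<Sum>l\<in>L. \<xi> l \<omega> * indicator {a l<..b l} t)\<^sup>2) \<partial>lborel)
      = ennreal (\<Sum>i\<in>L. \<Sum>j\<in>L. \<xi> i \<omega> * \<xi> j \<omega> * ?m i j)"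
      unfolding I[symmetric] by (rule nn_integral_eq_integral) (use int in \<open>auto simp: eq\<close>)
    \<comment> \<open>Single terms may be negative. The sum is nonnegative as the integral of a
      square, which the passage from \<open>nn_integral\<close> to \<open>expectation\<close>
      requires.\<close>
    show "0 \<le> (\<Sum>i\<in>L. \<Sum>j\<in>L. \<xi> i \<omega> * \<xi> j \<omega> * ?m i j)"
      unfolding I[symmetric] by (rule integral_nonneg_AE) simp
  qed
  have "(\<integral>\<^sup>+\<omega>. (\<integral>\<^sup>+t. ennreal ((\<Sum>l\<in>L. \<xi> l \<omega> * indicator {a l<..b l} t)\<^sup>2) \<partial>lborel) \<partial>M)
      = ennreal (expectation (\<lambda>\<omega>. \<Sum>i\<in>L. \<Sum>j\<in>L. \<xi> i \<omega> * \<xi> j \<omega> * ?m i j))"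
    unfolding inner by (rule nn_integral_eq_integral) (use xi inner_nn in auto)
  thus ?thesis using 1 by simp
qed

end

section \<open>Differences of Ito integrals\<close>

lemma simple_process_data_nonneg:
  assumes "simple_process_data M W T N \<tau> \<xi>" "l \<le> N"
  shows "0 \<le> \<tau> l"
  using assms(2)
proof (induction l)
  case 0
  thus ?case using assms(1) unfolding simple_process_data_def by simp
next
  case (Suc l)
  hence "\<tau> l \<le> \<tau> (Suc l)" using assms(1) unfolding simple_process_data_def by simp
  thus ?case using Suc by simp
qed

lemma square_sum3_le: "(a + b + c)\<^sup>2 \<le> 3 * a\<^sup>2 + 3 * b\<^sup>2 + 3 * (c::real)\<^sup>2"
proof -
  have "3 * a\<^sup>2 + 3 * b\<^sup>2 + 3 * c\<^sup>2 - (a + b + c)\<^sup>2 = (a - b)\<^sup>2 + (b - c)\<^sup>2 + (a - c)\<^sup>2"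
    by (simp add: power2_eq_square algebra_simps)
  moreover have "0 \<le> (a - b)\<^sup>2 + (b - c)\<^sup>2 + (a - c)\<^sup>2" by simp
  ultimately show ?thesis by linarith
qed

lemma ennreal_square_sum3_le:
  "ennreal ((a + b + c)\<^sup>2) \<le> 3 * ennreal (a\<^sup>2) + 3 * ennreal (b\<^sup>2) + 3 * ennreal (c\<^sup>2)"
proof -
  have "ennreal ((a + b + c)\<^sup>2) \<le> ennreal (3 * a\<^sup>2 + 3 * b\<^sup>2 + 3 * c\<^sup>2)"
    by (rule ennreal_leI[OF square_sum3_le])
  also have "\<dots> = 3 * ennreal (a\<^sup>2) + 3 * ennreal (b\<^sup>2) + 3 * ennreal (c\<^sup>2)"
    by (simp add: ennreal_plus ennreal_mult'')
  finally show ?thesis .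
qed

context brownian
begin

text \<open>The disjoint union of the two index sets, with the signs of the second family reversed,
  makes the difference one instance of \<open>increment_isometry\<close>. Truncating all partition
  points at \<open>t\<close> corresponds to restricting the time integral to
  \<open>{0..t}\<close>.\<close>

lemma simple_ito_diff_isometry:
  assumes d1: "simple_process_data M W T N1 \<tau>1 \<xi>1" and d2: "simple_process_data M W T N2 \<tau>2 \<xi>2"
    and t: "0 \<le> t"
  shows "(\<integral>\<^sup>+\<omega>. ennreal ((simple_ito_integral W N1 \<tau>1 \<xi>1 t \<omega> - simple_ito_integral W N2 \<tau>2 \<xi>2 t \<omega>)\<^sup>2) \<partial>M)
    = (\<integral>\<^sup>+\<omega>. (\<integral>\<^sup>+s\<in>{0..t}. ennreal ((simple_process N1 \<tau>1 \<xi>1 s \<omega> - simple_process N2 \<tau>2 \<xi>2 s \<omega>)\<^sup>2) \<partial>lborel) \<partial>M)"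
proof -
  define L where "L = {..<N1} <+> {..<N2}"
  define a where "a = case_sum (\<lambda>l. min t (\<tau>1 l)) (\<lambda>l. min t (\<tau>2 l))"
  define b where "b = case_sum (\<lambda>l. min t (\<tau>1 (Suc l))) (\<lambda>l. min t (\<tau>2 (Suc l)))"
  \<comment> \<open>If the left end lies beyond \<open>t\<close>, the truncated interval is empty
    but starts at \<open>t\<close>, where the coefficient need not be measurable. Replacing it by 0
    restores adaptedness without changing the sum.\<close>
  define \<xi> where "\<xi> = case_sum (\<lambda>l \<omega>. if \<tau>1 l \<le> t then \<xi>1 l \<omega> else 0) (\<lambda>l \<omega>. if \<tau>2 l \<le> t then - \<xi>2 l \<omega> else 0)"
  have fin: "finite L" unfolding L_def by simp
  have nn1: "0 \<le> \<tau>1 l" "0 \<le> \<tau>1 (Suc l)" "\<tau>1 l \<le> \<tau>1 (Suc l)" if "l < N1" for l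
    using that simple_process_data_nonneg[OF d1, of l] simple_process_data_nonneg[OF d1, of "Suc l"] d1
    unfolding simple_process_data_def by auto
  have nn2: "0 \<le> \<tau>2 l" "0 \<le> \<tau>2 (Suc l)" "\<tau>2 l \<le> \<tau>2 (Suc l)" if "l < N2" for l
    using that simple_process_data_nonneg[OF d2, of l] simple_process_data_nonneg[OF d2, of "Suc l"] d2
    unfolding simple_process_data_def by auto
  \<comment> \<open>The factor \<open>c\<close> will be 1 for the first family and -1 for the
    second.\<close>
  have ad: "adapted_bounded (min t (\<tau> l)) (\<lambda>\<omega>. if \<tau> l \<le> t then c * \<xi>' l \<omega> else 0)"
    if "simple_process_data M W T N \<tau> \<xi>'" "l < N" for c :: real and N \<tau> \<xi>' l
  proof (cases "\<tau> l \<le> t")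
    case True
    have 1: "adapted_bounded (\<tau> l) (\<xi>' l)"
      using that unfolding adapted_bounded_def simple_process_data_def by blast
    have 2: "adapted_bounded (\<tau> l) (\<lambda>_. c)" unfolding adapted_bounded_def by auto
    show ?thesis using adapted_bounded_mult[OF 2 1] True by (simp add: min_def)
  qed (auto simp: adapted_bounded_def)
  have ad1: "adapted_bounded (min t (\<tau>1 l)) (\<lambda>\<omega>. if \<tau>1 l \<le> t then \<xi>1 l \<omega> else 0)" if "l < N1" for l
    using ad[OF d1 that, of 1] unfolding mult_1 .
  have ad2: "adapted_bounded (min t (\<tau>2 l)) (\<lambda>\<omega>. if \<tau>2 l \<le> t then - \<xi>2 l \<omega> else 0)" if "l < N2" for l
    using ad[OF d2 that, of "-1"] unfolding mult_minus1 .
  have l: "0 \<le> a l \<and> a l \<le> b l \<and> adapted_bounded (a l) (\<xi> l)" if "l \<in> L" for l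
    using that t nn1 nn2 ad1 ad2
    unfolding L_def a_def b_def \<xi>_def by (auto simp: min.coboundedI2)
  have e1: "(\<Sum>l\<in>L. \<xi> l \<omega> * (W (b l) \<omega> - W (a l) \<omega>))
      = simple_ito_integral W N1 \<tau>1 \<xi>1 t \<omega> - simple_ito_integral W N2 \<tau>2 \<xi>2 t \<omega>" for \<omega>
  proof -
    have "(if \<tau>1 l \<le> t then \<xi>1 l \<omega> else 0) * (W (min t (\<tau>1 (Suc l))) \<omega> - W (min t (\<tau>1 l)) \<omega>)
      = \<xi>1 l \<omega> * (W (min t (\<tau>1 (Suc l))) \<omega> - W (min t (\<tau>1 l)) \<omega>)" if "l < N1" for l
      using nn1[OF that] by (auto simp: min_def)
    moreover have "(if \<tau>2 l \<le> t then - \<xi>2 l \<omega> else 0) * (W (min t (\<tau>2 (Suc l))) \<omega> - W (min t (\<tau>2 l)) \<omega>)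
      = - (\<xi>2 l \<omega> * (W (min t (\<tau>2 (Suc l))) \<omega> - W (min t (\<tau>2 l)) \<omega>))" if "l < N2" for l
      using nn2[OF that] by (auto simp: min_def)
    ultimately show ?thesis
      unfolding L_def a_def b_def \<xi>_def simple_ito_integral_def diff_conv_add_uminus[of "sum _ _"] sum_negf[symmetric]
      by (subst sum.Plus) (auto intro!: arg_cong2[where f = "(+)"] sum.cong)
  qed
  have e2: "ennreal ((\<Sum>l\<in>L. \<xi> l \<omega> * indicator {a l<..b l} s)\<^sup>2)
      = ennreal ((simple_process N1 \<tau>1 \<xi>1 s \<omega> - simple_process N2 \<tau>2 \<xi>2 s \<omega>)\<^sup>2) * indicator {0..t} s" for s \<omega>
  proof -
    have "(if \<tau>1 l \<le> t then \<xi>1 l \<omega> else 0) * indicator {min t (\<tau>1 l)<..min t (\<tau>1 (Suc l))} s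
      = indicator {0..t} s * (\<xi>1 l \<omega> * indicator {\<tau>1 l<..\<tau>1 (Suc l)} s)" if "l < N1" for l
      using nn1[OF that] by (auto simp: min_def indicator_def)
    moreover have "(if \<tau>2 l \<le> t then - \<xi>2 l \<omega> else 0) * indicator {min t (\<tau>2 l)<..min t (\<tau>2 (Suc l))} s
      = - (indicator {0..t} s * (\<xi>2 l \<omega> * indicator {\<tau>2 l<..\<tau>2 (Suc l)} s))" if "l < N2" for l
      using nn2[OF that] by (auto simp: min_def indicator_def)
    ultimately have "(\<Sum>l\<in>L. \<xi> l \<omega> * indicator {a l<..b l} s)
       = indicator {0..t} s * (simple_process N1 \<tau>1 \<xi>1 s \<omega> - simple_process N2 \<tau>2 \<xi>2 s \<omega>)"
      unfolding L_def a_def b_def \<xi>_def simple_process_def diff_conv_add_uminus[of "sum _ _"] sum_negf[symmetric]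
        distrib_left sum_distrib_left
      by (subst sum.Plus) (auto intro!: arg_cong2[where f = "(+)"] sum.cong simp del: sum_mult_indicator)
    thus ?thesis by (simp add: indicator_def)
  qed
  show ?thesis using increment_isometry[of L a b \<xi>, OF fin l] unfolding e1 e2 .
qed

text \<open>Progressive measurability at the final time \<open>T\<close> is joint measurability on
  \<open>{0..T}\<close> with respect to \<open>F T\<close>, and the indicator extends the process by
  zero to all times. The factors are swapped to match the iterated integrals, in which the
  expectation is outermost.\<close>

lemma prog_measurable_pair:
  assumes "prog_measurable M W T \<phi>" "0 \<le> T"
  shows "(\<lambda>(\<omega>, s). indicator {0..T} s * \<phi> s \<omega>) \<in> borel_measurable (M \<Otimes>\<^sub>M lborel)"
proof -
  let ?R = "restrict_space (M \<Otimes>\<^sub>M lborel) (space M \<times> {0..T})"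
  have p: "(\<lambda>(s, \<omega>). \<phi> s \<omega>) \<in> borel_measurable (restrict_space borel {0..T} \<Otimes>\<^sub>M F T)"
    using assms unfolding prog_measurable_def by auto
  have fst: "fst \<in> measurable ?R (F T)"
  proof (rule measurable_restrict_space1)
    have "fst \<in> measurable (M \<Otimes>\<^sub>M lborel) M" by measurable
    thus "fst \<in> measurable (M \<Otimes>\<^sub>M lborel) (F T)" using sets_F_le[of T] by (auto simp: measurable_def)
  qed
  have snd: "snd \<in> measurable ?R (restrict_space borel {0..T})"
    by (rule measurable_restrict_space2) (auto simp: space_restrict_space intro: measurable_restrict_space1)
  have "(\<lambda>x. (\<lambda>(s, \<omega>). \<phi> s \<omega>) (snd x, fst x)) \<in> borel_measurable ?R"
    by (rule measurable_compose[OF measurable_Pair[OF snd fst] p])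
  hence "(\<lambda>x. \<phi> (snd x) (fst x)) \<in> borel_measurable ?R" by simp
  hence "(\<lambda>x. indicator (space M \<times> {0..T}) x *\<^sub>R \<phi> (snd x) (fst x)) \<in> borel_measurable (M \<Otimes>\<^sub>M lborel)"
    by (subst (asm) borel_measurable_restrict_space_iff)
       (auto simp: space_pair_measure intro!: sets.Int pair_measureI)
  moreover have "indicator (space M \<times> {0..T}) x *\<^sub>R \<phi> (snd x) (fst x)
      = (\<lambda>(\<omega>, s). indicator {0..T} s * \<phi> s \<omega>) x" if "x \<in> space (M \<Otimes>\<^sub>M lborel)" for x
    using that by (auto simp: space_pair_measure indicator_def)
  ultimately show ?thesis by (subst measurable_cong[symmetric]) auto
qed

lemma simple_process_pair:
  assumes "simple_process_data M W T N \<tau> \<xi>"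
  shows "(\<lambda>(\<omega>, s). simple_process N \<tau> \<xi> s \<omega>) \<in> borel_measurable (M \<Otimes>\<^sub>M lborel)"
proof -
  have m: "\<xi> l \<in> borel_measurable M" if "l < N" for l
    using assms that measurable_F_le unfolding simple_process_data_def by blast
  show ?thesis unfolding simple_process_def case_prod_beta
  proof (intro borel_measurable_sum borel_measurable_times)
    fix l assume "l \<in> {..<N}"
    hence [measurable]: "\<xi> l \<in> borel_measurable M" using m by simp
    show "(\<lambda>x. \<xi> l (fst x)) \<in> borel_measurable (M \<Otimes>\<^sub>M lborel)" by measurable
  qed measurable
qed

lemma nested_nn_integral_add:
  fixes f g :: "'a \<times> real \<Rightarrow> ennreal"
  assumes [measurable]: "f \<in> borel_measurable (M \<Otimes>\<^sub>M lborel)" "g \<in> borel_measurable (M \<Otimes>\<^sub>M lborel)"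
  shows "(\<integral>\<^sup>+\<omega>. (\<integral>\<^sup>+s. f (\<omega>, s) + g (\<omega>, s) \<partial>lborel) \<partial>M)
    = (\<integral>\<^sup>+\<omega>. (\<integral>\<^sup>+s. f (\<omega>, s) \<partial>lborel) \<partial>M) + (\<integral>\<^sup>+\<omega>. (\<integral>\<^sup>+s. g (\<omega>, s) \<partial>lborel) \<partial>M)"
proof -
  have "(\<integral>\<^sup>+\<omega>. (\<integral>\<^sup>+s. f (\<omega>, s) + g (\<omega>, s) \<partial>lborel) \<partial>M)
      = (\<integral>\<^sup>+\<omega>. (\<integral>\<^sup>+s. f (\<omega>, s) \<partial>lborel) + (\<integral>\<^sup>+s. g (\<omega>, s) \<partial>lborel) \<partial>M)"
    by (intro nn_integral_cong nn_integral_add) measurable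
  also have "\<dots> = (\<integral>\<^sup>+\<omega>. (\<integral>\<^sup>+s. f (\<omega>, s) \<partial>lborel) \<partial>M) + (\<integral>\<^sup>+\<omega>. (\<integral>\<^sup>+s. g (\<omega>, s) \<partial>lborel) \<partial>M)"
    by (intro nn_integral_add) measurable
  finally show ?thesis .
qed

lemma nested_nn_integral_cmult:
  fixes f :: "'a \<times> real \<Rightarrow> ennreal"
  assumes [measurable]: "f \<in> borel_measurable (M \<Otimes>\<^sub>M lborel)"
  shows "(\<integral>\<^sup>+\<omega>. (\<integral>\<^sup>+s. c * f (\<omega>, s) \<partial>lborel) \<partial>M) = c * (\<integral>\<^sup>+\<omega>. (\<integral>\<^sup>+s. f (\<omega>, s) \<partial>lborel) \<partial>M)"
proof -
  have "(\<integral>\<^sup>+\<omega>. (\<integral>\<^sup>+s. c * f (\<omega>, s) \<partial>lborel) \<partial>M) = (\<integral>\<^sup>+\<omega>. c * (\<integral>\<^sup>+s. f (\<omega>, s) \<partial>lborel) \<partial>M)"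
    by (intro nn_integral_cong nn_integral_cmult) measurable
  also have "\<dots> = c * (\<integral>\<^sup>+\<omega>. (\<integral>\<^sup>+s. f (\<omega>, s) \<partial>lborel) \<partial>M)"
    by (intro nn_integral_cmult) measurable
  finally show ?thesis .
qed

text \<open>The non-optimal factor 9 comes from splitting into three terms twice.\<close>

lemma ito_integral_diff_bound:
  assumes h1: "has_ito_integral M W T \<phi>1 I1" and h2: "has_ito_integral M W T \<phi>2 I2" and t: "t \<in> {0..T}"
  shows "(\<integral>\<^sup>+\<omega>. ennreal ((I1 t \<omega> - I2 t \<omega>)\<^sup>2) \<partial>M)
    \<le> 9 * (\<integral>\<^sup>+\<omega>. (\<integral>\<^sup>+s\<in>{0..t}. ennreal ((\<phi>1 s \<omega> - \<phi>2 s \<omega>)\<^sup>2) \<partial>lborel) \<partial>M)"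
proof -
  have T: "0 \<le> T" using t by simp
  obtain N1 \<tau>1 \<xi>1 where a1:
    "\<And>k. simple_process_data M W T (N1 k) (\<tau>1 k) (\<xi>1 k)"
    "(\<lambda>k. \<integral>\<^sup>+\<omega>. (\<integral>\<^sup>+t\<in>{0..T}. ennreal ((\<phi>1 t \<omega> - simple_process (N1 k) (\<tau>1 k) (\<xi>1 k) t \<omega>)\<^sup>2) \<partial>lborel) \<partial>M) \<longlonglongrightarrow> 0"
    "(\<lambda>k. \<integral>\<^sup>+\<omega>. ennreal ((I1 t \<omega> - simple_ito_integral W (N1 k) (\<tau>1 k) (\<xi>1 k) t \<omega>)\<^sup>2) \<partial>M) \<longlonglongrightarrow> 0"
    using h1 t unfolding has_ito_integral_def by blast
  obtain N2 \<tau>2 \<xi>2 where a2: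
    "\<And>k. simple_process_data M W T (N2 k) (\<tau>2 k) (\<xi>2 k)"
    "(\<lambda>k. \<integral>\<^sup>+\<omega>. (\<integral>\<^sup>+t\<in>{0..T}. ennreal ((\<phi>2 t \<omega> - simple_process (N2 k) (\<tau>2 k) (\<xi>2 k) t \<omega>)\<^sup>2) \<partial>lborel) \<partial>M) \<longlonglongrightarrow> 0"
    "(\<lambda>k. \<integral>\<^sup>+\<omega>. ennreal ((I2 t \<omega> - simple_ito_integral W (N2 k) (\<tau>2 k) (\<xi>2 k) t \<omega>)\<^sup>2) \<partial>M) \<longlonglongrightarrow> 0"
    using h2 t unfolding has_ito_integral_def by blast
  define J1 J2 S1 S2 where "J1 k = simple_ito_integral W (N1 k) (\<tau>1 k) (\<xi>1 k) t"
    and "J2 k = simple_ito_integral W (N2 k) (\<tau>2 k) (\<xi>2 k) t"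
    and "S1 k = simple_process (N1 k) (\<tau>1 k) (\<xi>1 k)"
    and "S2 k = simple_process (N2 k) (\<tau>2 k) (\<xi>2 k)" for k
  define e1 e2 d1 d2 where "e1 k = (\<integral>\<^sup>+\<omega>. ennreal ((I1 t \<omega> - J1 k \<omega>)\<^sup>2) \<partial>M)"
    and "e2 k = (\<integral>\<^sup>+\<omega>. ennreal ((I2 t \<omega> - J2 k \<omega>)\<^sup>2) \<partial>M)"
    and "d1 k = (\<integral>\<^sup>+\<omega>. (\<integral>\<^sup>+t\<in>{0..T}. ennreal ((\<phi>1 t \<omega> - S1 k t \<omega>)\<^sup>2) \<partial>lborel) \<partial>M)"
    and "d2 k = (\<integral>\<^sup>+\<omega>. (\<integral>\<^sup>+t\<in>{0..T}. ennreal ((\<phi>2 t \<omega> - S2 k t \<omega>)\<^sup>2) \<partial>lborel) \<partial>M)" for k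
  let ?R = "(\<integral>\<^sup>+\<omega>. (\<integral>\<^sup>+s\<in>{0..t}. ennreal ((\<phi>1 s \<omega> - \<phi>2 s \<omega>)\<^sup>2) \<partial>lborel) \<partial>M)"
  have lim: "e1 \<longlonglongrightarrow> 0" "e2 \<longlonglongrightarrow> 0" "d1 \<longlonglongrightarrow> 0" "d2 \<longlonglongrightarrow> 0"
    using a1 a2 unfolding e1_def e2_def d1_def d2_def J1_def J2_def S1_def S2_def by auto
  have mI [measurable]: "I1 t \<in> borel_measurable M" "I2 t \<in> borel_measurable M"
    using h1 h2 t measurable_F_le unfolding has_ito_integral_def by blast+
  have mJ: "simple_ito_integral W N \<tau> \<xi> t \<in> borel_measurable M"
    if d: "simple_process_data M W T N \<tau> \<xi>" for N \<tau> \<xi>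
  proof -
    have 1: "\<xi> l \<in> borel_measurable M" if "l < N" for l
      using d that measurable_F_le unfolding simple_process_data_def by blast
    have 2: "0 \<le> min t (\<tau> l)" if "l \<le> N" for l
      using simple_process_data_nonneg[OF d that] t by simp
    show ?thesis unfolding simple_ito_integral_def[abs_def]
      by (intro borel_measurable_sum borel_measurable_times borel_measurable_diff W_measurable 1 2) auto
  qed
  have [measurable]: "J1 k \<in> borel_measurable M" "J2 k \<in> borel_measurable M" for k
    unfolding J1_def J2_def by (rule mJ[OF a1(1)], rule mJ[OF a2(1)])
  have mp: "(\<lambda>x. indicator {0..T} (snd x) * \<phi>1 (snd x) (fst x)) \<in> borel_measurable (M \<Otimes>\<^sub>M lborel)"
    "(\<lambda>x. indicator {0..T} (snd x) * \<phi>2 (snd x) (fst x)) \<in> borel_measurable (M \<Otimes>\<^sub>M lborel)"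
    using prog_measurable_pair[of T \<phi>1] prog_measurable_pair[of T \<phi>2] h1 h2 T
    unfolding has_ito_integral_def by (auto simp: case_prod_beta)
  have ms: "(\<lambda>x. S1 k (snd x) (fst x)) \<in> borel_measurable (M \<Otimes>\<^sub>M lborel)"
    "(\<lambda>x. S2 k (snd x) (fst x)) \<in> borel_measurable (M \<Otimes>\<^sub>M lborel)" for k
    using simple_process_pair[OF a1(1)] simple_process_pair[OF a2(1)]
    unfolding S1_def S2_def by (auto simp: case_prod_beta)
  \<comment> \<open>Outside \<open>{0..T}\<close> nothing is known about the measurability of the
    integrands. The indicator of \<open>{0..T}\<close> is inserted to obtain it and is then absorbed
    by that of \<open>{0..t}\<close>.\<close>
  have mq: "(\<lambda>x. ennreal ((f (snd x) (fst x) - g (snd x) (fst x))\<^sup>2) * indicator {0..t} (snd x)) \<in> borel_measurable (M \<Otimes>\<^sub>M lborel)"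
    if f: "(\<lambda>x. indicator {0..T} (snd x) * f (snd x) (fst x)) \<in> borel_measurable (M \<Otimes>\<^sub>M lborel)"
      and g: "(\<lambda>x. indicator {0..T} (snd x) * g (snd x) (fst x)) \<in> borel_measurable (M \<Otimes>\<^sub>M lborel)"
    for f g :: "real \<Rightarrow> 'a \<Rightarrow> real"
  proof -
    have "(\<lambda>x. ennreal ((indicator {0..T} (snd x) * f (snd x) (fst x) - indicator {0..T} (snd x) * g (snd x) (fst x))\<^sup>2)
        * indicator {0..t} (snd x)) \<in> borel_measurable (M \<Otimes>\<^sub>M lborel)"
      using f g by measurable
    moreover have "ennreal ((indicator {0..T} s * f s \<omega> - indicator {0..T} s * g s \<omega>)\<^sup>2) * indicator {0..t} s
      = ennreal ((f s \<omega> - g s \<omega>)\<^sup>2) * indicator {0..t} s" for s \<omega>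
      using t by (auto simp: indicator_def)
    ultimately show ?thesis by simp
  qed
  have ms': "(\<lambda>x. indicator {0..T} (snd x) * S1 k (snd x) (fst x)) \<in> borel_measurable (M \<Otimes>\<^sub>M lborel)"
    "(\<lambda>x. indicator {0..T} (snd x) * S2 k (snd x) (fst x)) \<in> borel_measurable (M \<Otimes>\<^sub>M lborel)" for k
    using ms[of k] by measurable
  \<comment> \<open>First split: through the simple integrals \<open>J1 k\<close> and
    \<open>J2 k\<close> at the fixed time \<open>t\<close>.\<close>
  have b1: "(\<integral>\<^sup>+\<omega>. ennreal ((I1 t \<omega> - I2 t \<omega>)\<^sup>2) \<partial>M) \<le> 3 * e1 k + 3 * (\<integral>\<^sup>+\<omega>. ennreal ((J1 k \<omega> - J2 k \<omega>)\<^sup>2) \<partial>M) + 3 * e2 k" for k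
  proof -
    have "(\<integral>\<^sup>+\<omega>. ennreal ((I1 t \<omega> - I2 t \<omega>)\<^sup>2) \<partial>M)
      \<le> (\<integral>\<^sup>+\<omega>. 3 * ennreal ((I1 t \<omega> - J1 k \<omega>)\<^sup>2) + 3 * ennreal ((J1 k \<omega> - J2 k \<omega>)\<^sup>2) + 3 * ennreal ((I2 t \<omega> - J2 k \<omega>)\<^sup>2) \<partial>M)"
    proof (rule nn_integral_mono)
      fix \<omega>
      show "ennreal ((I1 t \<omega> - I2 t \<omega>)\<^sup>2) \<le> 3 * ennreal ((I1 t \<omega> - J1 k \<omega>)\<^sup>2) + 3 * ennreal ((J1 k \<omega> - J2 k \<omega>)\<^sup>2) + 3 * ennreal ((I2 t \<omega> - J2 k \<omega>)\<^sup>2)"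
        using ennreal_square_sum3_le[of "I1 t \<omega> - J1 k \<omega>" "J1 k \<omega> - J2 k \<omega>" "J2 k \<omega> - I2 t \<omega>"]
        by (simp add: power2_commute)
    qed
    also have "\<dots> = 3 * e1 k + 3 * (\<integral>\<^sup>+\<omega>. ennreal ((J1 k \<omega> - J2 k \<omega>)\<^sup>2) \<partial>M) + 3 * e2 k"
      unfolding e1_def e2_def by (simp add: nn_integral_add nn_integral_cmult)
    finally show ?thesis .
  qed
  \<comment> \<open>Second split: the isometry for simple processes moves the estimate to the
    integrands, where it passes through \<open>\<phi>1\<close> and \<open>\<phi>2\<close>.\<close>
  have b2: "(\<integral>\<^sup>+\<omega>. ennreal ((J1 k \<omega> - J2 k \<omega>)\<^sup>2) \<partial>M) \<le> 3 * d1 k + 3 * ?R + 3 * d2 k" for k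
  proof -
    have "(\<integral>\<^sup>+\<omega>. ennreal ((J1 k \<omega> - J2 k \<omega>)\<^sup>2) \<partial>M)
      = (\<integral>\<^sup>+\<omega>. (\<integral>\<^sup>+s\<in>{0..t}. ennreal ((S1 k s \<omega> - S2 k s \<omega>)\<^sup>2) \<partial>lborel) \<partial>M)"
      unfolding J1_def J2_def S1_def S2_def using simple_ito_diff_isometry[OF a1(1) a2(1)] t by simp
    also have "\<dots> \<le> (\<integral>\<^sup>+\<omega>. (\<integral>\<^sup>+s. 3 * (ennreal ((\<phi>1 s \<omega> - S1 k s \<omega>)\<^sup>2) * indicator {0..t} s)
        + (3 * (ennreal ((\<phi>1 s \<omega> - \<phi>2 s \<omega>)\<^sup>2) * indicator {0..t} s)
        + 3 * (ennreal ((\<phi>2 s \<omega> - S2 k s \<omega>)\<^sup>2) * indicator {0..t} s)) \<partial>lborel) \<partial>M)"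
    proof (intro nn_integral_mono)
      fix \<omega> s
      have "ennreal ((S1 k s \<omega> - S2 k s \<omega>)\<^sup>2)
        \<le> 3 * ennreal ((\<phi>1 s \<omega> - S1 k s \<omega>)\<^sup>2) + 3 * ennreal ((\<phi>1 s \<omega> - \<phi>2 s \<omega>)\<^sup>2) + 3 * ennreal ((\<phi>2 s \<omega> - S2 k s \<omega>)\<^sup>2)"
        using ennreal_square_sum3_le[of "S1 k s \<omega> - \<phi>1 s \<omega>" "\<phi>1 s \<omega> - \<phi>2 s \<omega>" "\<phi>2 s \<omega> - S2 k s \<omega>"]
        by (simp add: power2_commute)
      thus "ennreal ((S1 k s \<omega> - S2 k s \<omega>)\<^sup>2) * indicator {0..t} s
        \<le> 3 * (ennreal ((\<phi>1 s \<omega> - S1 k s \<omega>)\<^sup>2) * indicator {0..t} s)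
        + (3 * (ennreal ((\<phi>1 s \<omega> - \<phi>2 s \<omega>)\<^sup>2) * indicator {0..t} s)
        + 3 * (ennreal ((\<phi>2 s \<omega> - S2 k s \<omega>)\<^sup>2) * indicator {0..t} s))"
        by (simp add: indicator_def add.assoc)
    qed
    also have "\<dots> = 3 * (\<integral>\<^sup>+\<omega>. (\<integral>\<^sup>+s\<in>{0..t}. ennreal ((\<phi>1 s \<omega> - S1 k s \<omega>)\<^sup>2) \<partial>lborel) \<partial>M) + (3 * ?R
       + 3 * (\<integral>\<^sup>+\<omega>. (\<integral>\<^sup>+s\<in>{0..t}. ennreal ((\<phi>2 s \<omega> - S2 k s \<omega>)\<^sup>2) \<partial>lborel) \<partial>M))"
    proof -
      define f1 f2 f3 where
        "f1 = (\<lambda>x. ennreal ((\<phi>1 (snd x) (fst x) - S1 k (snd x) (fst x))\<^sup>2) * indicator {0..t} (snd x))"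
        and "f2 = (\<lambda>x. ennreal ((\<phi>1 (snd x) (fst x) - \<phi>2 (snd x) (fst x))\<^sup>2) * indicator {0..t} (snd x))"
        and "f3 = (\<lambda>x. ennreal ((\<phi>2 (snd x) (fst x) - S2 k (snd x) (fst x))\<^sup>2) * indicator {0..t} (snd x))"
      have m [measurable]: "f1 \<in> borel_measurable (M \<Otimes>\<^sub>M lborel)" "f2 \<in> borel_measurable (M \<Otimes>\<^sub>M lborel)"
          "f3 \<in> borel_measurable (M \<Otimes>\<^sub>M lborel)"
        unfolding f1_def f2_def f3_def by (rule mq[OF mp(1) ms'(1)], rule mq[OF mp(1,2)], rule mq[OF mp(2) ms'(2)])
      have "(\<integral>\<^sup>+\<omega>. (\<integral>\<^sup>+s. 3 * f1 (\<omega>, s) + (3 * f2 (\<omega>, s) + 3 * f3 (\<omega>, s)) \<partial>lborel) \<partial>M)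
        = 3 * (\<integral>\<^sup>+\<omega>. (\<integral>\<^sup>+s. f1 (\<omega>, s) \<partial>lborel) \<partial>M) + (3 * (\<integral>\<^sup>+\<omega>. (\<integral>\<^sup>+s. f2 (\<omega>, s) \<partial>lborel) \<partial>M)
          + 3 * (\<integral>\<^sup>+\<omega>. (\<integral>\<^sup>+s. f3 (\<omega>, s) \<partial>lborel) \<partial>M))"
        using nested_nn_integral_add[of "\<lambda>x. 3 * f1 x" "\<lambda>x. 3 * f2 x + 3 * f3 x"]
          nested_nn_integral_add[of "\<lambda>x. 3 * f2 x" "\<lambda>x. 3 * f3 x"]
        by (simp add: nested_nn_integral_cmult)
      thus ?thesis unfolding f1_def f2_def f3_def by simp
    qed
    \<comment> \<open>The approximation errors are controlled over all of \<open>{0..T}\<close>, so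
      the domain is enlarged in the two outer terms.\<close>
    also have "\<dots> \<le> 3 * d1 k + (3 * ?R + 3 * d2 k)"
      unfolding d1_def d2_def using t
      by (intro add_mono mult_left_mono nn_integral_mono order_refl) (auto simp: indicator_def)
    finally show ?thesis by (simp add: add.assoc)
  qed
  have b: "(\<integral>\<^sup>+\<omega>. ennreal ((I1 t \<omega> - I2 t \<omega>)\<^sup>2) \<partial>M) \<le> 3 * e1 k + 3 * (3 * d1 k + 3 * ?R + 3 * d2 k) + 3 * e2 k" for k
    using b1[of k] mult_left_mono[OF b2[of k], of 3] by (meson add_mono order_refl order_trans zero_le)
  have "(\<lambda>k. 3 * e1 k + 3 * (3 * d1 k + 3 * ?R + 3 * d2 k) + 3 * e2 k) \<longlonglongrightarrow> 3 * 0 + 3 * (3 * 0 + 3 * ?R + 3 * 0) + 3 * 0"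
    by (intro tendsto_add ennreal_tendsto_cmult lim tendsto_const) auto
  hence "(\<integral>\<^sup>+\<omega>. ennreal ((I1 t \<omega> - I2 t \<omega>)\<^sup>2) \<partial>M) \<le> 3 * 0 + 3 * (3 * 0 + 3 * ?R + 3 * 0) + 3 * 0"
    by (rule LIMSEQ_le_const) (use b in auto)
  also have "\<dots> = 9 * ?R" by (simp flip: mult.assoc)
  finally show ?thesis .
qed

end

section \<open>Uniqueness of Ito processes with Lipschitz coefficients\<close>

lemma sum_squares_bound_ennreal: "2 * x * y \<le> x\<^sup>2 + (y::ennreal)\<^sup>2"
proof (cases x)
  case (real a)
  note x = this
  show ?thesis
  proof (cases y)
    case (real b)
    have "2 * x * y = ennreal (2 * a * b)" using x real by (simp add: ennreal_mult'')
    also have "\<dots> \<le> ennreal (a\<^sup>2 + b\<^sup>2)" by (intro ennreal_leI sum_squares_bound)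
    also have "\<dots> = x\<^sup>2 + y\<^sup>2" using x real by (simp add: ennreal_power)
    finally show ?thesis .
  qed (simp add: power2_eq_square)
qed (simp add: power2_eq_square)

text \<open>This is the Cauchy-Schwarz inequality against the constant 1 on \<open>A\<close>,
  obtained by integrating \<open>2 * f x * f y \<le> (f x)\<^sup>2 + (f y)\<^sup>2\<close> over both
  variables in \<open>A\<close>. Infinite values are allowed, so it can be applied to single paths
  before anything is known to be finite.\<close>

lemma nn_integral_power2_le:
  fixes f :: "'b \<Rightarrow> ennreal"
  assumes [measurable]: "f \<in> borel_measurable N" "A \<in> sets N"
  shows "(\<integral>\<^sup>+x\<in>A. f x \<partial>N)\<^sup>2 \<le> emeasure N A * (\<integral>\<^sup>+x\<in>A. (f x)\<^sup>2 \<partial>N)"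
proof -
  let ?g = "\<lambda>x. f x * indicator A x" and ?i = "indicator A :: 'b \<Rightarrow> ennreal"
  let ?I = "\<integral>\<^sup>+x. ?g x \<partial>N" and ?S = "\<integral>\<^sup>+x. (f x)\<^sup>2 * ?i x \<partial>N"
  have mg [measurable]: "?g \<in> borel_measurable N" by measurable
  have "(\<integral>\<^sup>+x. (\<integral>\<^sup>+y. 2 * ?g x * ?g y \<partial>N) \<partial>N) = (\<integral>\<^sup>+x. 2 * ?g x * ?I \<partial>N)"
    by (intro nn_integral_cong nn_integral_cmult mg)
  also have "\<dots> = (\<integral>\<^sup>+x. 2 * ?g x \<partial>N) * ?I"
    by (rule nn_integral_multc) measurable
  also have "(\<integral>\<^sup>+x. 2 * ?g x \<partial>N) = 2 * ?I"
    by (rule nn_integral_cmult[OF mg])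
  finally have "2 * ?I\<^sup>2 = (\<integral>\<^sup>+x. (\<integral>\<^sup>+y. 2 * ?g x * ?g y \<partial>N) \<partial>N)"
    by (simp add: power2_eq_square mult.assoc)
  also have "\<dots> \<le> (\<integral>\<^sup>+x. (\<integral>\<^sup>+y. (f x)\<^sup>2 * ?i x * ?i y + ?i x * ((f y)\<^sup>2 * ?i y) \<partial>N) \<partial>N)"
    by (intro nn_integral_mono) (use sum_squares_bound_ennreal in \<open>simp add: indicator_def\<close>)
  also have "\<dots> = (\<integral>\<^sup>+x. (f x)\<^sup>2 * ?i x * emeasure N A + ?i x * ?S \<partial>N)"
  proof (rule nn_integral_cong)
    fix x
    have "(\<integral>\<^sup>+y. (f x)\<^sup>2 * ?i x * ?i y + ?i x * ((f y)\<^sup>2 * ?i y) \<partial>N)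
        = (\<integral>\<^sup>+y. (f x)\<^sup>2 * ?i x * ?i y \<partial>N) + (\<integral>\<^sup>+y. ?i x * ((f y)\<^sup>2 * ?i y) \<partial>N)"
      by (rule nn_integral_add) measurable
    also have "(\<integral>\<^sup>+y. (f x)\<^sup>2 * ?i x * ?i y \<partial>N) = (f x)\<^sup>2 * ?i x * emeasure N A"
      by (rule nn_integral_cmult_indicator) (rule assms(2))
    also have "(\<integral>\<^sup>+y. ?i x * ((f y)\<^sup>2 * ?i y) \<partial>N) = ?i x * ?S"
      by (rule nn_integral_cmult) measurable
    finally show "(\<integral>\<^sup>+y. (f x)\<^sup>2 * ?i x * ?i y + ?i x * ((f y)\<^sup>2 * ?i y) \<partial>N)
        = (f x)\<^sup>2 * ?i x * emeasure N A + ?i x * ?S" .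
  qed
  also have "\<dots> = (\<integral>\<^sup>+x. (f x)\<^sup>2 * ?i x * emeasure N A \<partial>N) + (\<integral>\<^sup>+x. ?i x * ?S \<partial>N)"
    by (rule nn_integral_add) measurable
  also have "(\<integral>\<^sup>+x. (f x)\<^sup>2 * ?i x * emeasure N A \<partial>N) = ?S * emeasure N A"
    by (rule nn_integral_multc) measurable
  also have "(\<integral>\<^sup>+x. ?i x * ?S \<partial>N) = (\<integral>\<^sup>+x. ?i x \<partial>N) * ?S"
    by (rule nn_integral_multc) measurable
  also have "(\<integral>\<^sup>+x. ?i x \<partial>N) = emeasure N A"
    by (rule nn_integral_indicator[OF assms(2)])
  also have "?S * emeasure N A + emeasure N A * ?S = 2 * (emeasure N A * ?S)"
    by (simp add: mult.commute mult_2)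
  finally show ?thesis by (subst (asm) ennreal_mult_le_mult_iff) auto
qed

text \<open>Inserting the inequality into itself gives
  \<open>a t \<le> c * (K * t) ^ m / fact m\<close> for every \<open>m\<close>, where
  \<open>c\<close> is \<open>K\<close> times the integral over \<open>{0..T}\<close>. These are
  terms of a convergent exponential series and tend to 0. Iteration suits a function with values in
  \<open>ennreal\<close> about whose continuity nothing is known.\<close>

lemma gronwall_zero:
  fixes a :: "real \<Rightarrow> ennreal"
  assumes K: "0 \<le> K" and fin: "(\<integral>\<^sup>+s\<in>{0..T}. a s \<partial>lborel) < \<infinity>"
    and le: "\<And>t. t \<in> {0..T} \<Longrightarrow> a t \<le> ennreal K * (\<integral>\<^sup>+s\<in>{0..t}. a s \<partial>lborel)"
    and t: "t \<in> {0..T}"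
  shows "a t = 0"
proof -
  obtain c where c: "0 \<le> c" "ennreal K * (\<integral>\<^sup>+s\<in>{0..T}. a s \<partial>lborel) = ennreal c"
  proof -
    have "ennreal K * (\<integral>\<^sup>+s\<in>{0..T}. a s \<partial>lborel) < \<infinity>" using fin by (simp add: ennreal_mult_less_top)
    thus ?thesis using that by (cases "ennreal K * (\<integral>\<^sup>+s\<in>{0..T}. a s \<partial>lborel)") auto
  qed
  have bound: "a t \<le> ennreal (c * (K * t) ^ m / fact m)" if "t \<in> {0..T}" for m t
    using that
  proof (induction m arbitrary: t)
    case 0
    have "a t \<le> ennreal K * (\<integral>\<^sup>+s\<in>{0..t}. a s \<partial>lborel)" by (rule le[OF 0])
    also have "\<dots> \<le> ennreal K * (\<integral>\<^sup>+s\<in>{0..T}. a s \<partial>lborel)"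
      using 0 by (intro mult_left_mono nn_integral_mono) (auto simp: indicator_def)
    finally show ?case by (simp add: c(2))
  next
    case (Suc m)
    have t: "0 \<le> t" using Suc.prems by simp
    have "a t \<le> ennreal K * (\<integral>\<^sup>+s\<in>{0..t}. a s \<partial>lborel)" by (rule le[OF Suc.prems])
    also have "\<dots> \<le> ennreal K * (\<integral>\<^sup>+s\<in>{0..t}. ennreal (c * (K * s) ^ m / fact m) \<partial>lborel)"
      using Suc by (intro mult_left_mono nn_integral_mono) (auto simp: indicator_def)
    also have "(\<integral>\<^sup>+s\<in>{0..t}. ennreal (c * (K * s) ^ m / fact m) \<partial>lborel)
        = ennreal (c * K ^ m * t ^ Suc m / fact (Suc m) - c * K ^ m * 0 ^ Suc m / fact (Suc m))"
    proof (rule nn_integral_FTC_Icc)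
      fix x assume "x \<in> {0..t}"
      have "((\<lambda>x. c * K ^ m / fact (Suc m) * x ^ Suc m) has_real_derivative
          c * K ^ m / fact (Suc m) * (real (Suc m) * x ^ (Suc m - Suc 0))) (at x)"
        by (intro DERIV_cmult DERIV_pow)
      moreover have "c * K ^ m / fact (Suc m) * (real (Suc m) * x ^ (Suc m - Suc 0)) = c * (K * x) ^ m / fact m"
        by (simp add: power_mult_distrib divide_simps del: of_nat_Suc)
      ultimately show "((\<lambda>x. c * K ^ m * x ^ Suc m / fact (Suc m)) has_real_derivative c * (K * x) ^ m / fact m) (at x)"
        unfolding times_divide_eq_left by (simp only:)
    qed (use t K c in auto)
    also have "ennreal K * \<dots> = ennreal (c * (K * t) ^ Suc m / fact (Suc m))"
      unfolding ennreal_mult'[OF K, symmetric] by (rule arg_cong[where f = ennreal]) (simp add: power_mult_distrib)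
    finally show ?case .
  qed
  have "(\<lambda>m. c * (inverse (fact m) * (K * t) ^ m)) \<longlonglongrightarrow> c * 0"
    by (intro tendsto_mult tendsto_const summable_LIMSEQ_zero summable_exp)
  hence "(\<lambda>m. ennreal (c * (K * t) ^ m / fact m)) \<longlonglongrightarrow> ennreal 0"
    by (intro tendsto_ennrealI) (simp add: field_simps)
  hence "a t \<le> ennreal 0"
    by (rule LIMSEQ_le_const) (use bound[OF t] in auto)
  thus ?thesis by simp
qed

lemma abs_set_lebesgue_integral_le_nn_integral:
  fixes f :: "'b \<Rightarrow> real"
  assumes "set_integrable N A f"
  shows "ennreal \<bar>LINT x:A|N. f x\<bar> \<le> (\<integral>\<^sup>+x\<in>A. ennreal \<bar>f x\<bar> \<partial>N)"
proof -
  have "ennreal \<bar>LINT x:A|N. f x\<bar> \<le> (\<integral>\<^sup>+x. norm (indicator A x *\<^sub>R f x) \<partial>N)"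
    using integral_norm_bound_ennreal[OF assms[unfolded set_integrable_def]]
    by (simp add: set_lebesgue_integral_def)
  also have "\<dots> = (\<integral>\<^sup>+x\<in>A. ennreal \<bar>f x\<bar> \<partial>N)"
    by (intro nn_integral_cong) (auto simp: indicator_def)
  finally show ?thesis .
qed

text \<open>The rationals of the open interval are dense in the closed one, so continuity reaches
  the end points as well. This upgrades equality at countably many times, which holds on almost
  every path, to equality at all times.\<close>

lemma continuous_eq_on_rationals:
  fixes f g :: "real \<Rightarrow> real"
  assumes "a < b" "continuous_on {a..b} f" "continuous_on {a..b} g"
    and eq: "\<And>x. x \<in> {a<..<b} \<inter> \<rat> \<Longrightarrow> f x = g x" and x: "x \<in> {a..b}"
  shows "f x = g x"
proof -
  have cl: "closure ({a<..<b} \<inter> \<rat>) = {a..b}"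
    using closure_open_Int_superset[of "{a<..<b}" "\<rat>"] assms(1) by (simp add: Rats_closure_real)
  have "f x - g x = 0"
  proof (rule continuous_constant_on_closure[of "{a<..<b} \<inter> \<rat>" "\<lambda>x. f x - g x" 0 x])
    show "continuous_on (closure ({a<..<b} \<inter> \<rat>)) (\<lambda>x. f x - g x)"
      unfolding cl by (intro continuous_on_diff assms(2,3))
    show "x \<in> closure ({a<..<b} \<inter> \<rat>)" unfolding cl by (rule x)
    show "f y - g y = 0" if "y \<in> {a<..<b} \<inter> \<rat>" for y using eq[OF that] by simp
  qed
  thus ?thesis by simp
qed

context brownian
begin

text \<open>Gronwall's lemma is applied to \<open>a\<close>, the sum over the coordinates of the
  mean squares of the difference. The coefficients are processes already evaluated along the
  solutions, so \<open>lip\<close> compares their values path by path; almost every time suffices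
  because they enter through integrals.\<close>

lemma ito_process_unique:
  assumes T: "0 < T" and \<kappa>: "0 \<le> \<kappa>"
    and x: "ito_process M W T d x0 b1 s1 x" and y: "ito_process M W T d x0 b2 s2 y"
    and lip: "AE \<omega> in M. AE t in lborel. t \<in> {0..T} \<longrightarrow> (\<forall>k<d.
        \<bar>b1 t \<omega> $ k - b2 t \<omega> $ k\<bar> \<le> \<kappa> * (\<Sum>l<d. \<bar>x t \<omega> $ l - y t \<omega> $ l\<bar>) \<and>
        \<bar>s1 t \<omega> $ k - s2 t \<omega> $ k\<bar> \<le> \<kappa> * (\<Sum>l<d. \<bar>x t \<omega> $ l - y t \<omega> $ l\<bar>))"
  shows "AE \<omega> in M. \<forall>t\<in>{0..T}. x t \<omega> = y t \<omega>"
proof -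
  interpret P: pair_sigma_finite M "lborel :: real measure" ..
  define z where "z k t \<omega> = x t \<omega> $ k - y t \<omega> $ k" for k t \<omega>
  \<comment> \<open>\<open>Z\<close> is the coordinate difference extended by zero, which makes it
    jointly measurable. \<open>Q\<close> is the squared distance and \<open>f\<close> the right-hand
    side of \<open>lip\<close>.\<close>
  define Z where "Z k = (\<lambda>p. indicator {0..T} (snd p) * z k (snd p) (fst p))" for k
  define Q where "Q p = ennreal (\<Sum>l<d. (Z l p)\<^sup>2)" for p
  define f where "f p = ennreal (\<kappa> * (\<Sum>l<d. \<bar>Z l p\<bar>))" for p
  define a where "a s = (\<integral>\<^sup>+\<omega>. Q (\<omega>, s) \<partial>M)" for s
  define \<Phi> where "\<Phi> t = (\<integral>\<^sup>+\<omega>. (\<integral>\<^sup>+s\<in>{0..t}. (f (\<omega>, s))\<^sup>2 \<partial>lborel) \<partial>M)" for t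
  have T0: "0 \<le> T" using T by simp
  have Lx: "L2F M W T d x" and Ly: "L2F M W T d y" using x y unfolding ito_process_def by auto
  have carr: "x t \<omega> \<in> carrier_vec d" "y t \<omega> \<in> carrier_vec d" if "t \<in> {0..T}" "\<omega> \<in> space M" for t \<omega>
    using Lx Ly that unfolding L2F_def by auto
  have mxy: "(\<lambda>p. indicator {0..T} (snd p) * (x (snd p) (fst p) $ k)) \<in> borel_measurable (M \<Otimes>\<^sub>M lborel)"
    "(\<lambda>p. indicator {0..T} (snd p) * (y (snd p) (fst p) $ k)) \<in> borel_measurable (M \<Otimes>\<^sub>M lborel)" if "k < d" for k
    using prog_measurable_pair[of T "\<lambda>t \<omega>. x t \<omega> $ k"] prog_measurable_pair[of T "\<lambda>t \<omega>. y t \<omega> $ k"] Lx Ly T0 that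
    unfolding L2F_def by (auto simp: case_prod_beta)
  have mZ: "Z k \<in> borel_measurable (M \<Otimes>\<^sub>M lborel)" if "k < d" for k
    unfolding Z_def z_def right_diff_distrib by (intro borel_measurable_diff mxy that)
  have mQ [measurable]: "Q \<in> borel_measurable (M \<Otimes>\<^sub>M lborel)"
    unfolding Q_def[abs_def]
    by (intro measurable_compose[OF _ measurable_ennreal] borel_measurable_sum borel_measurable_power mZ) auto
  have mf [measurable]: "f \<in> borel_measurable (M \<Otimes>\<^sub>M lborel)"
    unfolding f_def[abs_def]
    by (intro measurable_compose[OF _ measurable_ennreal] borel_measurable_times borel_measurable_const
        borel_measurable_sum borel_measurable_abs mZ) auto
  \<comment> \<open>The factor \<open>d\<close> comes from comparing the square of a sum of
    \<open>d\<close> absolute values with the sum of their squares.\<close>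
  have fQ: "(f p)\<^sup>2 \<le> ennreal (\<kappa>\<^sup>2 * d) * Q p" for p
  proof -
    have "(\<Sum>l<d. \<bar>Z l p\<bar>)\<^sup>2 \<le> d * (\<Sum>l<d. (Z l p)\<^sup>2)"
      using Cauchy_Schwarz_ineq_sum[of "\<lambda>_. 1" "\<lambda>l. \<bar>Z l p\<bar>" "{..<d}"] by simp
    hence "(\<kappa> * (\<Sum>l<d. \<bar>Z l p\<bar>))\<^sup>2 \<le> \<kappa>\<^sup>2 * d * (\<Sum>l<d. (Z l p)\<^sup>2)"
      by (simp add: power_mult_distrib mult.assoc mult_left_mono)
    hence "ennreal ((\<kappa> * (\<Sum>l<d. \<bar>Z l p\<bar>))\<^sup>2) \<le> ennreal (\<kappa>\<^sup>2 * d * (\<Sum>l<d. (Z l p)\<^sup>2))"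
      by (rule ennreal_leI)
    moreover have "(f p)\<^sup>2 = ennreal ((\<kappa> * (\<Sum>l<d. \<bar>Z l p\<bar>))\<^sup>2)"
      unfolding f_def using \<kappa> by (intro ennreal_power mult_nonneg_nonneg sum_nonneg) auto
    ultimately show ?thesis unfolding Q_def by (simp add: ennreal_mult'' sum_nonneg)
  qed
  have \<Phi>a: "\<Phi> t \<le> ennreal (\<kappa>\<^sup>2 * d) * (\<integral>\<^sup>+s\<in>{0..t}. a s \<partial>lborel)" for t
  proof -
    have "\<Phi> t \<le> (\<integral>\<^sup>+\<omega>. (\<integral>\<^sup>+s. ennreal (\<kappa>\<^sup>2 * d) * (Q (\<omega>, s) * indicator {0..t} s) \<partial>lborel) \<partial>M)"
      unfolding \<Phi>_def using fQ by (intro nn_integral_mono) (auto simp: indicator_def)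
    also have "\<dots> = ennreal (\<kappa>\<^sup>2 * d) * (\<integral>\<^sup>+\<omega>. (\<integral>\<^sup>+s. Q (\<omega>, s) * indicator {0..t} s \<partial>lborel) \<partial>M)"
      using nested_nn_integral_cmult[of "\<lambda>p. Q p * indicator {0..t} (snd p)"] by simp
    \<comment> \<open>Fubini exchanges expectation and time, so that the bound becomes an integral
      of \<open>a\<close>, as Gronwall's lemma demands.\<close>
    also have "(\<integral>\<^sup>+\<omega>. (\<integral>\<^sup>+s. Q (\<omega>, s) * indicator {0..t} s \<partial>lborel) \<partial>M)
        = (\<integral>\<^sup>+s. (\<integral>\<^sup>+\<omega>. Q (\<omega>, s) * indicator {0..t} s \<partial>M) \<partial>lborel)"
      using P.Fubini[of "\<lambda>p. Q p * indicator {0..t} (snd p)"] by simp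
    also have "\<dots> = (\<integral>\<^sup>+s\<in>{0..t}. a s \<partial>lborel)"
      unfolding a_def by (simp add: nn_integral_multc)
    finally show ?thesis .
  qed
  \<comment> \<open>The Gronwall iteration has to start from a finite value, which the square
    integrability of \<open>x\<close> and \<open>y\<close> provides.\<close>
  have fin: "(\<integral>\<^sup>+s\<in>{0..T}. a s \<partial>lborel) < \<infinity>"
  proof -
    have sq: "x t \<omega> \<bullet> x t \<omega> = (\<Sum>l<d. (x t \<omega> $ l)\<^sup>2)" "y t \<omega> \<bullet> y t \<omega> = (\<Sum>l<d. (y t \<omega> $ l)\<^sup>2)"
      if "t \<in> {0..T}" "\<omega> \<in> space M" for t \<omega>
      using carr[OF that] by (simp_all add: scalar_prod_def power2_eq_square atLeast0LessThan)
    define X Y where "X p = ennreal (\<Sum>l<d. (indicator {0..T} (snd p) * (x (snd p) (fst p) $ l))\<^sup>2)"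
      and "Y p = ennreal (\<Sum>l<d. (indicator {0..T} (snd p) * (y (snd p) (fst p) $ l))\<^sup>2)" for p
    have [measurable]: "X \<in> borel_measurable (M \<Otimes>\<^sub>M lborel)" "Y \<in> borel_measurable (M \<Otimes>\<^sub>M lborel)"
      unfolding X_def[abs_def] Y_def[abs_def]
      by (intro measurable_compose[OF _ measurable_ennreal] borel_measurable_sum borel_measurable_power mxy; simp)+
    have "(\<integral>\<^sup>+s\<in>{0..T}. a s \<partial>lborel) = (\<integral>\<^sup>+\<omega>. (\<integral>\<^sup>+s. Q (\<omega>, s) * indicator {0..T} s \<partial>lborel) \<partial>M)"
      using P.Fubini[of "\<lambda>p. Q p * indicator {0..T} (snd p)"] unfolding a_def by (simp add: nn_integral_multc)
    also have "\<dots> \<le> (\<integral>\<^sup>+\<omega>. (\<integral>\<^sup>+s. 2 * X (\<omega>, s) + 2 * Y (\<omega>, s) \<partial>lborel) \<partial>M)"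
    proof (intro nn_integral_mono)
      fix \<omega> s
      have *: "(p - q)\<^sup>2 \<le> 2 * p\<^sup>2 + 2 * (q::real)\<^sup>2" for p q
        using sum_squares_bound[of p "-q"] by (simp add: power2_diff)
      have "(\<Sum>l<d. (Z l (\<omega>, s))\<^sup>2) \<le> 2 * (\<Sum>l<d. (indicator {0..T} s * (x s \<omega> $ l))\<^sup>2)
          + 2 * (\<Sum>l<d. (indicator {0..T} s * (y s \<omega> $ l))\<^sup>2)"
        unfolding Z_def z_def sum_distrib_left sum.distrib[symmetric] fst_conv snd_conv right_diff_distrib
        by (intro sum_mono *)
      hence "Q (\<omega>, s) \<le> ennreal (2 * (\<Sum>l<d. (indicator {0..T} s * (x s \<omega> $ l))\<^sup>2)
          + 2 * (\<Sum>l<d. (indicator {0..T} s * (y s \<omega> $ l))\<^sup>2))"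
        unfolding Q_def by (rule ennreal_leI)
      also have "\<dots> = 2 * X (\<omega>, s) + 2 * Y (\<omega>, s)"
        unfolding X_def Y_def by (simp add: ennreal_plus ennreal_mult'' sum_nonneg)
      finally show "Q (\<omega>, s) * indicator {0..T} s \<le> 2 * X (\<omega>, s) + 2 * Y (\<omega>, s)"
        by (auto simp: indicator_def)
    qed
    also have "\<dots> = 2 * (\<integral>\<^sup>+\<omega>. (\<integral>\<^sup>+s. X (\<omega>, s) \<partial>lborel) \<partial>M) + 2 * (\<integral>\<^sup>+\<omega>. (\<integral>\<^sup>+s. Y (\<omega>, s) \<partial>lborel) \<partial>M)"
      using nested_nn_integral_add[of "\<lambda>p. 2 * X p" "\<lambda>p. 2 * Y p"] by (simp add: nested_nn_integral_cmult)
    also have "(\<integral>\<^sup>+\<omega>. (\<integral>\<^sup>+s. X (\<omega>, s) \<partial>lborel) \<partial>M)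
        = (\<integral>\<^sup>+\<omega>. (\<integral>\<^sup>+t\<in>{0..T}. ennreal (x t \<omega> \<bullet> x t \<omega>) \<partial>lborel) \<partial>M)"
      unfolding X_def by (intro nn_integral_cong) (auto simp: indicator_def sq)
    also have "(\<integral>\<^sup>+\<omega>. (\<integral>\<^sup>+s. Y (\<omega>, s) \<partial>lborel) \<partial>M)
        = (\<integral>\<^sup>+\<omega>. (\<integral>\<^sup>+t\<in>{0..T}. ennreal (y t \<omega> \<bullet> y t \<omega>) \<partial>lborel) \<partial>M)"
      unfolding Y_def by (intro nn_integral_cong) (auto simp: indicator_def sq)
    also have "2 * (\<integral>\<^sup>+\<omega>. (\<integral>\<^sup>+t\<in>{0..T}. ennreal (x t \<omega> \<bullet> x t \<omega>) \<partial>lborel) \<partial>M)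
        + 2 * (\<integral>\<^sup>+\<omega>. (\<integral>\<^sup>+t\<in>{0..T}. ennreal (y t \<omega> \<bullet> y t \<omega>) \<partial>lborel) \<partial>M) < \<infinity>"
      using Lx Ly unfolding L2F_def by (simp add: ennreal_mult_less_top)
    finally show ?thesis .
  qed
  obtain I1 where I1: "\<And>k. k < d \<Longrightarrow> has_ito_integral M W T (\<lambda>t \<omega>. s1 t \<omega> $ k) (I1 k)"
      "AE \<omega> in M. \<forall>t\<in>{0..T}. \<forall>k<d. x t \<omega> $ k = x0 $ k + (LINT r:{0..t}|lborel. b1 r \<omega> $ k) + I1 k t \<omega>"
    using x unfolding ito_process_def by blast
  obtain I2 where I2: "\<And>k. k < d \<Longrightarrow> has_ito_integral M W T (\<lambda>t \<omega>. s2 t \<omega> $ k) (I2 k)"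
      "AE \<omega> in M. \<forall>t\<in>{0..T}. \<forall>k<d. y t \<omega> $ k = x0 $ k + (LINT r:{0..t}|lborel. b2 r \<omega> $ k) + I2 k t \<omega>"
    using y unfolding ito_process_def by blast
  have int1: "AE \<omega> in M. \<forall>k<d. set_integrable lborel {0..T} (\<lambda>t. b1 t \<omega> $ k)"
    and int2: "AE \<omega> in M. \<forall>k<d. set_integrable lborel {0..T} (\<lambda>t. b2 t \<omega> $ k)"
    using x y unfolding ito_process_def by blast+
  have f_eq: "f (\<omega>, s) = ennreal (\<kappa> * (\<Sum>l<d. \<bar>x s \<omega> $ l - y s \<omega> $ l\<bar>))" if "s \<in> {0..T}" for s \<omega>
    using that unfolding f_def Z_def z_def by simp
  \<comment> \<open>Squaring a sum of two terms costs a factor 2. The drift contributes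
    \<open>2 * T\<close>, with \<open>T\<close> from Cauchy-Schwarz on \<open>{0..t}\<close>, and
    the Ito integrals contribute \<open>18 = 2 * 9\<close>.\<close>
  have step: "(\<integral>\<^sup>+\<omega>. ennreal ((z k t \<omega>)\<^sup>2) \<partial>M) \<le> ennreal (2 * T + 18) * \<Phi> t" if k: "k < d" and t: "t \<in> {0..T}" for k t
  proof -
    have m: "I1 k t \<in> borel_measurable M" "I2 k t \<in> borel_measurable M"
      using I1(1)[OF k] I2(1)[OF k] t measurable_F_le unfolding has_ito_integral_def by blast+
    note [measurable] = m
    have "AE \<omega> in M. ennreal ((z k t \<omega>)\<^sup>2)
        \<le> ennreal (2 * T) * (\<integral>\<^sup>+s\<in>{0..t}. (f (\<omega>, s))\<^sup>2 \<partial>lborel) + 2 * ennreal ((I1 k t \<omega> - I2 k t \<omega>)\<^sup>2)"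
      using I1(2) I2(2) int1 int2 lip AE_space
    proof eventually_elim
      case (elim \<omega>)
      let ?b = "\<lambda>r. b1 r \<omega> $ k - b2 r \<omega> $ k"
      have sub: "set_integrable lborel {0..t} (\<lambda>r. b1 r \<omega> $ k)" "set_integrable lborel {0..t} (\<lambda>r. b2 r \<omega> $ k)"
        by (rule set_integrable_subset[of lborel "{0..T}"]; use elim(3,4) k t in auto)+
      have si: "set_integrable lborel {0..t} ?b" by (rule set_integral_diff(1)[OF sub])
      have zeq: "z k t \<omega> = (LINT r:{0..t}|lborel. ?b r) + (I1 k t \<omega> - I2 k t \<omega>)"
        using elim(1,2) t k set_integral_diff(2)[OF sub] unfolding z_def by simp
      have mfw [measurable]: "(\<lambda>s. f (\<omega>, s)) \<in> borel_measurable lborel"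
        using elim(6) mf by (rule measurable_compose_Pair1)
      have "ennreal \<bar>LINT r:{0..t}|lborel. ?b r\<bar> \<le> (\<integral>\<^sup>+r\<in>{0..t}. ennreal \<bar>?b r\<bar> \<partial>lborel)"
        by (rule abs_set_lebesgue_integral_le_nn_integral[OF si])
      also have "\<dots> \<le> (\<integral>\<^sup>+r\<in>{0..t}. f (\<omega>, r) \<partial>lborel)"
      proof (rule nn_integral_mono_AE)
        show "AE r in lborel. ennreal \<bar>?b r\<bar> * indicator {0..t} r \<le> f (\<omega>, r) * indicator {0..t} r"
          using elim(5)
        proof eventually_elim
          case (elim r)
          show ?case
          proof (cases "r \<in> {0..t}")
            case True
            hence r: "r \<in> {0..T}" using t by simp
            have "\<bar>?b r\<bar> \<le> \<kappa> * (\<Sum>l<d. \<bar>x r \<omega> $ l - y r \<omega> $ l\<bar>)" using elim r k by blast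
            hence "ennreal \<bar>?b r\<bar> \<le> f (\<omega>, r)" unfolding f_eq[OF r] by (rule ennreal_leI)
            thus ?thesis by (rule mult_right_mono) simp
          qed simp
        qed
      qed
      finally have "ennreal \<bar>LINT r:{0..t}|lborel. ?b r\<bar> \<le> (\<integral>\<^sup>+r\<in>{0..t}. f (\<omega>, r) \<partial>lborel)" .
      hence "(ennreal \<bar>LINT r:{0..t}|lborel. ?b r\<bar>)\<^sup>2 \<le> (\<integral>\<^sup>+r\<in>{0..t}. f (\<omega>, r) \<partial>lborel)\<^sup>2"
        by (rule power_mono_ennreal)
      also have "\<dots> \<le> emeasure lborel {0..t} * (\<integral>\<^sup>+r\<in>{0..t}. (f (\<omega>, r))\<^sup>2 \<partial>lborel)"
        by (rule nn_integral_power2_le) measurable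
      also have "\<dots> \<le> ennreal T * (\<integral>\<^sup>+r\<in>{0..t}. (f (\<omega>, r))\<^sup>2 \<partial>lborel)"
        using t by (intro mult_right_mono) (auto intro: ennreal_leI)
      finally have B: "ennreal ((LINT r:{0..t}|lborel. ?b r)\<^sup>2) \<le> ennreal T * (\<integral>\<^sup>+r\<in>{0..t}. (f (\<omega>, r))\<^sup>2 \<partial>lborel)"
        by (simp add: ennreal_power)
      have "(z k t \<omega>)\<^sup>2 \<le> 2 * (LINT r:{0..t}|lborel. ?b r)\<^sup>2 + 2 * (I1 k t \<omega> - I2 k t \<omega>)\<^sup>2"
        unfolding zeq power2_sum using sum_squares_bound[of "LINT r:{0..t}|lborel. ?b r" "I1 k t \<omega> - I2 k t \<omega>"]
        by linarith
      hence "ennreal ((z k t \<omega>)\<^sup>2) \<le> ennreal (2 * (LINT r:{0..t}|lborel. ?b r)\<^sup>2 + 2 * (I1 k t \<omega> - I2 k t \<omega>)\<^sup>2)"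
        by (rule ennreal_leI)
      also have "\<dots> = 2 * ennreal ((LINT r:{0..t}|lborel. ?b r)\<^sup>2) + 2 * ennreal ((I1 k t \<omega> - I2 k t \<omega>)\<^sup>2)"
        by (simp add: ennreal_plus ennreal_mult'')
      also have "\<dots> \<le> 2 * (ennreal T * (\<integral>\<^sup>+r\<in>{0..t}. (f (\<omega>, r))\<^sup>2 \<partial>lborel)) + 2 * ennreal ((I1 k t \<omega> - I2 k t \<omega>)\<^sup>2)"
        by (intro add_mono mult_left_mono B) auto
      also have "2 * (ennreal T * (\<integral>\<^sup>+r\<in>{0..t}. (f (\<omega>, r))\<^sup>2 \<partial>lborel))
          = ennreal (2 * T) * (\<integral>\<^sup>+r\<in>{0..t}. (f (\<omega>, r))\<^sup>2 \<partial>lborel)"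
        using T0 by (simp add: ennreal_mult'' mult.assoc)
      finally show ?case .
    qed
    hence "(\<integral>\<^sup>+\<omega>. ennreal ((z k t \<omega>)\<^sup>2) \<partial>M)
        \<le> (\<integral>\<^sup>+\<omega>. ennreal (2 * T) * (\<integral>\<^sup>+s\<in>{0..t}. (f (\<omega>, s))\<^sup>2 \<partial>lborel) + 2 * ennreal ((I1 k t \<omega> - I2 k t \<omega>)\<^sup>2) \<partial>M)"
      by (rule nn_integral_mono_AE)
    also have "\<dots> = ennreal (2 * T) * \<Phi> t + 2 * (\<integral>\<^sup>+\<omega>. ennreal ((I1 k t \<omega> - I2 k t \<omega>)\<^sup>2) \<partial>M)"
      unfolding \<Phi>_def by (simp add: nn_integral_add nn_integral_cmult)
    also have "\<dots> \<le> ennreal (2 * T) * \<Phi> t + 2 * (9 * (\<integral>\<^sup>+\<omega>. (\<integral>\<^sup>+s\<in>{0..t}. ennreal ((s1 s \<omega> $ k - s2 s \<omega> $ k)\<^sup>2) \<partial>lborel) \<partial>M))"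
      by (intro add_mono mult_left_mono order_refl ito_integral_diff_bound[OF I1(1)[OF k] I2(1)[OF k] t]) auto
    also have "\<dots> \<le> ennreal (2 * T) * \<Phi> t + 2 * (9 * \<Phi> t)"
    proof (intro add_mono mult_left_mono order_refl)
      show "(\<integral>\<^sup>+\<omega>. (\<integral>\<^sup>+s\<in>{0..t}. ennreal ((s1 s \<omega> $ k - s2 s \<omega> $ k)\<^sup>2) \<partial>lborel) \<partial>M) \<le> \<Phi> t"
        unfolding \<Phi>_def
      proof (rule nn_integral_mono_AE)
        show "AE \<omega> in M. (\<integral>\<^sup>+s\<in>{0..t}. ennreal ((s1 s \<omega> $ k - s2 s \<omega> $ k)\<^sup>2) \<partial>lborel) \<le> (\<integral>\<^sup>+s\<in>{0..t}. (f (\<omega>, s))\<^sup>2 \<partial>lborel)"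
          using lip
        proof eventually_elim
          case (elim \<omega>)
          show ?case
          proof (rule nn_integral_mono_AE)
            show "AE s in lborel. ennreal ((s1 s \<omega> $ k - s2 s \<omega> $ k)\<^sup>2) * indicator {0..t} s \<le> (f (\<omega>, s))\<^sup>2 * indicator {0..t} s"
              using elim
            proof eventually_elim
              case (elim s)
              show ?case
              proof (cases "s \<in> {0..t}")
                case True
                hence s: "s \<in> {0..T}" using t by simp
                have "\<bar>s1 s \<omega> $ k - s2 s \<omega> $ k\<bar> \<le> \<kappa> * (\<Sum>l<d. \<bar>x s \<omega> $ l - y s \<omega> $ l\<bar>)"
                  using elim s k by blast
                hence "\<bar>s1 s \<omega> $ k - s2 s \<omega> $ k\<bar>\<^sup>2 \<le> (\<kappa> * (\<Sum>l<d. \<bar>x s \<omega> $ l - y s \<omega> $ l\<bar>))\<^sup>2"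
                  by (intro power_mono) auto
                hence "ennreal ((s1 s \<omega> $ k - s2 s \<omega> $ k)\<^sup>2) \<le> ennreal ((\<kappa> * (\<Sum>l<d. \<bar>x s \<omega> $ l - y s \<omega> $ l\<bar>))\<^sup>2)"
                  by (intro ennreal_leI) simp
                also have "\<dots> = (f (\<omega>, s))\<^sup>2"
                  unfolding f_eq[OF s] using \<kappa> by (simp add: ennreal_power sum_nonneg)
                finally show ?thesis using True by simp
              qed simp
            qed
          qed
        qed
      qed
    qed auto
    also have "2 * (9 * \<Phi> t) = ennreal 18 * \<Phi> t" unfolding mult.assoc[symmetric] by simp
    also have "ennreal (2 * T) * \<Phi> t + ennreal 18 * \<Phi> t = ennreal (2 * T + 18) * \<Phi> t"
      using T0 by (subst ennreal_plus) (simp, simp, rule distrib_right[symmetric])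
    finally show ?thesis .
  qed
  have zm: "z k t \<in> borel_measurable M" if "k < d" "t \<in> {0..T}" for k t
  proof -
    have "(\<lambda>\<omega>. Z k (\<omega>, t)) \<in> borel_measurable M" using mZ[OF that(1)] by measurable
    thus ?thesis using that unfolding Z_def by simp
  qed
  have a_eq: "a t = (\<Sum>k<d. \<integral>\<^sup>+\<omega>. ennreal ((z k t \<omega>)\<^sup>2) \<partial>M)" if t: "t \<in> {0..T}" for t
  proof -
    have "a t = (\<integral>\<^sup>+\<omega>. (\<Sum>k<d. ennreal ((z k t \<omega>)\<^sup>2)) \<partial>M)"
      unfolding a_def Q_def Z_def using t by (simp add: sum_ennreal)
    also have "\<dots> = (\<Sum>k<d. \<integral>\<^sup>+\<omega>. ennreal ((z k t \<omega>)\<^sup>2) \<partial>M)"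
      by (intro nn_integral_sum measurable_compose[OF _ measurable_ennreal] borel_measurable_power zm t) auto
    finally show ?thesis .
  qed
  \<comment> \<open>There are \<open>d\<close> coordinates, each bounded by \<open>step\<close>; the
    last factor is the one in \<open>\<Phi>a\<close>.\<close>
  define K where "K = real d * (2 * T + 18) * (\<kappa>\<^sup>2 * d)"
  have a0: "a t = 0" if "t \<in> {0..T}" for t
  proof (rule gronwall_zero[OF _ fin _ that])
    show "0 \<le> K" unfolding K_def using T0 by simp
    fix t assume t: "t \<in> {0..T}"
    have "a t \<le> (\<Sum>k<d. ennreal (2 * T + 18) * \<Phi> t)"
      unfolding a_eq[OF t] by (intro sum_mono step t) auto
    also have "\<dots> = ennreal (real d * (2 * T + 18)) * \<Phi> t"
      unfolding sum_constant card_lessThan ennreal_of_nat_eq_real_of_nat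
      by (subst ennreal_mult') (simp_all only: of_nat_0_le_iff mult.assoc)
    also have "\<dots> \<le> ennreal (real d * (2 * T + 18)) * (ennreal (\<kappa>\<^sup>2 * d) * (\<integral>\<^sup>+s\<in>{0..t}. a s \<partial>lborel))"
      by (intro mult_left_mono \<Phi>a) auto
    also have "\<dots> = ennreal K * (\<integral>\<^sup>+s\<in>{0..t}. a s \<partial>lborel)"
      unfolding K_def mult.assoc[symmetric, of "ennreal _"]
      by (subst ennreal_mult''[symmetric]) simp_all
    finally show "a t \<le> ennreal K * (\<integral>\<^sup>+s\<in>{0..t}. a s \<partial>lborel)" .
  qed
  have z0: "AE \<omega> in M. \<forall>k<d. z k t \<omega> = 0" if t: "t \<in> {0..T}" for t
  proof -
    have "AE \<omega> in M. \<forall>k\<in>{..<d}. z k t \<omega> = 0"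
    proof (subst AE_ball_countable, simp, intro ballI)
      fix k assume k: "k \<in> {..<d}"
      have "(\<integral>\<^sup>+\<omega>. ennreal ((z k t \<omega>)\<^sup>2) \<partial>M) = 0"
        using a0[OF t] k unfolding a_eq[OF t] by (subst (asm) sum_eq_0_iff) blast+
      moreover have "(\<lambda>\<omega>. ennreal ((z k t \<omega>)\<^sup>2)) \<in> borel_measurable M"
        using k by (intro measurable_compose[OF _ measurable_ennreal] borel_measurable_power zm t) simp
      ultimately have "AE \<omega> in M. ennreal ((z k t \<omega>)\<^sup>2) = 0" by (subst (asm) nn_integral_0_iff_AE)
      thus "AE \<omega> in M. z k t \<omega> = 0" by eventually_elim simp
    qed
    thus ?thesis unfolding Ball_def lessThan_iff .
  qed
  \<comment> \<open>The rational times are countable, so one null set of paths serves them all;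
    continuity of the paths then covers the remaining times.\<close>
  have "AE \<omega> in M. \<forall>t\<in>{0<..<T} \<inter> \<rat>. \<forall>k<d. z k t \<omega> = 0"
  proof (rule AE_ball_countable')
    show "AE \<omega> in M. \<forall>k<d. z k t \<omega> = 0" if "t \<in> {0<..<T} \<inter> \<rat>" for t
      by (rule z0) (use that in auto)
  qed (intro countable_Int2 countable_rat)
  moreover have "AE \<omega> in M. \<forall>k<d. continuous_on {0..T} (\<lambda>t. x t \<omega> $ k)"
      "AE \<omega> in M. \<forall>k<d. continuous_on {0..T} (\<lambda>t. y t \<omega> $ k)"
    using x y unfolding ito_process_def by blast+
  ultimately show ?thesis using AE_space
  proof eventually_elim
    case (elim \<omega>)
    show ?case
    proof
      fix t assume t: "t \<in> {0..T}"
      have "x t \<omega> $ k = y t \<omega> $ k" if "k < d" for k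
      proof (rule continuous_eq_on_rationals[OF T, of "\<lambda>t. x t \<omega> $ k" "\<lambda>t. y t \<omega> $ k"])
        show "continuous_on {0..T} (\<lambda>t. x t \<omega> $ k)" "continuous_on {0..T} (\<lambda>t. y t \<omega> $ k)"
          using elim(2,3) that by blast+
        fix s assume "s \<in> {0<..<T} \<inter> \<rat>"
        hence "z k s \<omega> = 0" using elim(1) that by blast
        thus "x s \<omega> $ k = y s \<omega> $ k" unfolding z_def by simp
      qed (rule t)
      thus "x t \<omega> = y t \<omega>" using carr[OF t elim(4)] by (intro eq_vecI) (simp_all only: carrier_vecD)
    qed
  qed
qed

end

section \<open>Bounded matrix functions\<close>

text \<open>Weaker than \<open>bounded_coeff\<close>, so that inverses can be handled through
  dimensions and bounds alone. The bound may depend on the entry, which lets sums and products be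
  treated entry by entry; \<open>mbounded_lipschitz\<close> merges the bounds at the end.\<close>

definition mbounded :: "real \<Rightarrow> nat \<Rightarrow> nat \<Rightarrow> (real \<Rightarrow> real mat) \<Rightarrow> bool" where
  "mbounded T r c F \<longleftrightarrow> (\<forall>t\<in>{0..T}. F t \<in> carrier_mat r c) \<and>
     (\<forall>a<r. \<forall>b<c. \<exists>\<kappa>. \<forall>t\<in>{0..T}. \<bar>F t $$ (a, b)\<bar> \<le> \<kappa>)"

lemma mboundedD: "mbounded T r c F \<Longrightarrow> t \<in> {0..T} \<Longrightarrow> F t \<in> carrier_mat r c"
  unfolding mbounded_def by blast

lemma mbounded_entryE:
  assumes "mbounded T r c F" "a < r" "b < c"
  obtains \<kappa> where "\<And>t. t \<in> {0..T} \<Longrightarrow> \<bar>F t $$ (a, b)\<bar> \<le> \<kappa>"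
  using assms unfolding mbounded_def by blast

lemma mboundedI:
  assumes "\<And>t. t \<in> {0..T} \<Longrightarrow> F t \<in> carrier_mat r c"
    and "\<And>a b. a < r \<Longrightarrow> b < c \<Longrightarrow> \<exists>\<kappa>. \<forall>t\<in>{0..T}. \<bar>F t $$ (a, b)\<bar> \<le> \<kappa>"
  shows "mbounded T r c F"
  using assms unfolding mbounded_def by blast

lemma mbounded_cong:
  assumes "mbounded T r c F" "\<And>t. t \<in> {0..T} \<Longrightarrow> G t = F t"
  shows "mbounded T r c G"
  using assms unfolding mbounded_def by simp

lemma bounded_coeff_mbounded: "bounded_coeff T r c F \<Longrightarrow> mbounded T r c F"
  unfolding bounded_coeff_def mbounded_def by blast

lemma continuous_coeff_mbounded:
  assumes "continuous_coeff T r c F"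
  shows "mbounded T r c F"
proof (rule mboundedI)
  fix a b assume "a < r" "b < c"
  hence "continuous_on {0..T} (\<lambda>t. F t $$ (a, b))" using assms unfolding continuous_coeff_def by blast
  hence "bounded ((\<lambda>t. F t $$ (a, b)) ` {0..T})"
    by (intro compact_imp_bounded compact_continuous_image compact_Icc)
  thus "\<exists>\<kappa>. \<forall>t\<in>{0..T}. \<bar>F t $$ (a, b)\<bar> \<le> \<kappa>" unfolding bounded_iff by simp
qed (use assms in \<open>simp add: continuous_coeff_def\<close>)

lemma abs_bounded_sum:
  fixes f :: "'i \<Rightarrow> 't \<Rightarrow> real"
  assumes "\<And>i. i \<in> S \<Longrightarrow> \<exists>\<kappa>. \<forall>t\<in>X. \<bar>f i t\<bar> \<le> \<kappa>"
  shows "\<exists>\<kappa>. \<forall>t\<in>X. \<bar>\<Sum>i\<in>S. f i t\<bar> \<le> \<kappa>"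
proof -
  obtain \<kappa> where \<kappa>: "\<And>i t. i \<in> S \<Longrightarrow> t \<in> X \<Longrightarrow> \<bar>f i t\<bar> \<le> \<kappa> i" using assms by metis
  have "\<bar>\<Sum>i\<in>S. f i t\<bar> \<le> (\<Sum>i\<in>S. \<kappa> i)" if "t \<in> X" for t
    by (rule order_trans[OF sum_abs sum_mono]) (rule \<kappa>[OF _ that])
  thus ?thesis by blast
qed

lemma mbounded_mult:
  assumes F: "mbounded T r n F" and G: "mbounded T n c G"
  shows "mbounded T r c (\<lambda>t. F t * G t)"
proof (rule mboundedI)
  fix a b assume ab: "a < r" "b < c"
  have "\<exists>\<kappa>. \<forall>t\<in>{0..T}. \<bar>F t $$ (a, k) * G t $$ (k, b)\<bar> \<le> \<kappa>" if k: "k < n" for k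
  proof -
    obtain p where p: "\<And>t. t \<in> {0..T} \<Longrightarrow> \<bar>F t $$ (a, k)\<bar> \<le> p"
      using mbounded_entryE[OF F ab(1) k] by blast
    obtain q where q: "\<And>t. t \<in> {0..T} \<Longrightarrow> \<bar>G t $$ (k, b)\<bar> \<le> q"
      using mbounded_entryE[OF G k ab(2)] by blast
    have "\<bar>F t $$ (a, k) * G t $$ (k, b)\<bar> \<le> p * q" if "t \<in> {0..T}" for t
      unfolding abs_mult by (rule mult_mono[OF p[OF that] q[OF that]]) (use p[OF that] in auto)
    thus ?thesis by blast
  qed
  hence "\<exists>\<kappa>. \<forall>t\<in>{0..T}. \<bar>\<Sum>k\<in>{0..<n}. F t $$ (a, k) * G t $$ (k, b)\<bar> \<le> \<kappa>"
    by (intro abs_bounded_sum) simp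
  moreover have "(F t * G t) $$ (a, b) = (\<Sum>k\<in>{0..<n}. F t $$ (a, k) * G t $$ (k, b))" if "t \<in> {0..T}" for t
    using ab mboundedD[OF F that] mboundedD[OF G that] by (simp add: scalar_prod_def)
  ultimately show "\<exists>\<kappa>. \<forall>t\<in>{0..T}. \<bar>(F t * G t) $$ (a, b)\<bar> \<le> \<kappa>" by simp
qed (rule mult_carrier_mat[OF mboundedD[OF F] mboundedD[OF G]])

lemma mbounded_add:
  assumes F: "mbounded T r c F" and G: "mbounded T r c G"
  shows "mbounded T r c (\<lambda>t. F t + G t)"
proof (rule mboundedI)
  fix a b assume ab: "a < r" "b < c"
  obtain p where p: "\<And>t. t \<in> {0..T} \<Longrightarrow> \<bar>F t $$ (a, b)\<bar> \<le> p" using mbounded_entryE[OF F ab] by blast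
  obtain q where q: "\<And>t. t \<in> {0..T} \<Longrightarrow> \<bar>G t $$ (a, b)\<bar> \<le> q" using mbounded_entryE[OF G ab] by blast
  have "\<bar>(F t + G t) $$ (a, b)\<bar> \<le> p + q" if "t \<in> {0..T}" for t
    using p[OF that] q[OF that] ab mboundedD[OF F that] mboundedD[OF G that] by simp
  thus "\<exists>\<kappa>. \<forall>t\<in>{0..T}. \<bar>(F t + G t) $$ (a, b)\<bar> \<le> \<kappa>" by blast
qed (rule add_carrier_mat[OF mboundedD[OF G]])

lemma mbounded_smult:
  assumes F: "mbounded T r c F"
  shows "mbounded T r c (\<lambda>t. k \<cdot>\<^sub>m F t)"
proof (rule mboundedI)
  fix a b assume ab: "a < r" "b < c"
  obtain p where p: "\<And>t. t \<in> {0..T} \<Longrightarrow> \<bar>F t $$ (a, b)\<bar> \<le> p" using mbounded_entryE[OF F ab] by blast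
  have "\<bar>(k \<cdot>\<^sub>m F t) $$ (a, b)\<bar> \<le> \<bar>k\<bar> * p" if "t \<in> {0..T}" for t
    using p[OF that] ab mboundedD[OF F that] by (simp add: abs_mult mult_left_mono)
  thus "\<exists>\<kappa>. \<forall>t\<in>{0..T}. \<bar>(k \<cdot>\<^sub>m F t) $$ (a, b)\<bar> \<le> \<kappa>" by blast
qed (rule smult_carrier_mat[OF mboundedD[OF F]])

lemma mbounded_uminus:
  assumes F: "mbounded T r c F"
  shows "mbounded T r c (\<lambda>t. - F t)"
proof (rule mboundedI)
  fix a b assume ab: "a < r" "b < c"
  obtain p where p: "\<And>t. t \<in> {0..T} \<Longrightarrow> \<bar>F t $$ (a, b)\<bar> \<le> p" using mbounded_entryE[OF F ab] by blast
  have "\<bar>(- F t) $$ (a, b)\<bar> \<le> p" if "t \<in> {0..T}" for t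
    using p[OF that] ab mboundedD[OF F that] by simp
  thus "\<exists>\<kappa>. \<forall>t\<in>{0..T}. \<bar>(- F t) $$ (a, b)\<bar> \<le> \<kappa>" by blast
qed (use mboundedD[OF F] in simp)

lemma mbounded_minus:
  assumes F: "mbounded T r c F" and G: "mbounded T r c G"
  shows "mbounded T r c (\<lambda>t. F t - G t)"
  by (rule mbounded_cong[OF mbounded_add[OF F mbounded_uminus[OF G]]])
     (rule minus_add_uminus_mat[OF mboundedD[OF F] mboundedD[OF G]])

lemma mbounded_transpose:
  assumes F: "mbounded T r c F"
  shows "mbounded T c r (\<lambda>t. transpose_mat (F t))"
proof (rule mboundedI)
  fix a b assume ab: "a < c" "b < r"
  obtain p where p: "\<And>t. t \<in> {0..T} \<Longrightarrow> \<bar>F t $$ (b, a)\<bar> \<le> p" using mbounded_entryE[OF F ab(2,1)] by blast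
  have "\<bar>transpose_mat (F t) $$ (a, b)\<bar> \<le> p" if "t \<in> {0..T}" for t
    using p[OF that] ab mboundedD[OF F that] by simp
  thus "\<exists>\<kappa>. \<forall>t\<in>{0..T}. \<bar>transpose_mat (F t) $$ (a, b)\<bar> \<le> \<kappa>" by blast
qed (use mboundedD[OF F] in simp)

lemma mbounded_msum:
  assumes F: "\<And>i. i \<in> S \<Longrightarrow> mbounded T r c (\<lambda>t. F t i)"
  shows "mbounded T r c (\<lambda>t. msum r c (F t) S)"
proof (rule mboundedI)
  fix a b assume ab: "a < r" "b < c"
  have "\<exists>\<kappa>. \<forall>t\<in>{0..T}. \<bar>F t i $$ (a, b)\<bar> \<le> \<kappa>" if "i \<in> S" for i
    using F[OF that] ab unfolding mbounded_def by blast
  hence "\<exists>\<kappa>. \<forall>t\<in>{0..T}. \<bar>\<Sum>i\<in>S. F t i $$ (a, b)\<bar> \<le> \<kappa>" by (rule abs_bounded_sum)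
  thus "\<exists>\<kappa>. \<forall>t\<in>{0..T}. \<bar>msum r c (F t) S $$ (a, b)\<bar> \<le> \<kappa>" using ab unfolding msum_def by simp
qed (simp add: msum_def)

lemma hcat_Nil: "hcat d [] = 0\<^sub>m d 0"
  unfolding hcat_def by simp

lemma hcat_Cons: "hcat d (X # Xs) = transpose_mat (transpose_mat X @\<^sub>r transpose_mat (hcat d Xs))"
  unfolding hcat_def by simp

text \<open>Entry form of one step of \<open>hcat\<close>, the common source of its boundedness and
  of its action on stacked vectors.\<close>

lemma append_cols_index:
  assumes "X \<in> carrier_mat n p" "Y \<in> carrier_mat n q" "a < n" "b < p + q"
  shows "transpose_mat (transpose_mat X @\<^sub>r transpose_mat Y) $$ (a, b) = (if b < p then X $$ (a, b) else Y $$ (a, b - p))"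
  using assms unfolding append_rows_def by auto

lemma append_cols_carrier:
  assumes "X \<in> carrier_mat n p" "Y \<in> carrier_mat n q"
  shows "transpose_mat (transpose_mat X @\<^sub>r transpose_mat Y) \<in> carrier_mat n (p + q)"
  using carrier_append_rows[of "transpose_mat X" p n "transpose_mat Y" q] assms by simp

lemma mbounded_hcat:
  assumes "list_all2 (\<lambda>d F. mbounded T n d F) ds Fs"
  shows "mbounded T n (sum_list ds) (\<lambda>t. hcat n (map (\<lambda>F. F t) Fs))"
  using assms
proof (induction rule: list_all2_induct)
  case Nil
  show ?case by (rule mboundedI) (simp_all add: hcat_Nil)
next
  case (Cons d ds F Fs)
  let ?H = "\<lambda>t. hcat n (map (\<lambda>F. F t) Fs)"
  note F = Cons.hyps(1) and H = Cons.IH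
  have "mbounded T n (d + sum_list ds) (\<lambda>t. transpose_mat (transpose_mat (F t) @\<^sub>r transpose_mat (?H t)))"
  proof (rule mboundedI)
    fix a b assume ab: "a < n" "b < d + sum_list ds"
    have eq: "transpose_mat (transpose_mat (F t) @\<^sub>r transpose_mat (?H t)) $$ (a, b)
        = (if b < d then F t $$ (a, b) else ?H t $$ (a, b - d))" if "t \<in> {0..T}" for t
      by (rule append_cols_index[OF mboundedD[OF F that] mboundedD[OF H that] ab])
    show "\<exists>\<kappa>. \<forall>t\<in>{0..T}. \<bar>transpose_mat (transpose_mat (F t) @\<^sub>r transpose_mat (?H t)) $$ (a, b)\<bar> \<le> \<kappa>"
    proof (cases "b < d")
      case True
      obtain p where p: "\<And>t. t \<in> {0..T} \<Longrightarrow> \<bar>F t $$ (a, b)\<bar> \<le> p" using mbounded_entryE[OF F ab(1) True] by blast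
      show ?thesis by (rule exI[of _ p]) (simp add: eq True p)
    next
      case False
      hence "b - d < sum_list ds" using ab by simp
      then obtain p where p: "\<And>t. t \<in> {0..T} \<Longrightarrow> \<bar>?H t $$ (a, b - d)\<bar> \<le> p"
        using mbounded_entryE[OF H ab(1)] by blast
      show ?thesis by (rule exI[of _ p]) (simp add: eq False p)
    qed
  qed (rule append_cols_carrier[OF mboundedD[OF F] mboundedD[OF H]])
  thus ?case by (simp add: hcat_Cons)
qed

section \<open>Coercive matrices and uniformly bounded inverses\<close>

definition coercive :: "real \<Rightarrow> nat \<Rightarrow> real mat \<Rightarrow> bool" where
  "coercive \<delta> d S \<longleftrightarrow> S \<in> carrier_mat d d \<and> (\<forall>v\<in>carrier_vec d. \<delta> * (v \<bullet> v) \<le> qform S v)"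

lemma scalar_prod_self:
  fixes v :: "real vec"
  shows "v \<in> carrier_vec d \<Longrightarrow> v \<bullet> v = (\<Sum>k<d. (v $ k)\<^sup>2)"
  by (simp add: scalar_prod_def power2_eq_square atLeast0LessThan)

lemma square_le_scalar_prod_self:
  fixes v :: "real vec"
  assumes "v \<in> carrier_vec d" "a < d"
  shows "(v $ a)\<^sup>2 \<le> v \<bullet> v"
  unfolding scalar_prod_self[OF assms(1)] by (rule member_le_sum) (use assms in auto)

text \<open>A vector in the kernel satisfies \<open>\<delta> * (v \<bullet> v) \<le> 0\<close> and
  vanishes, so the determinant is nonzero. Consequently \<open>mat_inverse\<close> succeeds and
  \<open>minv\<close> is not an unspecified value.\<close>

lemma coercive_invertible:
  assumes "0 < \<delta>" and S: "coercive \<delta> d S"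
  shows "minv S \<in> carrier_mat d d" "S * minv S = 1\<^sub>m d"
proof -
  have c: "S \<in> carrier_mat d d" using S unfolding coercive_def by blast
  have "v = 0\<^sub>v d" if v: "v \<in> carrier_vec d" "S *\<^sub>v v = 0\<^sub>v d" for v
  proof (rule eq_vecI)
    fix a assume a: "a < dim_vec (0\<^sub>v d :: real vec)"
    have "\<delta> * (v \<bullet> v) \<le> qform S v" using S v unfolding coercive_def by blast
    also have "qform S v = 0" unfolding qform_def v(2) using v(1) by simp
    finally have "v \<bullet> v \<le> 0" using assms(1) by (simp add: mult_le_0_iff)
    moreover have "(v $ a)\<^sup>2 \<le> v \<bullet> v" by (rule square_le_scalar_prod_self[OF v(1)]) (use a in simp)
    ultimately have "(v $ a)\<^sup>2 \<le> 0" by linarith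
    thus "v $ a = 0\<^sub>v d $ a" using a by simp
  qed (use v in simp)
  hence "det S \<noteq> 0" unfolding det_0_iff_vec_prod_zero[OF c] by blast
  hence u: "S \<in> Units (ring_mat TYPE(real) d undefined)" by (rule det_non_zero_imp_unit[OF c])
  obtain B where B: "mat_inverse S = Some B"
    using mat_inverse(1)[OF c, of undefined] u by (cases "mat_inverse S") auto
  show "minv S \<in> carrier_mat d d" "S * minv S = 1\<^sub>m d"
    using mat_inverse(2)[OF c B] unfolding minv_def B by auto
qed

text \<open>If \<open>w\<close> is column \<open>b\<close> of the inverse, then
  \<open>S *\<^sub>v w\<close> is a unit vector and coercivity reads
  \<open>\<delta> * (w \<bullet> w) \<le> w $ b\<close>. Coordinate \<open>b\<close> alone yields
  \<open>w $ b \<le> 1 / \<delta>\<close>; inserting this bounds every other coordinate. The bound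
  depends on \<delta> only, hence is uniform in time once \<delta> is.\<close>

lemma coercive_minv_le:
  assumes \<delta>: "0 < \<delta>" and S: "coercive \<delta> d S" and ab: "a < d" "b < d"
  shows "\<bar>minv S $$ (a, b)\<bar> \<le> 1 / \<delta>"
proof -
  note inv = coercive_invertible[OF \<delta> S]
  have c: "S \<in> carrier_mat d d" using S unfolding coercive_def by blast
  define w where "w = col (minv S) b"
  have w: "w \<in> carrier_vec d" unfolding w_def using inv(1) by (intro carrier_vecI) simp
  have "S *\<^sub>v w = col (S * minv S) b" unfolding w_def by (rule col_mult2[OF c inv(1) ab(2), symmetric])
  hence Sw: "S *\<^sub>v w = unit_vec d b" unfolding inv(2) using ab by simp
  have "\<delta> * (w \<bullet> w) \<le> qform S w" using S w unfolding coercive_def by blast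
  also have "qform S w = w $ b" unfolding qform_def Sw using w ab by simp
  finally have le: "\<delta> * (w \<bullet> w) \<le> w $ b" .
  have sq: "\<delta> * (w $ k)\<^sup>2 \<le> w $ b" if "k < d" for k
    using le mult_left_mono[OF square_le_scalar_prod_self[OF w that], of \<delta>] \<delta> by linarith
  have wb: "w $ b \<le> 1 / \<delta>"
  proof (cases "w $ b \<le> 0")
    case True
    also have "0 \<le> 1 / \<delta>" using \<delta> by simp
    finally show ?thesis .
  next
    case False
    have "(\<delta> * (w $ b)) * (w $ b) \<le> 1 * (w $ b)" using sq[OF ab(2)] by (simp add: power2_eq_square mult.assoc)
    hence "\<delta> * (w $ b) \<le> 1" by (rule mult_right_le_imp_le) (use False in simp)
    thus ?thesis using \<delta> by (simp add: pos_le_divide_eq mult.commute)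
  qed
  have "(w $ a)\<^sup>2 \<le> w $ b / \<delta>" using sq[OF ab(1)] \<delta> by (simp add: pos_le_divide_eq mult.commute)
  also have "\<dots> \<le> (1 / \<delta>) / \<delta>" using wb \<delta> by (intro divide_right_mono) auto
  also have "\<dots> = (1 / \<delta>)\<^sup>2" by (simp add: power2_eq_square)
  finally have "\<bar>w $ a\<bar>\<^sup>2 \<le> (1 / \<delta>)\<^sup>2" by simp
  hence "\<bar>w $ a\<bar> \<le> 1 / \<delta>" by (rule power2_le_imp_le) (use \<delta> in simp)
  thus ?thesis unfolding w_def using inv(1) ab by simp
qed

text \<open>The quadratic form of a block diagonal matrix is the sum of those of its blocks, so the
  constant \<delta> is inherited.\<close>

lemma coercive_four_block:
  assumes A: "coercive \<delta> d A" and B: "coercive \<delta> e B"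
  shows "coercive \<delta> (d + e) (four_block_mat A (0\<^sub>m d e) (0\<^sub>m e d) B)"
  unfolding coercive_def
proof (intro conjI ballI)
  have cA: "A \<in> carrier_mat d d" and cB: "B \<in> carrier_mat e e"
    using A B unfolding coercive_def by auto
  show "four_block_mat A (0\<^sub>m d e) (0\<^sub>m e d) B \<in> carrier_mat (d + e) (d + e)"
    using cA cB by (rule four_block_carrier_mat)
  fix v :: "real vec" assume v: "v \<in> carrier_vec (d + e)"
  define x y where "x = vec_first v d" and "y = vec_last v e"
  have xy: "x \<in> carrier_vec d" "y \<in> carrier_vec e" "v = x @\<^sub>v y"
    unfolding x_def y_def using v by auto
  have z: "0\<^sub>m d e *\<^sub>v y = 0\<^sub>v d" "0\<^sub>m e d *\<^sub>v x = 0\<^sub>v e" using xy by auto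
  have "four_block_mat A (0\<^sub>m d e) (0\<^sub>m e d) B *\<^sub>v v = (A *\<^sub>v x) @\<^sub>v (B *\<^sub>v y)"
    unfolding xy(3) using four_block_mat_mult_vec[OF cA _ _ cB xy(1,2), of "0\<^sub>m d e" "0\<^sub>m e d"] cA cB xy z by simp
  hence "qform (four_block_mat A (0\<^sub>m d e) (0\<^sub>m e d) B) v = qform A x + qform B y"
    unfolding qform_def using scalar_prod_append[of "A *\<^sub>v x" d "B *\<^sub>v y" e x y] cA cB xy by simp
  moreover have "v \<bullet> v = x \<bullet> x + y \<bullet> y"
    unfolding xy(3) by (rule scalar_prod_append[OF xy(1,2,1,2)])
  moreover have "\<delta> * (x \<bullet> x) \<le> qform A x" "\<delta> * (y \<bullet> y) \<le> qform B y"
    using A B xy unfolding coercive_def by auto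
  ultimately show "\<delta> * (v \<bullet> v) \<le> qform (four_block_mat A (0\<^sub>m d e) (0\<^sub>m e d) B) v"
    by (simp add: distrib_left)
qed

lemma coercive_diag_block:
  assumes "list_all2 (coercive \<delta>) ds As"
  shows "coercive \<delta> (sum_list ds) (diag_block_mat As)"
  using assms
proof (induction rule: list_all2_induct)
  case Nil
  show ?case unfolding coercive_def qform_def by (auto simp: scalar_prod_def)
next
  case (Cons d ds A As)
  have "A \<in> carrier_mat d d" "diag_block_mat As \<in> carrier_mat (sum_list ds) (sum_list ds)"
    using Cons unfolding coercive_def by auto
  thus ?case using coercive_four_block[OF Cons.hyps(1) Cons.IH] by (simp add: Let_def)
qed

text \<open>Expanding the quadratic form of
  \<open>S t - \<delta> \<cdot>\<^sub>m 1\<^sub>m d\<close> moves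
  \<open>\<delta> * (v \<bullet> v)\<close> to the other side.\<close>

lemma pos_weight_coercive:
  assumes "pos_weight T d S"
  shows "\<exists>\<delta>>0. \<forall>t\<in>{0..T}. coercive \<delta> d (S t)"
proof -
  obtain \<delta> where \<delta>: "0 < \<delta>" "\<And>t. t \<in> {0..T} \<Longrightarrow> psd d (S t - \<delta> \<cdot>\<^sub>m 1\<^sub>m d)"
    using assms unfolding pos_weight_def by blast
  have "coercive \<delta> d (S t)" if t: "t \<in> {0..T}" for t
    unfolding coercive_def
  proof (intro conjI ballI)
    show c: "S t \<in> carrier_mat d d" using assms t unfolding pos_weight_def bounded_coeff_def by blast
    fix v :: "real vec" assume v: "v \<in> carrier_vec d"
    have "0 \<le> qform (S t - \<delta> \<cdot>\<^sub>m 1\<^sub>m d) v" using \<delta>(2)[OF t] v unfolding psd_def by blast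
    also have "(S t - \<delta> \<cdot>\<^sub>m 1\<^sub>m d) *\<^sub>v v = S t *\<^sub>v v - \<delta> \<cdot>\<^sub>v v"
    proof -
      have "(\<delta> \<cdot>\<^sub>m 1\<^sub>m d) *\<^sub>v v = \<delta> \<cdot>\<^sub>v v"
      proof (rule eq_vecI)
        fix k assume "k < dim_vec (\<delta> \<cdot>\<^sub>v v)"
        hence k: "k < d" using v by simp
        have "((\<delta> \<cdot>\<^sub>m 1\<^sub>m d) *\<^sub>v v) $ k = (\<Sum>i\<in>{0..<d}. \<delta> * (if k = i then 1 else 0) * v $ i)"
          using k v by (auto simp: scalar_prod_def intro!: sum.cong)
        also have "\<dots> = (\<Sum>i\<in>{0..<d}. if k = i then \<delta> * v $ i else 0)"
          by (rule sum.cong) auto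
        finally show "((\<delta> \<cdot>\<^sub>m 1\<^sub>m d) *\<^sub>v v) $ k = (\<delta> \<cdot>\<^sub>v v) $ k" using k v by (simp add: sum.delta')
      qed (use v in simp)
      thus ?thesis using minus_mult_distrib_mat_vec[OF c _ v, of "\<delta> \<cdot>\<^sub>m 1\<^sub>m d"] by simp
    qed
    hence "qform (S t - \<delta> \<cdot>\<^sub>m 1\<^sub>m d) v = qform (S t) v - \<delta> * (v \<bullet> v)"
      unfolding qform_def using c v by (simp add: minus_scalar_prod_distrib[of _ d])
    finally show "\<delta> * (v \<bullet> v) \<le> qform (S t) v" by simp
  qed
  thus ?thesis using \<delta>(1) by blast
qed

lemma coercive_mono:
  assumes S: "coercive \<delta> d S" and le: "\<epsilon> \<le> \<delta>"
  shows "coercive \<epsilon> d S"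
  unfolding coercive_def
proof (intro conjI ballI)
  show "S \<in> carrier_mat d d" using S unfolding coercive_def by blast
  fix v :: "real vec" assume v: "v \<in> carrier_vec d"
  have "\<epsilon> * (v \<bullet> v) \<le> \<delta> * (v \<bullet> v)"
    by (rule mult_right_mono[OF le]) (simp add: scalar_prod_self[OF v] sum_nonneg)
  also have "\<dots> \<le> qform S v" using S v unfolding coercive_def by blast
  finally show "\<epsilon> * (v \<bullet> v) \<le> qform S v" .
qed

text \<open>A finite list of positive constants has a positive minimum, valid for all blocks and all
  times at once; 1 is an arbitrary start for the empty list.\<close>

lemma pos_weights_coercive:
  assumes "list_all2 (pos_weight T) ds Fs"
  shows "\<exists>\<delta>>0. \<forall>t\<in>{0..T}. list_all2 (coercive \<delta>) ds (map (\<lambda>F. F t) Fs)"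
  using assms
proof (induction rule: list_all2_induct)
  case Nil
  show ?case by (rule exI[of _ 1]) simp
next
  case (Cons d ds F Fs)
  obtain \<delta>1 where 1: "0 < \<delta>1" "\<forall>t\<in>{0..T}. coercive \<delta>1 d (F t)"
    using pos_weight_coercive[OF Cons.hyps(1)] by blast
  obtain \<delta>2 where 2: "0 < \<delta>2" "\<forall>t\<in>{0..T}. list_all2 (coercive \<delta>2) ds (map (\<lambda>F. F t) Fs)"
    using Cons.IH by blast
  have "list_all2 (coercive (min \<delta>1 \<delta>2)) (d # ds) (map (\<lambda>F. F t) (F # Fs))" if t: "t \<in> {0..T}" for t
  proof -
    have "coercive (min \<delta>1 \<delta>2) d (F t)"
      by (rule coercive_mono[OF 1(2)[rule_format, OF t] min.cobounded1])
    moreover have "list_all2 (coercive (min \<delta>1 \<delta>2)) ds (map (\<lambda>F. F t) Fs)"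
      by (rule list_all2_mono[OF 2(2)[rule_format, OF t]]) (rule coercive_mono[OF _ min.cobounded2])
    ultimately show ?thesis by simp
  qed
  thus ?case using 1(1) 2(1) by (intro exI[of _ "min \<delta>1 \<delta>2"]) simp
qed

lemma mbounded_minv_diag_block:
  assumes "list_all2 (pos_weight T) ds Fs"
  shows "mbounded T (sum_list ds) (sum_list ds) (\<lambda>t. minv (diag_block_mat (map (\<lambda>F. F t) Fs)))"
proof -
  obtain \<delta> where \<delta>: "0 < \<delta>" "\<And>t. t \<in> {0..T} \<Longrightarrow> list_all2 (coercive \<delta>) ds (map (\<lambda>F. F t) Fs)"
    using pos_weights_coercive[OF assms] by blast
  note c = coercive_diag_block[OF \<delta>(2)]
  show ?thesis
  proof (rule mboundedI)
    fix a b assume "a < sum_list ds" "b < sum_list ds"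
    hence "\<forall>t\<in>{0..T}. \<bar>minv (diag_block_mat (map (\<lambda>F. F t) Fs)) $$ (a, b)\<bar> \<le> 1 / \<delta>"
      using coercive_minv_le[OF \<delta>(1) c] by blast
    thus "\<exists>\<kappa>. \<forall>t\<in>{0..T}. \<bar>minv (diag_block_mat (map (\<lambda>F. F t) Fs)) $$ (a, b)\<bar> \<le> \<kappa>" ..
  qed (rule coercive_invertible(1)[OF \<delta>(1) c])
qed

text \<open>A single weight is a block diagonal matrix with one block.\<close>

lemma mbounded_minv:
  assumes "pos_weight T d F"
  shows "mbounded T d d (\<lambda>t. minv (F t))"
  using mbounded_minv_diag_block[of T "[d]" "[F]"] assms by (simp del: diag_block_mat.simps)

text \<open>\<open>invertible_mat\<close> provides a two-sided inverse of unknown dimensions.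
  Comparing dimensions in the two products fixes them, which makes \<open>A\<close> a unit of the
  matrix ring and lets \<open>mat_inverse\<close> succeed. It serves \<open>Nmat\<close>, whose
  invertibility is assumed rather than derived from coercivity.\<close>

lemma invertible_minv_carrier:
  assumes A: "A \<in> carrier_mat n n" and inv: "invertible_mat A"
  shows "minv A \<in> carrier_mat n n"
proof -
  obtain B where B: "A * B = 1\<^sub>m (dim_row A)" "B * A = 1\<^sub>m (dim_row B)"
    using inv unfolding invertible_mat_def inverts_mat_def by blast
  have "dim_col B = n" using arg_cong[OF B(1), of dim_col] A by simp
  moreover have "dim_row B = n" using arg_cong[OF B(2), of dim_col] A by simp
  ultimately have "B \<in> carrier_mat n n" by blast
  hence "A \<in> Units (ring_mat TYPE(real) n undefined)"
    using A B[unfolded \<open>dim_row B = n\<close>] unfolding Units_def ring_mat_def by auto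
  then obtain C where C: "mat_inverse A = Some C"
    using mat_inverse(1)[OF A, of undefined] by (cases "mat_inverse A") auto
  show ?thesis using mat_inverse(2)[OF A C] unfolding minv_def C by simp
qed

section \<open>Closed-loop coefficients\<close>

text \<open>A row of the concatenation is the concatenation of the rows, and the scalar product
  splits accordingly.\<close>

lemma append_cols_mult_vec:
  fixes X Y :: "real mat"
  assumes X: "X \<in> carrier_mat n p" and Y: "Y \<in> carrier_mat n q"
    and u: "u \<in> carrier_vec p" and v: "v \<in> carrier_vec q"
  shows "transpose_mat (transpose_mat X @\<^sub>r transpose_mat Y) *\<^sub>v (u @\<^sub>v v) = X *\<^sub>v u + Y *\<^sub>v v"
proof -
  define Z where "Z = transpose_mat (transpose_mat X @\<^sub>r transpose_mat Y)"
  have c: "Z \<in> carrier_mat n (p + q)" unfolding Z_def by (rule append_cols_carrier[OF X Y])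
  have "Z *\<^sub>v (u @\<^sub>v v) = X *\<^sub>v u + Y *\<^sub>v v"
  proof (rule eq_vecI)
    show "dim_vec (Z *\<^sub>v (u @\<^sub>v v)) = dim_vec (X *\<^sub>v u + Y *\<^sub>v v)" using c Y by simp
    fix k assume "k < dim_vec (X *\<^sub>v u + Y *\<^sub>v v)"
    hence k: "k < n" using Y by simp
    have "row Z k = row X k @\<^sub>v row Y k"
    proof (rule eq_vecI)
      fix b assume "b < dim_vec (row X k @\<^sub>v row Y k)"
      hence b: "b < p + q" using X Y by simp
      have "row Z k $ b = Z $$ (k, b)" using c k b by simp
      also have "\<dots> = (if b < p then X $$ (k, b) else Y $$ (k, b - p))"
        unfolding Z_def by (rule append_cols_index[OF X Y k b])
      also have "\<dots> = (row X k @\<^sub>v row Y k) $ b" using X Y k b by simp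
      finally show "row Z k $ b = (row X k @\<^sub>v row Y k) $ b" .
    qed (use c X Y in simp)
    moreover have "row X k \<in> carrier_vec p" "row Y k \<in> carrier_vec q" using X Y by auto
    ultimately have "row Z k \<bullet> (u @\<^sub>v v) = row X k \<bullet> u + row Y k \<bullet> v"
      using scalar_prod_append[of "row X k" p "row Y k" q u v] u v by simp
    thus "(Z *\<^sub>v (u @\<^sub>v v)) $ k = (X *\<^sub>v u + Y *\<^sub>v v) $ k"
      using c X Y k by simp
  qed
  thus ?thesis unfolding Z_def .
qed

lemma hcat_pair_mult_vec:
  assumes X: "X \<in> carrier_mat n p" and Y: "Y \<in> carrier_mat n q"
    and u: "u \<in> carrier_vec p" and v: "v \<in> carrier_vec q"
  shows "hcat n [X, Y] *\<^sub>v (u @\<^sub>v v) = X *\<^sub>v u + Y *\<^sub>v v"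
proof -
  \<comment> \<open>\<open>hcat\<close> ends with a block of width 0, and appending that block
    leaves \<open>Y\<close> unchanged.\<close>
  have "Y = transpose_mat (transpose_mat Y @\<^sub>r transpose_mat (0\<^sub>m n 0))"
    by (rule eq_matI) (use Y in \<open>auto simp: append_rows_def\<close>)
  hence "hcat n [X, Y] = transpose_mat (transpose_mat X @\<^sub>r transpose_mat Y)"
    by (simp add: hcat_Cons hcat_Nil)
  thus ?thesis using append_cols_mult_vec[OF assms] by simp
qed

lemma msum_mult_vec_index:
  assumes "\<And>i. i \<in> S \<Longrightarrow> F i \<in> carrier_mat r c" "y \<in> carrier_vec c" "k < r"
  shows "(msum r c F S *\<^sub>v y) $ k = (\<Sum>i\<in>S. (F i *\<^sub>v y) $ k)"
proof -
  have "(msum r c F S *\<^sub>v y) $ k = (\<Sum>l\<in>{0..<c}. (\<Sum>i\<in>S. F i $$ (k, l)) * y $ l)"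
    using assms by (simp add: msum_def scalar_prod_def)
  also have "\<dots> = (\<Sum>i\<in>S. \<Sum>l\<in>{0..<c}. F i $$ (k, l) * y $ l)"
    unfolding sum_distrib_right by (rule sum.swap)
  also have "\<dots> = (\<Sum>i\<in>S. (F i *\<^sub>v y) $ k)"
  proof (rule sum.cong[OF refl])
    fix i assume "i \<in> S"
    from assms(1)[OF this] assms(2,3) show "(\<Sum>l\<in>{0..<c}. F i $$ (k, l) * y $ l) = (F i *\<^sub>v y) $ k"
      by (simp add: scalar_prod_def)
  qed
  finally show ?thesis .
qed

lemma mult_mat_vec_uminus:
  fixes A :: "real mat"
  assumes "A \<in> carrier_mat r c" "v \<in> carrier_vec c"
  shows "A *\<^sub>v (- v) = - (A *\<^sub>v v)"
  using mult_mat_vec[OF assms, of "-1"] assms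
  by (simp add: uminus_vec_def smult_vec_def)

text \<open>Everything containing \<open>\<rho>\<close>, \<open>\<eta>\<close> or \<open>\<zeta>\<close> cancels: this is why \<open>\<xi>\<close> and \<open>\<theta>\<close> are chosen as they are.\<close>

lemma incentive_term_index:
  fixes \<eta> \<zeta> \<rho> :: "real mat"
  assumes c: "B1 \<in> carrier_mat n d1" "B2 \<in> carrier_mat n d2" "B3 \<in> carrier_mat n d3"
    "\<eta> \<in> carrier_mat d1 d2" "\<zeta> \<in> carrier_mat d1 d3" "\<rho> \<in> carrier_mat d2 d3"
    "k1 \<in> carrier_mat d1 n" "k2 \<in> carrier_mat d2 n" "k3 \<in> carrier_mat d3 n"
    and y: "y \<in> carrier_vec n" and k: "k < n"
    and \<xi>: "\<xi> = (- (1 / 3)) \<cdot>\<^sub>m k1 + \<eta> * k2 + \<zeta> * k3" and \<theta>: "\<theta> = - k2 + \<rho> * k3"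
  shows "((B1 * (\<xi> + \<eta> * \<theta>)) *\<^sub>v y) $ k + ((B2 * \<theta>) *\<^sub>v y) $ k
      + ((B1 * (\<eta> * \<rho> + \<zeta>) + B2 * \<rho> + B3) *\<^sub>v (- (k3 *\<^sub>v y))) $ k
    = - (1 / 3) * (B1 *\<^sub>v (k1 *\<^sub>v y)) $ k + (B2 *\<^sub>v (- (k2 *\<^sub>v y))) $ k + (B3 *\<^sub>v (- (k3 *\<^sub>v y))) $ k"
proof -
  define a b e where "a = k1 *\<^sub>v y" and "b = k2 *\<^sub>v y" and "e = k3 *\<^sub>v y"
  have v: "a \<in> carrier_vec d1" "b \<in> carrier_vec d2" "e \<in> carrier_vec d3"
    unfolding a_def b_def e_def using c y by (auto intro: mult_mat_vec_carrier)
  have c\<theta>: "\<theta> \<in> carrier_mat d2 n" unfolding \<theta> using c by simp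
  have c\<xi>: "\<xi> \<in> carrier_mat d1 n" unfolding \<xi> using c by simp
  have \<theta>y: "\<theta> *\<^sub>v y = - b + \<rho> *\<^sub>v e"
    unfolding \<theta> a_def b_def e_def
    by (subst add_mult_distrib_mat_vec[of _ d2 n]) (use c y in simp_all)
  have s: "((- (1 / 3)) \<cdot>\<^sub>m k1) *\<^sub>v y = (- (1 / 3)) \<cdot>\<^sub>v a"
    unfolding a_def by (rule eq_vecI) (use c y in \<open>auto simp: scalar_prod_def sum_distrib_left mult.assoc\<close>)
  have \<xi>y: "\<xi> *\<^sub>v y = (- (1 / 3)) \<cdot>\<^sub>v a + \<eta> *\<^sub>v b + \<zeta> *\<^sub>v e"
    unfolding \<xi> a_def b_def e_def s[unfolded a_def, symmetric]
    by (subst add_mult_distrib_mat_vec[of _ d1 n] | use c y in \<open>simp; fail\<close>)+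
  have \<eta>\<theta>: "\<eta> *\<^sub>v (\<theta> *\<^sub>v y) = - (\<eta> *\<^sub>v b) + \<eta> *\<^sub>v (\<rho> *\<^sub>v e)"
    unfolding \<theta>y by (subst mult_add_distrib_mat_vec[of _ d1 d2]) (use c v in \<open>simp_all add: mult_mat_vec_uminus[of _ d1 d2]\<close>)
  have "(\<xi> + \<eta> * \<theta>) *\<^sub>v y = \<xi> *\<^sub>v y + \<eta> *\<^sub>v (\<theta> *\<^sub>v y)"
    by (subst add_mult_distrib_mat_vec[of _ d1 n]) (use c c\<theta> c\<xi> y in simp_all)
  \<comment> \<open>The term \<open>\<eta> *\<^sub>v b\<close> of \<xi> meets its negative coming
    from \<theta>.\<close>
  also have "\<dots> = (- (1 / 3)) \<cdot>\<^sub>v a + \<zeta> *\<^sub>v e + \<eta> *\<^sub>v (\<rho> *\<^sub>v e)"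
    unfolding \<xi>y \<eta>\<theta> by (rule eq_vecI) (use c v in \<open>auto simp: carrier_vecD\<close>)
  finally have 1: "(\<xi> + \<eta> * \<theta>) *\<^sub>v y = (- (1 / 3)) \<cdot>\<^sub>v a + \<zeta> *\<^sub>v e + \<eta> *\<^sub>v (\<rho> *\<^sub>v e)" .
  \<comment> \<open>\<open>z\<close> and \<open>r\<close> are what remains of \<zeta> and of the
    product of \<eta> and \<rho>; both return in \<open>t3\<close> with the opposite sign.\<close>
  define z r where "z = \<zeta> *\<^sub>v e" and "r = \<eta> *\<^sub>v (\<rho> *\<^sub>v e)"
  have zr: "z \<in> carrier_vec d1" "r \<in> carrier_vec d1" unfolding z_def r_def using c v by auto
  have t1: "((B1 * (\<xi> + \<eta> * \<theta>)) *\<^sub>v y) $ k = - (1 / 3) * (B1 *\<^sub>v a) $ k + (B1 *\<^sub>v z) $ k + (B1 *\<^sub>v r) $ k"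
  proof -
    have "(B1 * (\<xi> + \<eta> * \<theta>)) *\<^sub>v y = B1 *\<^sub>v ((\<xi> + \<eta> * \<theta>) *\<^sub>v y)"
      by (rule assoc_mult_mat_vec[of _ n d1 _ n]) (use c c\<theta> c\<xi> y in simp_all)
    also have "\<dots> = B1 *\<^sub>v ((- (1 / 3)) \<cdot>\<^sub>v a + z + r)" unfolding 1 z_def r_def ..
    also have "\<dots> = B1 *\<^sub>v ((- (1 / 3)) \<cdot>\<^sub>v a + z) + B1 *\<^sub>v r"
      by (rule mult_add_distrib_mat_vec[of _ n d1]) (use c v zr in simp_all)
    also have "B1 *\<^sub>v ((- (1 / 3)) \<cdot>\<^sub>v a + z) = B1 *\<^sub>v ((- (1 / 3)) \<cdot>\<^sub>v a) + B1 *\<^sub>v z"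
      by (rule mult_add_distrib_mat_vec[of _ n d1]) (use c v zr in simp_all)
    also have "B1 *\<^sub>v ((- (1 / 3)) \<cdot>\<^sub>v a) = (- (1 / 3)) \<cdot>\<^sub>v (B1 *\<^sub>v a)" by (rule mult_mat_vec[OF c(1) v(1)])
    finally show ?thesis using c k by simp
  qed
  have t2: "((B2 * \<theta>) *\<^sub>v y) $ k = - (B2 *\<^sub>v b) $ k + (B2 *\<^sub>v (\<rho> *\<^sub>v e)) $ k"
  proof -
    have "(B2 * \<theta>) *\<^sub>v y = B2 *\<^sub>v (\<theta> *\<^sub>v y)" by (rule assoc_mult_mat_vec[OF c(2) c\<theta> y])
    also have "\<dots> = B2 *\<^sub>v (- b) + B2 *\<^sub>v (\<rho> *\<^sub>v e)" unfolding \<theta>y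
      by (rule mult_add_distrib_mat_vec[of _ n d2]) (use c v in simp_all)
    also have "B2 *\<^sub>v (- b) = - (B2 *\<^sub>v b)" by (rule mult_mat_vec_uminus[OF c(2) v(2)])
    finally show ?thesis using c k by simp
  qed
  have t3: "((B1 * (\<eta> * \<rho> + \<zeta>) + B2 * \<rho> + B3) *\<^sub>v (- e)) $ k
      = - ((B1 *\<^sub>v r) $ k + (B1 *\<^sub>v z) $ k + (B2 *\<^sub>v (\<rho> *\<^sub>v e)) $ k + (B3 *\<^sub>v e) $ k)"
  proof -
    have "(B1 * (\<eta> * \<rho> + \<zeta>) + B2 * \<rho> + B3) *\<^sub>v (- e) = - ((B1 * (\<eta> * \<rho> + \<zeta>) + B2 * \<rho> + B3) *\<^sub>v e)"
      by (rule mult_mat_vec_uminus[of _ n d3]) (use c v in simp_all)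
    moreover have "(B1 * (\<eta> * \<rho> + \<zeta>) + B2 * \<rho> + B3) *\<^sub>v e = (B1 * (\<eta> * \<rho> + \<zeta>) + B2 * \<rho>) *\<^sub>v e + B3 *\<^sub>v e"
      by (rule add_mult_distrib_mat_vec[of _ n d3]) (use c v in simp_all)
    moreover have "(B1 * (\<eta> * \<rho> + \<zeta>) + B2 * \<rho>) *\<^sub>v e = (B1 * (\<eta> * \<rho> + \<zeta>)) *\<^sub>v e + (B2 * \<rho>) *\<^sub>v e"
      by (rule add_mult_distrib_mat_vec[of _ n d3]) (use c v in simp_all)
    moreover have "(B2 * \<rho>) *\<^sub>v e = B2 *\<^sub>v (\<rho> *\<^sub>v e)" by (rule assoc_mult_mat_vec[OF c(2,6) v(3)])
    moreover have "(B1 * (\<eta> * \<rho> + \<zeta>)) *\<^sub>v e = B1 *\<^sub>v ((\<eta> * \<rho> + \<zeta>) *\<^sub>v e)"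
      by (rule assoc_mult_mat_vec[of _ n d1 _ d3]) (use c v in simp_all)
    moreover have "(\<eta> * \<rho> + \<zeta>) *\<^sub>v e = (\<eta> * \<rho>) *\<^sub>v e + \<zeta> *\<^sub>v e"
      by (rule add_mult_distrib_mat_vec[of _ d1 d3]) (use c v in simp_all)
    moreover have "(\<eta> * \<rho>) *\<^sub>v e = \<eta> *\<^sub>v (\<rho> *\<^sub>v e)" by (rule assoc_mult_mat_vec[OF c(4,6) v(3)])
    moreover have "B1 *\<^sub>v (r + z) = B1 *\<^sub>v r + B1 *\<^sub>v z"
      by (rule mult_add_distrib_mat_vec[OF c(1) zr(2,1)])
    ultimately have "(B1 * (\<eta> * \<rho> + \<zeta>) + B2 * \<rho> + B3) *\<^sub>v (- e)
        = - (B1 *\<^sub>v r + B1 *\<^sub>v z + B2 *\<^sub>v (\<rho> *\<^sub>v e) + B3 *\<^sub>v e)"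
      unfolding r_def z_def by simp
    thus ?thesis using c k by simp
  qed
  have t4: "(B2 *\<^sub>v (- b)) $ k = - (B2 *\<^sub>v b) $ k" "(B3 *\<^sub>v (- e)) $ k = - (B3 *\<^sub>v e) $ k"
    using mult_mat_vec_uminus[OF c(2) v(2)] mult_mat_vec_uminus[OF c(3) v(3)] c k by simp_all
  show ?thesis using t1 t2 t3 t4 unfolding a_def b_def e_def by linarith
qed

text \<open>\<open>incentive_term_index\<close> is summed over all pairs. Its term with
  \<open>k1\<close> does not depend on \<open>j\<close>, so the three copies of -1/3 add up to the
  full feedback of Level 1. The matrices are generic so that the identity serves both the drift,
  with the worst-case disturbance inside \<open>A\<close>, and the diffusion.\<close>

lemma closed_loop_index:
  fixes dimB dimC :: "nat \<Rightarrow> nat \<Rightarrow> nat"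
  assumes c: "\<And>i j. i \<in> {1..2} \<Longrightarrow> j \<in> {1..3} \<Longrightarrow>
      B1 i \<in> carrier_mat n (dimA i) \<and> B2 i j \<in> carrier_mat n (dimB i j) \<and> B3 j i \<in> carrier_mat n (dimC j i) \<and>
      \<eta> i j \<in> carrier_mat (dimA i) (dimB i j) \<and> \<zeta> i j \<in> carrier_mat (dimA i) (dimC j i) \<and>
      \<rho> i j \<in> carrier_mat (dimB i j) (dimC j i) \<and>
      k1 i \<in> carrier_mat (dimA i) n \<and> k2 i j \<in> carrier_mat (dimB i j) n \<and> k3 j i \<in> carrier_mat (dimC j i) n \<and>
      \<xi> i j = (- (1 / 3)) \<cdot>\<^sub>m k1 i + \<eta> i j * k2 i j + \<zeta> i j * k3 j i \<and> \<theta> i j = - k2 i j + \<rho> i j * k3 j i \<and>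
      H j i = B1 i * (\<eta> i j * \<rho> i j + \<zeta> i j) + B2 i j * \<rho> i j + B3 j i"
    and A: "A \<in> carrier_mat n n" and y: "y \<in> carrier_vec n" and k: "k < n"
  shows "((A + msum n n (\<lambda>(i, j). B1 i * (\<xi> i j + \<eta> i j * \<theta> i j)) ({1..2} \<times> {1..3})
        + msum n n (\<lambda>(i, j). B2 i j * \<theta> i j) ({1..2} \<times> {1..3})) *\<^sub>v y) $ k
      + (\<Sum>j\<in>{1..3}. (hcat n [H j 1, H j 2] *\<^sub>v (- (k3 j 1 *\<^sub>v y) @\<^sub>v - (k3 j 2 *\<^sub>v y))) $ k)
    = (A *\<^sub>v y) $ k + (\<Sum>i\<in>{1..2}. (B1 i *\<^sub>v (- (k1 i *\<^sub>v y))) $ k)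
      + (\<Sum>(i, j)\<in>{1..2} \<times> {1..3}. (B2 i j *\<^sub>v (- (k2 i j *\<^sub>v y))) $ k)
      + (\<Sum>(j, i)\<in>{1..3} \<times> {1..2}. (B3 j i *\<^sub>v (- (k3 j i *\<^sub>v y))) $ k)"
proof -
  let ?S = "{1..2} \<times> {1..3} :: (nat \<times> nat) set"
  have cc: "B1 i \<in> carrier_mat n (dimA i)" "B2 i j \<in> carrier_mat n (dimB i j)" "B3 j i \<in> carrier_mat n (dimC j i)"
    "\<eta> i j \<in> carrier_mat (dimA i) (dimB i j)" "\<zeta> i j \<in> carrier_mat (dimA i) (dimC j i)"
    "\<rho> i j \<in> carrier_mat (dimB i j) (dimC j i)"
    "k1 i \<in> carrier_mat (dimA i) n" "k2 i j \<in> carrier_mat (dimB i j) n" "k3 j i \<in> carrier_mat (dimC j i) n"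
    "\<xi> i j = (- (1 / 3)) \<cdot>\<^sub>m k1 i + \<eta> i j * k2 i j + \<zeta> i j * k3 j i" "\<theta> i j = - k2 i j + \<rho> i j * k3 j i"
    "H j i = B1 i * (\<eta> i j * \<rho> i j + \<zeta> i j) + B2 i j * \<rho> i j + B3 j i"
    if "i \<in> {1..2}" "j \<in> {1..3}" for i j
    using c[OF that] by blast+
  have c1: "B1 i * (\<xi> i j + \<eta> i j * \<theta> i j) \<in> carrier_mat n n" "B2 i j * \<theta> i j \<in> carrier_mat n n"
      "H j i \<in> carrier_mat n (dimC j i)" if "i \<in> {1..2}" "j \<in> {1..3}" for i j
    unfolding cc(10-12)[OF that] using cc(1-9)[OF that] by simp_all
  have ck: "- (k3 j i *\<^sub>v y) \<in> carrier_vec (dimC j i)" if "i \<in> {1..2}" "j \<in> {1..3}" for i j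
    using cc(9)[OF that] y by simp
  \<comment> \<open>The row block of player \<open>j\<close> acts on the stacked control as a sum
    over \<open>i\<close>, which brings all terms to sums over the same pairs.\<close>
  have h: "(hcat n [H j 1, H j 2] *\<^sub>v (- (k3 j 1 *\<^sub>v y) @\<^sub>v - (k3 j 2 *\<^sub>v y))) $ k
      = (\<Sum>i\<in>{1..2}. (H j i *\<^sub>v (- (k3 j i *\<^sub>v y))) $ k)" if j: "j \<in> {1..3}" for j
  proof -
    have i: "(1::nat) \<in> {1..2}" "(2::nat) \<in> {1..2}" by auto
    have "hcat n [H j 1, H j 2] *\<^sub>v (- (k3 j 1 *\<^sub>v y) @\<^sub>v - (k3 j 2 *\<^sub>v y))
        = H j 1 *\<^sub>v (- (k3 j 1 *\<^sub>v y)) + H j 2 *\<^sub>v (- (k3 j 2 *\<^sub>v y))"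
      by (rule hcat_pair_mult_vec[OF c1(3)[OF i(1) j] c1(3)[OF i(2) j] ck[OF i(1) j] ck[OF i(2) j]])
    moreover have "{1..2::nat} = {1, 2}" by auto
    ultimately show ?thesis using k c1(3)[OF i(2) j] by simp
  qed
  have m1: "msum n n (\<lambda>(i, j). B1 i * (\<xi> i j + \<eta> i j * \<theta> i j)) ?S \<in> carrier_mat n n"
    and m2: "msum n n (\<lambda>(i, j). B2 i j * \<theta> i j) ?S \<in> carrier_mat n n"
    unfolding msum_def by simp_all
  have "((A + msum n n (\<lambda>(i, j). B1 i * (\<xi> i j + \<eta> i j * \<theta> i j)) ?S
        + msum n n (\<lambda>(i, j). B2 i j * \<theta> i j) ?S) *\<^sub>v y) $ k
      = (A *\<^sub>v y) $ k + (msum n n (\<lambda>(i, j). B1 i * (\<xi> i j + \<eta> i j * \<theta> i j)) ?S *\<^sub>v y) $ k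
        + (msum n n (\<lambda>(i, j). B2 i j * \<theta> i j) ?S *\<^sub>v y) $ k"
    using add_mult_distrib_mat_vec[OF add_carrier_mat[OF m1] m2 y, of A] add_mult_distrib_mat_vec[OF A m1 y] m1 m2 k
    by simp
  also have "(msum n n (\<lambda>(i, j). B1 i * (\<xi> i j + \<eta> i j * \<theta> i j)) ?S *\<^sub>v y) $ k
      = (\<Sum>(i, j)\<in>?S. ((B1 i * (\<xi> i j + \<eta> i j * \<theta> i j)) *\<^sub>v y) $ k)"
  proof (subst msum_mult_vec_index[OF _ y k])
    fix p assume "p \<in> ?S"
    then obtain i j where p: "p = (i, j)" "i \<in> {1..2}" "j \<in> {1..3}" by (rule SigmaE)
    show "(case p of (i, j) \<Rightarrow> B1 i * (\<xi> i j + \<eta> i j * \<theta> i j)) \<in> carrier_mat n n"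
      unfolding p(1) prod.case by (rule c1(1)[OF p(2,3)])
  qed (rule sum.cong[OF refl], simp add: case_prod_beta)
  also have "(msum n n (\<lambda>(i, j). B2 i j * \<theta> i j) ?S *\<^sub>v y) $ k
      = (\<Sum>(i, j)\<in>?S. ((B2 i j * \<theta> i j) *\<^sub>v y) $ k)"
  proof (subst msum_mult_vec_index[OF _ y k])
    fix p assume "p \<in> ?S"
    then obtain i j where p: "p = (i, j)" "i \<in> {1..2}" "j \<in> {1..3}" by (rule SigmaE)
    show "(case p of (i, j) \<Rightarrow> B2 i j * \<theta> i j) \<in> carrier_mat n n"
      unfolding p(1) prod.case by (rule c1(2)[OF p(2,3)])
  qed (rule sum.cong[OF refl], simp add: case_prod_beta)
  finally have L: "((A + msum n n (\<lambda>(i, j). B1 i * (\<xi> i j + \<eta> i j * \<theta> i j)) ?S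
        + msum n n (\<lambda>(i, j). B2 i j * \<theta> i j) ?S) *\<^sub>v y) $ k
      = (A *\<^sub>v y) $ k + (\<Sum>(i, j)\<in>?S. ((B1 i * (\<xi> i j + \<eta> i j * \<theta> i j)) *\<^sub>v y) $ k)
        + (\<Sum>(i, j)\<in>?S. ((B2 i j * \<theta> i j) *\<^sub>v y) $ k)" .
  \<comment> \<open>Level 3 orders its indices as \<open>(j, i)\<close>, the other levels as
    \<open>(i, j)\<close>.\<close>
  have swap: "(\<Sum>j\<in>{1..3}. \<Sum>i\<in>{1..2}. f j i) = (\<Sum>(i, j)\<in>?S. f j i)" for f :: "nat \<Rightarrow> nat \<Rightarrow> real"
    by (subst sum.swap) (rule sum.cartesian_product)
  have R: "(\<Sum>j\<in>{1..3}. (hcat n [H j 1, H j 2] *\<^sub>v (- (k3 j 1 *\<^sub>v y) @\<^sub>v - (k3 j 2 *\<^sub>v y))) $ k)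
      = (\<Sum>(i, j)\<in>?S. (H j i *\<^sub>v (- (k3 j i *\<^sub>v y))) $ k)"
    unfolding swap[symmetric] by (rule sum.cong[OF refl h])
  have "(\<Sum>(i, j)\<in>?S. ((B1 i * (\<xi> i j + \<eta> i j * \<theta> i j)) *\<^sub>v y) $ k)
        + (\<Sum>(i, j)\<in>?S. ((B2 i j * \<theta> i j) *\<^sub>v y) $ k) + (\<Sum>(i, j)\<in>?S. (H j i *\<^sub>v (- (k3 j i *\<^sub>v y))) $ k)
      = (\<Sum>(i, j)\<in>?S. - (1 / 3) * (B1 i *\<^sub>v (k1 i *\<^sub>v y)) $ k + (B2 i j *\<^sub>v (- (k2 i j *\<^sub>v y))) $ k
          + (B3 j i *\<^sub>v (- (k3 j i *\<^sub>v y))) $ k)"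
    unfolding sum.distrib[symmetric]
  proof (rule sum.cong[OF refl])
    fix p assume "p \<in> ?S"
    then obtain i j where p: "p = (i, j)" "i \<in> {1..2}" "j \<in> {1..3}" by (rule SigmaE)
    show "(case p of (i, j) \<Rightarrow> ((B1 i * (\<xi> i j + \<eta> i j * \<theta> i j)) *\<^sub>v y) $ k)
        + (case p of (i, j) \<Rightarrow> ((B2 i j * \<theta> i j) *\<^sub>v y) $ k)
        + (case p of (i, j) \<Rightarrow> (H j i *\<^sub>v (- (k3 j i *\<^sub>v y))) $ k)
      = (case p of (i, j) \<Rightarrow> - (1 / 3) * (B1 i *\<^sub>v (k1 i *\<^sub>v y)) $ k + (B2 i j *\<^sub>v (- (k2 i j *\<^sub>v y))) $ k
          + (B3 j i *\<^sub>v (- (k3 j i *\<^sub>v y))) $ k)"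
      unfolding p(1) prod.case cc(12)[OF p(2,3)]
      by (rule incentive_term_index[OF cc(1-9)[OF p(2,3)] y k cc(10,11)[OF p(2,3)]])
  qed
  also have "\<dots> = (\<Sum>(i, j)\<in>?S. - (1 / 3) * (B1 i *\<^sub>v (k1 i *\<^sub>v y)) $ k)
      + (\<Sum>(i, j)\<in>?S. (B2 i j *\<^sub>v (- (k2 i j *\<^sub>v y))) $ k) + (\<Sum>(i, j)\<in>?S. (B3 j i *\<^sub>v (- (k3 j i *\<^sub>v y))) $ k)"
    unfolding sum.distrib[symmetric] by (rule sum.cong[OF refl]) (simp only: case_prod_beta)
  also have "(\<Sum>(i, j)\<in>?S. - (1 / 3) * (B1 i *\<^sub>v (k1 i *\<^sub>v y)) $ k) = (\<Sum>i\<in>{1..2}. (B1 i *\<^sub>v (- (k1 i *\<^sub>v y))) $ k)"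
    unfolding sum.cartesian_product[symmetric]
  proof (rule sum.cong[OF refl])
    fix i :: nat assume i: "i \<in> {1..2}"
    have "B1 i \<in> carrier_mat n (dimA i)" "k1 i *\<^sub>v y \<in> carrier_vec (dimA i)"
      using cc(1,7)[OF i, of 1] y by auto
    hence "(B1 i *\<^sub>v (- (k1 i *\<^sub>v y))) $ k = - (B1 i *\<^sub>v (k1 i *\<^sub>v y)) $ k"
      using mult_mat_vec_uminus[of "B1 i" n "dimA i" "k1 i *\<^sub>v y"] k by simp
    thus "(\<Sum>j\<in>{1..3::nat}. - (1 / 3) * (B1 i *\<^sub>v (k1 i *\<^sub>v y)) $ k) = (B1 i *\<^sub>v (- (k1 i *\<^sub>v y))) $ k"
      by simp
  qed
  also have "(\<Sum>(i, j)\<in>?S. (B3 j i *\<^sub>v (- (k3 j i *\<^sub>v y))) $ k)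
      = (\<Sum>(j, i)\<in>{1..3} \<times> {1..2}. (B3 j i *\<^sub>v (- (k3 j i *\<^sub>v y))) $ k)"
    unfolding swap[symmetric] by (rule sum.cartesian_product)
  finally show ?thesis unfolding L R by linarith
qed

lemma mbounded_lipschitz:
  assumes F: "mbounded T r c F"
  shows "\<exists>\<kappa>\<ge>0. \<forall>t\<in>{0..T}. \<forall>x\<in>carrier_vec c. \<forall>y\<in>carrier_vec c. \<forall>k<r.
    \<bar>(F t *\<^sub>v x) $ k - (F t *\<^sub>v y) $ k\<bar> \<le> \<kappa> * (\<Sum>l<c. \<bar>x $ l - y $ l\<bar>)"
proof -
  obtain q where q: "\<And>a b t. a < r \<Longrightarrow> b < c \<Longrightarrow> t \<in> {0..T} \<Longrightarrow> \<bar>F t $$ (a, b)\<bar> \<le> q a b"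
    using F unfolding mbounded_def by metis
  \<comment> \<open>The sum of all entry bounds dominates each of them; the absolute values make it
    nonnegative in every case.\<close>
  define \<kappa> where "\<kappa> = (\<Sum>p\<in>{..<r} \<times> {..<c}. \<bar>q (fst p) (snd p)\<bar>)"
  have \<kappa>: "\<bar>F t $$ (a, b)\<bar> \<le> \<kappa>" if "a < r" "b < c" "t \<in> {0..T}" for a b t
  proof -
    have "\<bar>F t $$ (a, b)\<bar> \<le> \<bar>q a b\<bar>" using q[OF that] by linarith
    also have "\<dots> \<le> \<kappa>"
      unfolding \<kappa>_def using member_le_sum[of "(a, b)" "{..<r} \<times> {..<c}" "\<lambda>p. \<bar>q (fst p) (snd p)\<bar>"] that by simp
    finally show ?thesis .
  qed
  have "\<bar>(F t *\<^sub>v x) $ k - (F t *\<^sub>v y) $ k\<bar> \<le> \<kappa> * (\<Sum>l<c. \<bar>x $ l - y $ l\<bar>)"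
    if t: "t \<in> {0..T}" and x: "x \<in> carrier_vec c" and y: "y \<in> carrier_vec c" and k: "k < r" for t x y k
  proof -
    have e: "(F t *\<^sub>v v) $ k = (\<Sum>l<c. F t $$ (k, l) * v $ l)" if "v \<in> carrier_vec c" for v
      using mboundedD[OF F t] that k by (simp add: scalar_prod_def atLeast0LessThan)
    have "(F t *\<^sub>v x) $ k - (F t *\<^sub>v y) $ k = (\<Sum>l<c. F t $$ (k, l) * (x $ l - y $ l))"
      unfolding e[OF x] e[OF y] by (simp add: sum_subtractf right_diff_distrib)
    also have "\<bar>\<dots>\<bar> \<le> (\<Sum>l<c. \<bar>F t $$ (k, l) * (x $ l - y $ l)\<bar>)" by (rule sum_abs)
    also have "\<dots> \<le> (\<Sum>l<c. \<kappa> * \<bar>x $ l - y $ l\<bar>)"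
      unfolding abs_mult by (intro sum_mono mult_right_mono \<kappa>[OF k _ t]) auto
    finally show ?thesis unfolding sum_distrib_left .
  qed
  moreover have "0 \<le> \<kappa>" unfolding \<kappa>_def by (rule sum_nonneg) simp
  ultimately show ?thesis by blast
qed

lemma vsum_index: "k < d \<Longrightarrow> vsum d f S $ k = (\<Sum>i\<in>S. f i $ k)"
  unfolding vsum_def by simp

lemma vsum_carrier: "vsum d f S \<in> carrier_vec d"
  unfolding vsum_def by simp

text \<open>The exceptional set in the product of paths and times is measurable by progressive
  measurability. Its slices at a fixed time are null by \<open>eq\<close>, so by Fubini its slice
  along almost every path is null too.\<close>

lemma (in brownian) L2F_AE_AE_eq:
  assumes T: "0 \<le> T" and u: "L2F M W T d u" and v: "L2F M W T d v"
    and eq: "\<And>t. t \<in> {0..T} \<Longrightarrow> AE \<omega> in M. u t \<omega> = v t \<omega>"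
  shows "AE \<omega> in M. AE t in lborel. t \<in> {0..T} \<longrightarrow> u t \<omega> = v t \<omega>"
proof -
  interpret P: pair_sigma_finite M "lborel :: real measure" ..
  \<comment> \<open>Coordinates times the indicator are compared because these are the jointly
    measurable expressions; outside \<open>{0..T}\<close> both sides vanish.\<close>
  have "AE \<omega> in M. AE t in lborel. \<forall>k<d. indicator {0..T} t * u t \<omega> $ k = (indicator {0..T} t * v t \<omega> $ k :: real)"
  proof (subst P.AE_commute)
    have m: "(\<lambda>p. indicator {0..T} (snd p) * (w (snd p) (fst p) $ k) :: real) \<in> borel_measurable (M \<Otimes>\<^sub>M lborel)"
      if "L2F M W T d w" "k < d" for w k
      using prog_measurable_pair[of T "\<lambda>t \<omega>. w t \<omega> $ k"] that T unfolding L2F_def by (simp add: case_prod_beta)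
    have "{p \<in> space (M \<Otimes>\<^sub>M lborel). \<forall>k\<in>{..<d}. indicator {0..T} (snd p) * u (snd p) (fst p) $ k
        = (indicator {0..T} (snd p) * v (snd p) (fst p) $ k :: real)} \<in> sets (M \<Otimes>\<^sub>M lborel)"
      by (intro sets.sets_Collect_finite_All borel_measurable_eq m u v) auto
    thus "{p \<in> space (M \<Otimes>\<^sub>M lborel). \<forall>k<d. indicator {0..T} (snd p) * u (snd p) (fst p) $ k
        = (indicator {0..T} (snd p) * v (snd p) (fst p) $ k :: real)} \<in> sets (M \<Otimes>\<^sub>M lborel)"
      unfolding Ball_def lessThan_iff .
    show "AE t in lborel. AE \<omega> in M. \<forall>k<d. indicator {0..T} t * u t \<omega> $ k = (indicator {0..T} t * v t \<omega> $ k :: real)"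
    proof (rule AE_I2)
      fix t :: real
      show "AE \<omega> in M. \<forall>k<d. indicator {0..T} t * u t \<omega> $ k = (indicator {0..T} t * v t \<omega> $ k :: real)"
      proof (cases "t \<in> {0..T}")
        case True
        show ?thesis using eq[OF True] by eventually_elim simp
      qed simp
    qed
  qed
  thus ?thesis using AE_space
  proof eventually_elim
    case (elim \<omega>)
    show ?case using elim(1)
    proof eventually_elim
      case (elim t)
      show ?case
      proof
        assume t: "t \<in> {0..T}"
        have c: "u t \<omega> \<in> carrier_vec d" "v t \<omega> \<in> carrier_vec d"
          using u v t \<open>\<omega> \<in> space M\<close> unfolding L2F_def by blast+
        show "u t \<omega> = v t \<omega>"
          by (rule eq_vecI) (use elim t c in auto)
      qed
    qed
  qed
qed

section \<open>Boundedness of the gains and of the hat coefficients\<close>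

locale hierarchical_game =
  fixes g :: game and P :: "real \<Rightarrow> real mat" and \<eta> \<zeta> \<rho> :: "nat \<Rightarrow> nat \<Rightarrow> real \<Rightarrow> real mat"
  assumes standing: "standing_assumptions g" and riccati: "riccati_solution g P"
    and \<eta>: "\<And>i j. i \<in> {1..2} \<Longrightarrow> j \<in> {1..3} \<Longrightarrow>
           continuous_coeff (horizon g) (dim1 g i) (dim2 g i j) (\<eta> i j)"
    and \<zeta>: "\<And>i j. i \<in> {1..2} \<Longrightarrow> j \<in> {1..3} \<Longrightarrow>
           continuous_coeff (horizon g) (dim1 g i) (dim3 g j i) (\<zeta> i j)"
    and \<rho>: "\<And>i j. i \<in> {1..2} \<Longrightarrow> j \<in> {1..3} \<Longrightarrow>
           continuous_coeff (horizon g) (dim2 g i j) (dim3 g j i) (\<rho> i j)"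
begin

abbreviation T where "T \<equiv> horizon g"
abbreviation n where "n \<equiv> dimx g"

lemma horizon_pos: "0 < T"
  using standing unfolding standing_assumptions_def Let_def by blast

lemma riccatiD:
  "continuous_coeff T n n P"
  "\<forall>t\<in>{0..T}. invertible_mat (Nmat g P t)"
  "\<exists>\<kappa>. \<forall>t\<in>{0..T}. \<forall>a<n. \<forall>b<n. \<bar>minv (Nmat g P t) $$ (a, b)\<bar> \<le> \<kappa>"
  using riccati unfolding riccati_solution_def Let_def by - ((elim conjE, assumption)+)

lemma P_mbounded: "mbounded T n n P"
  by (rule continuous_coeff_mbounded[OF riccatiD(1)])

lemma state_coeff_mbounded:
  "mbounded T n n (cA g)" "mbounded T n n (cC g)" "mbounded T n (dimv g) (cE g)"
  using standing unfolding standing_assumptions_def Let_def by - ((rule bounded_coeff_mbounded)?, blast)+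

lemma control_coeff1:
  assumes "i \<in> {1..2}"
  shows "mbounded T n (dim1 g i) (cB1 g i)" "mbounded T n (dim1 g i) (cD1 g i)"
    "pos_weight T (dim1 g i) (wR11 g i)"
  using standing assms unfolding standing_assumptions_def Let_def by - ((rule bounded_coeff_mbounded)?, blast)+

lemma control_coeff23:
  assumes "i \<in> {1..2}" "j \<in> {1..3}"
  shows "mbounded T n (dim2 g i j) (cB2 g i j)" "mbounded T n (dim2 g i j) (cD2 g i j)"
    "mbounded T n (dim3 g j i) (cB3 g j i)" "mbounded T n (dim3 g j i) (cD3 g j i)"
    "pos_weight T (dim2 g i j) (wR12 g i j)" "pos_weight T (dim3 g j i) (wR13 g j i)"
  using standing assms unfolding standing_assumptions_def Let_def by - ((rule bounded_coeff_mbounded)?, blast)+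

text \<open>Block widths in the common order of \<open>Bc\<close>, \<open>Dc\<close> and
  \<open>Rc\<close>.\<close>

definition dimc :: "nat list" where
  "dimc = [dim1 g 1, dim1 g 2,
    dim2 g 1 1, dim2 g 1 2, dim2 g 1 3, dim2 g 2 1, dim2 g 2 2, dim2 g 2 3,
    dim3 g 1 1, dim3 g 1 2, dim3 g 2 1, dim3 g 2 2, dim3 g 3 1, dim3 g 3 2]"

lemma Bc_mbounded: "mbounded T n (sum_list dimc) (Bc g)"
proof -
  have "list_all2 (\<lambda>d F. mbounded T n d F) dimc
     [cB1 g 1, cB1 g 2,
      cB2 g 1 1, cB2 g 1 2, cB2 g 1 3, cB2 g 2 1, cB2 g 2 2, cB2 g 2 3,
      cB3 g 1 1, cB3 g 1 2, cB3 g 2 1, cB3 g 2 2, cB3 g 3 1, cB3 g 3 2]"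
    unfolding dimc_def list_all2_Cons by (intro conjI control_coeff1 control_coeff23 list_all2_Nil[THEN iffD2]) auto
  from mbounded_hcat[OF this] show ?thesis
    by (rule mbounded_cong) (simp add: Bc_def)
qed

lemma Dc_mbounded: "mbounded T n (sum_list dimc) (Dc g)"
proof -
  have "list_all2 (\<lambda>d F. mbounded T n d F) dimc
     [cD1 g 1, cD1 g 2,
      cD2 g 1 1, cD2 g 1 2, cD2 g 1 3, cD2 g 2 1, cD2 g 2 2, cD2 g 2 3,
      cD3 g 1 1, cD3 g 1 2, cD3 g 2 1, cD3 g 2 2, cD3 g 3 1, cD3 g 3 2]"
    unfolding dimc_def list_all2_Cons by (intro conjI control_coeff1 control_coeff23 list_all2_Nil[THEN iffD2]) auto
  from mbounded_hcat[OF this] show ?thesis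
    by (rule mbounded_cong) (simp add: Dc_def)
qed

lemma minv_Rc_mbounded: "mbounded T (sum_list dimc) (sum_list dimc) (\<lambda>t. minv (Rc g t))"
proof -
  have "list_all2 (pos_weight T) dimc
     [wR11 g 1, wR11 g 2,
      wR12 g 1 1, wR12 g 1 2, wR12 g 1 3, wR12 g 2 1, wR12 g 2 2, wR12 g 2 3,
      wR13 g 1 1, wR13 g 1 2, wR13 g 2 1, wR13 g 2 2, wR13 g 3 1, wR13 g 3 2]"
    unfolding dimc_def list_all2_Cons by (intro conjI control_coeff1 control_coeff23 list_all2_Nil[THEN iffD2]) auto
  from mbounded_minv_diag_block[OF this] show ?thesis
    by (rule mbounded_cong) (simp add: Rc_def del: diag_block_mat.simps)
qed

lemma Smat_mbounded: "mbounded T n n (Smat g P)"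
  unfolding Smat_def[abs_def]
  by (rule mbounded_minus[OF state_coeff_mbounded(2) mbounded_mult[OF mbounded_mult[OF
    mbounded_mult[OF Dc_mbounded minv_Rc_mbounded] mbounded_transpose[OF Bc_mbounded]] P_mbounded]])

text \<open>The bound on the entries is part of \<open>riccati_solution\<close>; the dimension of
  the inverse has to be derived from invertibility.\<close>

lemma minv_Nmat_mbounded: "mbounded T n n (\<lambda>t. minv (Nmat g P t))"
proof (rule mboundedI)
  fix t assume t: "t \<in> {0..T}"
  have "mbounded T n n (\<lambda>t. P t * Dc g t * minv (Rc g t) * transpose_mat (Dc g t))"
    by (rule mbounded_mult[OF mbounded_mult[OF mbounded_mult[OF P_mbounded Dc_mbounded] minv_Rc_mbounded]
      mbounded_transpose[OF Dc_mbounded]])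
  from add_carrier_mat[OF mboundedD[OF this t]] have "Nmat g P t \<in> carrier_mat n n"
    unfolding Nmat_def .
  moreover have "invertible_mat (Nmat g P t)"
    by (rule bspec[OF riccatiD(2) t])
  ultimately show "minv (Nmat g P t) \<in> carrier_mat n n" by (rule invertible_minv_carrier)
next
  fix a b assume "a < n" "b < n"
  with riccatiD(3) show "\<exists>\<kappa>. \<forall>t\<in>{0..T}. \<bar>minv (Nmat g P t) $$ (a, b)\<bar> \<le> \<kappa>"
    by blast
qed

lemma Lam_mbounded: "mbounded T n n (Lam g P)"
  unfolding Lam_def[abs_def]
  by (rule mbounded_mult[OF mbounded_mult[OF minv_Nmat_mbounded P_mbounded] Smat_mbounded])

text \<open>Common shape of the feedback gains \<open>K1\<close>, \<open>K2\<close> and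
  \<open>K3\<close>.\<close>

lemma gain_mbounded:
  assumes "mbounded T n d B" "mbounded T n d D" "pos_weight T d R"
  shows "mbounded T d n (\<lambda>t. minv (R t) * (transpose_mat (B t) * P t + transpose_mat (D t) * Lam g P t))"
  by (rule mbounded_mult[OF mbounded_minv[OF assms(3)] mbounded_add[OF
    mbounded_mult[OF mbounded_transpose[OF assms(1)] P_mbounded]
    mbounded_mult[OF mbounded_transpose[OF assms(2)] Lam_mbounded]]])

lemma K1_mbounded: "i \<in> {1..2} \<Longrightarrow> mbounded T (dim1 g i) n (K1 g P i)"
  unfolding K1_def[abs_def] by (rule gain_mbounded[OF control_coeff1])

lemma K2_mbounded: "i \<in> {1..2} \<Longrightarrow> j \<in> {1..3} \<Longrightarrow> mbounded T (dim2 g i j) n (K2 g P i j)"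
  unfolding K2_def[abs_def] by (rule gain_mbounded[OF control_coeff23(1,2,5)])

lemma K3_mbounded: "i \<in> {1..2} \<Longrightarrow> j \<in> {1..3} \<Longrightarrow> mbounded T (dim3 g j i) n (K3 g P j i)"
  unfolding K3_def[abs_def] by (rule gain_mbounded[OF control_coeff23(3,4,6)])

lemma theta_mbounded:
  assumes "i \<in> {1..2}" "j \<in> {1..3}"
  shows "mbounded T (dim2 g i j) n (theta g P \<rho> i j)"
  unfolding theta_def[abs_def]
  by (rule mbounded_add[OF mbounded_uminus[OF K2_mbounded[OF assms]]
    mbounded_mult[OF continuous_coeff_mbounded[OF \<rho>[OF assms]] K3_mbounded[OF assms]]])

lemma xi_mbounded:
  assumes "i \<in> {1..2}" "j \<in> {1..3}"
  shows "mbounded T (dim1 g i) n (xi g P \<eta> \<zeta> i j)"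
  unfolding xi_def[abs_def]
  by (rule mbounded_add[OF mbounded_add[OF mbounded_smult[OF K1_mbounded[OF assms(1)]]
    mbounded_mult[OF continuous_coeff_mbounded[OF \<eta>[OF assms]] K2_mbounded[OF assms]]]
    mbounded_mult[OF continuous_coeff_mbounded[OF \<zeta>[OF assms]] K3_mbounded[OF assms]]])

text \<open>\<open>B1\<close> and \<open>B2\<close> are generic because the same two sums occur in
  \<open>A_hat\<close> with the drift coefficients and in \<open>C_hat\<close> with the diffusion
  coefficients.\<close>

lemma hat_sum_mbounded:
  assumes B1: "\<And>i. i \<in> {1..2} \<Longrightarrow> mbounded T n (dim1 g i) (B1 i)"
    and B2: "\<And>i j. i \<in> {1..2} \<Longrightarrow> j \<in> {1..3} \<Longrightarrow> mbounded T n (dim2 g i j) (B2 i j)"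
  shows "mbounded T n n (\<lambda>t. msum n n (\<lambda>(i, j). B1 i t * (xi g P \<eta> \<zeta> i j t + \<eta> i j t * theta g P \<rho> i j t)) ({1..2} \<times> {1..3}))"
    and "mbounded T n n (\<lambda>t. msum n n (\<lambda>(i, j). B2 i j t * theta g P \<rho> i j t) ({1..2} \<times> {1..3}))"
proof -
  show "mbounded T n n (\<lambda>t. msum n n (\<lambda>(i, j). B1 i t * (xi g P \<eta> \<zeta> i j t + \<eta> i j t * theta g P \<rho> i j t)) ({1..2} \<times> {1..3}))"
  proof (rule mbounded_msum)
    fix p assume "p \<in> {1..2::nat} \<times> {1..3::nat}"
    then obtain i j where p: "p = (i, j)" "i \<in> {1..2}" "j \<in> {1..3}" by (rule SigmaE)
    show "mbounded T n n (\<lambda>t. case p of (i, j) \<Rightarrow> B1 i t * (xi g P \<eta> \<zeta> i j t + \<eta> i j t * theta g P \<rho> i j t))"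
      unfolding p(1) prod.case
      by (rule mbounded_mult[OF B1[OF p(2)] mbounded_add[OF xi_mbounded[OF p(2,3)]
        mbounded_mult[OF continuous_coeff_mbounded[OF \<eta>[OF p(2,3)]] theta_mbounded[OF p(2,3)]]]])
  qed
  show "mbounded T n n (\<lambda>t. msum n n (\<lambda>(i, j). B2 i j t * theta g P \<rho> i j t) ({1..2} \<times> {1..3}))"
  proof (rule mbounded_msum)
    fix p assume "p \<in> {1..2::nat} \<times> {1..3::nat}"
    then obtain i j where p: "p = (i, j)" "i \<in> {1..2}" "j \<in> {1..3}" by (rule SigmaE)
    show "mbounded T n n (\<lambda>t. case p of (i, j) \<Rightarrow> B2 i j t * theta g P \<rho> i j t)"
      unfolding p(1) prod.case
      by (rule mbounded_mult[OF B2[OF p(2,3)] theta_mbounded[OF p(2,3)]])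
  qed
qed

lemma gamEE_P_mbounded: "mbounded T n n (\<lambda>t. gamEE g t * P t)"
  unfolding gamEE_def
  by (rule mbounded_mult[OF mbounded_smult[OF mbounded_mult[OF state_coeff_mbounded(3)
    mbounded_transpose[OF state_coeff_mbounded(3)]]] P_mbounded])

lemma A_hat_mbounded: "mbounded T n n (A_hat g P \<eta> \<zeta> \<rho>)"
  unfolding A_hat_def[abs_def]
  by (rule mbounded_add[OF mbounded_add[OF mbounded_add[OF state_coeff_mbounded(1) gamEE_P_mbounded]
    hat_sum_mbounded(1)] hat_sum_mbounded(2)]; rule control_coeff1 control_coeff23; assumption)

lemma C_hat_mbounded: "mbounded T n n (C_hat g P \<eta> \<zeta> \<rho>)"
  unfolding C_hat_def[abs_def]
  by (rule mbounded_add[OF mbounded_add[OF state_coeff_mbounded(2)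
    hat_sum_mbounded(1)] hat_sum_mbounded(2)]; rule control_coeff1 control_coeff23; assumption)

section \<open>Closed-loop identities at a fixed time and state\<close>

context
  fixes t :: real and y :: "real vec"
  assumes t: "t \<in> {0..T}" and y: "y \<in> carrier_vec n"
begin

lemma gain_carrier:
  assumes ij: "i \<in> {1..2}" "j \<in> {1..3}"
  shows "\<eta> i j t \<in> carrier_mat (dim1 g i) (dim2 g i j)" "\<zeta> i j t \<in> carrier_mat (dim1 g i) (dim3 g j i)"
    "\<rho> i j t \<in> carrier_mat (dim2 g i j) (dim3 g j i)" "K1 g P i t \<in> carrier_mat (dim1 g i) n"
    "K2 g P i j t \<in> carrier_mat (dim2 g i j) n" "K3 g P j i t \<in> carrier_mat (dim3 g j i) n"
  by (rule mboundedD[OF continuous_coeff_mbounded[OF \<eta>[OF ij]] t]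
      mboundedD[OF continuous_coeff_mbounded[OF \<zeta>[OF ij]] t] mboundedD[OF continuous_coeff_mbounded[OF \<rho>[OF ij]] t]
      mboundedD[OF K1_mbounded[OF ij(1)] t] mboundedD[OF K2_mbounded[OF ij] t] mboundedD[OF K3_mbounded[OF ij] t])+

text \<open>When Level 3 plays its team feedback at \<open>y\<close>, the announced strategies of
  Levels 1 and 2 return their own team feedbacks, whichever \<eta>, \<zeta> and \<rho> are used. The
  term \<open>gamEE g t * P t\<close> of \<open>A_hat\<close> is \<open>cE g t\<close> applied to
  the worst-case disturbance.\<close>

lemma closed_loop_drift:
  assumes k: "k < n"
  shows "(A_hat g P \<eta> \<zeta> \<rho> t *\<^sub>v y + vsum n (\<lambda>j. B3_hat_row g \<eta> \<zeta> \<rho> j t *\<^sub>v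
        (- (K3 g P j 1 t *\<^sub>v y) @\<^sub>v - (K3 g P j 2 t *\<^sub>v y))) {1..3}) $ k
    = drift g t y (\<lambda>i. - (K1 g P i t *\<^sub>v y)) (\<lambda>i j. - (K2 g P i j t *\<^sub>v y)) (\<lambda>j i. - (K3 g P j i t *\<^sub>v y))
        (((1 / (gam g)\<^sup>2) \<cdot>\<^sub>m (transpose_mat (cE g t) * P t)) *\<^sub>v y) $ k"
proof -
  have A: "cA g t + gamEE g t * P t \<in> carrier_mat n n"
    using mboundedD[OF mbounded_add[OF state_coeff_mbounded(1) gamEE_P_mbounded] t] .
  have Ay: "((cA g t + gamEE g t * P t) *\<^sub>v y) $ k = (cA g t *\<^sub>v y) $ k
      + (cE g t *\<^sub>v (((1 / (gam g)\<^sup>2) \<cdot>\<^sub>m (transpose_mat (cE g t) * P t)) *\<^sub>v y)) $ k"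
  proof -
    have E: "cE g t \<in> carrier_mat n (dimv g)" and Pc: "P t \<in> carrier_mat n n" and cA: "cA g t \<in> carrier_mat n n"
      using mboundedD[OF state_coeff_mbounded(3) t] mboundedD[OF P_mbounded t] mboundedD[OF state_coeff_mbounded(1) t] by auto
    have "gamEE g t * P t = cE g t * ((1 / (gam g)\<^sup>2) \<cdot>\<^sub>m (transpose_mat (cE g t) * P t))"
      unfolding gamEE_def
      using mult_smult_assoc_mat[of "cE g t * transpose_mat (cE g t)" n n "P t" n "1 / (gam g)\<^sup>2"]
        mult_smult_distrib[of "cE g t" n "dimv g" "transpose_mat (cE g t) * P t" n "1 / (gam g)\<^sup>2"]
        assoc_mult_mat[of "cE g t" n "dimv g" "transpose_mat (cE g t)" n "P t" n] E Pc by simp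
    moreover have "(cE g t * ((1 / (gam g)\<^sup>2) \<cdot>\<^sub>m (transpose_mat (cE g t) * P t))) *\<^sub>v y
        = cE g t *\<^sub>v (((1 / (gam g)\<^sup>2) \<cdot>\<^sub>m (transpose_mat (cE g t) * P t)) *\<^sub>v y)"
      by (rule assoc_mult_mat_vec[OF E _ y]) (use E Pc in auto)
    moreover have "gamEE g t * P t \<in> carrier_mat n n" by (rule mboundedD[OF gamEE_P_mbounded t])
    ultimately show ?thesis
      using add_mult_distrib_mat_vec[OF cA _ y, of "gamEE g t * P t"] k E by simp
  qed
  have "(A_hat g P \<eta> \<zeta> \<rho> t *\<^sub>v y) $ k + (\<Sum>j\<in>{1..3}. (B3_hat_row g \<eta> \<zeta> \<rho> j t *\<^sub>v
        (- (K3 g P j 1 t *\<^sub>v y) @\<^sub>v - (K3 g P j 2 t *\<^sub>v y))) $ k)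
    = ((cA g t + gamEE g t * P t) *\<^sub>v y) $ k + (\<Sum>i\<in>{1..2}. (cB1 g i t *\<^sub>v (- (K1 g P i t *\<^sub>v y))) $ k)
      + (\<Sum>(i, j)\<in>{1..2} \<times> {1..3}. (cB2 g i j t *\<^sub>v (- (K2 g P i j t *\<^sub>v y))) $ k)
      + (\<Sum>(j, i)\<in>{1..3} \<times> {1..2}. (cB3 g j i t *\<^sub>v (- (K3 g P j i t *\<^sub>v y))) $ k)"
    unfolding A_hat_def B3_hat_row_def
  \<comment> \<open>The disturbance feedback belongs to the matrix \<open>A\<close> of the general
    identity; \<open>Ay\<close> separates it afterwards.\<close>
  proof (rule closed_loop_index[where dimA = "dim1 g" and dimB = "dim2 g" and dimC = "dim3 g", OF _ A y k])
    fix i j :: nat assume ij: "i \<in> {1..2}" "j \<in> {1..3}"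
    show "cB1 g i t \<in> carrier_mat n (dim1 g i) \<and> cB2 g i j t \<in> carrier_mat n (dim2 g i j) \<and> cB3 g j i t \<in> carrier_mat n (dim3 g j i) \<and>
      \<eta> i j t \<in> carrier_mat (dim1 g i) (dim2 g i j) \<and> \<zeta> i j t \<in> carrier_mat (dim1 g i) (dim3 g j i) \<and>
      \<rho> i j t \<in> carrier_mat (dim2 g i j) (dim3 g j i) \<and>
      K1 g P i t \<in> carrier_mat (dim1 g i) n \<and> K2 g P i j t \<in> carrier_mat (dim2 g i j) n \<and> K3 g P j i t \<in> carrier_mat (dim3 g j i) n \<and>
      xi g P \<eta> \<zeta> i j t = (- (1 / 3)) \<cdot>\<^sub>m K1 g P i t + \<eta> i j t * K2 g P i j t + \<zeta> i j t * K3 g P j i t \<and>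
      theta g P \<rho> i j t = - K2 g P i j t + \<rho> i j t * K3 g P j i t \<and>
      B3_hat g \<eta> \<zeta> \<rho> j i t = cB1 g i t * (\<eta> i j t * \<rho> i j t + \<zeta> i j t) + cB2 g i j t * \<rho> i j t + cB3 g j i t"
      by (intro conjI xi_def theta_def B3_hat_def
          control_coeff1(1)[OF ij(1), THEN mboundedD, OF t]
          control_coeff23(1)[OF ij, THEN mboundedD, OF t] control_coeff23(3)[OF ij, THEN mboundedD, OF t]
          gain_carrier[OF ij])
  qed
  thus ?thesis unfolding drift_def using k Ay mboundedD[OF state_coeff_mbounded(1) t] mboundedD[OF A_hat_mbounded t]
      mboundedD[OF state_coeff_mbounded(3) t]
    by (simp add: vsum_index case_prod_beta vsum_carrier[THEN carrier_vecD] del: index_mult_mat_vec)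
qed

text \<open>The disturbance does not enter the diffusion, so \<open>cC g t\<close> alone takes the
  place of \<open>A\<close> in \<open>closed_loop_index\<close>.\<close>

lemma closed_loop_diffusion:
  assumes k: "k < n"
  shows "(C_hat g P \<eta> \<zeta> \<rho> t *\<^sub>v y + vsum n (\<lambda>j. D3_hat_row g \<eta> \<zeta> \<rho> j t *\<^sub>v
        (- (K3 g P j 1 t *\<^sub>v y) @\<^sub>v - (K3 g P j 2 t *\<^sub>v y))) {1..3}) $ k
    = diffusion g t y (\<lambda>i. - (K1 g P i t *\<^sub>v y)) (\<lambda>i j. - (K2 g P i j t *\<^sub>v y)) (\<lambda>j i. - (K3 g P j i t *\<^sub>v y)) $ k"
proof -
  have "(C_hat g P \<eta> \<zeta> \<rho> t *\<^sub>v y) $ k + (\<Sum>j\<in>{1..3}. (D3_hat_row g \<eta> \<zeta> \<rho> j t *\<^sub>v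
        (- (K3 g P j 1 t *\<^sub>v y) @\<^sub>v - (K3 g P j 2 t *\<^sub>v y))) $ k)
    = (cC g t *\<^sub>v y) $ k + (\<Sum>i\<in>{1..2}. (cD1 g i t *\<^sub>v (- (K1 g P i t *\<^sub>v y))) $ k)
      + (\<Sum>(i, j)\<in>{1..2} \<times> {1..3}. (cD2 g i j t *\<^sub>v (- (K2 g P i j t *\<^sub>v y))) $ k)
      + (\<Sum>(j, i)\<in>{1..3} \<times> {1..2}. (cD3 g j i t *\<^sub>v (- (K3 g P j i t *\<^sub>v y))) $ k)"
    unfolding C_hat_def D3_hat_row_def
  proof (rule closed_loop_index[where dimA = "dim1 g" and dimB = "dim2 g" and dimC = "dim3 g",
        OF _ mboundedD[OF state_coeff_mbounded(2) t] y k])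
    fix i j :: nat assume ij: "i \<in> {1..2}" "j \<in> {1..3}"
    show "cD1 g i t \<in> carrier_mat n (dim1 g i) \<and> cD2 g i j t \<in> carrier_mat n (dim2 g i j) \<and> cD3 g j i t \<in> carrier_mat n (dim3 g j i) \<and>
      \<eta> i j t \<in> carrier_mat (dim1 g i) (dim2 g i j) \<and> \<zeta> i j t \<in> carrier_mat (dim1 g i) (dim3 g j i) \<and>
      \<rho> i j t \<in> carrier_mat (dim2 g i j) (dim3 g j i) \<and>
      K1 g P i t \<in> carrier_mat (dim1 g i) n \<and> K2 g P i j t \<in> carrier_mat (dim2 g i j) n \<and> K3 g P j i t \<in> carrier_mat (dim3 g j i) n \<and>
      xi g P \<eta> \<zeta> i j t = (- (1 / 3)) \<cdot>\<^sub>m K1 g P i t + \<eta> i j t * K2 g P i j t + \<zeta> i j t * K3 g P j i t \<and>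
      theta g P \<rho> i j t = - K2 g P i j t + \<rho> i j t * K3 g P j i t \<and>
      D3_hat g \<eta> \<zeta> \<rho> j i t = cD1 g i t * (\<eta> i j t * \<rho> i j t + \<zeta> i j t) + cD2 g i j t * \<rho> i j t + cD3 g j i t"
      by (intro conjI xi_def theta_def D3_hat_def
          control_coeff1(2)[OF ij(1), THEN mboundedD, OF t]
          control_coeff23(2)[OF ij, THEN mboundedD, OF t] control_coeff23(4)[OF ij, THEN mboundedD, OF t]
          gain_carrier[OF ij])
  qed
  thus ?thesis unfolding diffusion_def using k mboundedD[OF state_coeff_mbounded(2) t] mboundedD[OF C_hat_mbounded t]
    by (simp add: vsum_index case_prod_beta vsum_carrier[THEN carrier_vecD] del: index_mult_mat_vec)
qed

end

end

theorem mainTheorem7: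
  fixes g :: game
    and M :: "'a measure" and W :: "real \<Rightarrow> 'a \<Rightarrow> real"
    and P :: "real \<Rightarrow> real mat"
    and \<eta> \<zeta> \<rho> :: "nat \<Rightarrow> nat \<Rightarrow> real \<Rightarrow> real mat"
    and u3bar :: "nat \<Rightarrow> nat \<Rightarrow> real \<Rightarrow> 'a \<Rightarrow> real vec"
    and xbar xhat :: "real \<Rightarrow> 'a \<Rightarrow> real vec"
  assumes "prob_space M" and "complete_measure M" and "brownian_motion M W"
    and "standing_assumptions g"
    and "riccati_solution g P"
    and "team_trajectory g P M W xbar"
    and "\<And>i j. i \<in> {1..2} \<Longrightarrow> j \<in> {1..3} \<Longrightarrow>
           continuous_coeff (horizon g) (dim1 g i) (dim2 g i j) (\<eta> i j)"
    and "\<And>i j. i \<in> {1..2} \<Longrightarrow> j \<in> {1..3} \<Longrightarrow>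
           continuous_coeff (horizon g) (dim1 g i) (dim3 g j i) (\<zeta> i j)"
    and "level2_nash g P \<eta> \<zeta> M W (team_u2 g P xbar) (team_u3 g P xbar)"
    and "\<And>i j. i \<in> {1..2} \<Longrightarrow> j \<in> {1..3} \<Longrightarrow>
           continuous_coeff (horizon g) (dim2 g i j) (dim3 g j i) (\<rho> i j)"
    and "level3_nash g P \<eta> \<zeta> \<rho> M W u3bar"
    and "level3_state g P \<eta> \<zeta> \<rho> M W u3bar xhat"
    and "\<And>j t. j \<in> {1..3} \<Longrightarrow> t \<in> {0..horizon g} \<Longrightarrow>
           AE \<omega> in M. stack3 u3bar j t \<omega> = stack3 (team_u3 g P xbar) j t \<omega>"
  shows "AE \<omega> in M. \<forall>t\<in>{0..horizon g}. xhat t \<omega> = xbar t \<omega>"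
proof -
  let ?T = "horizon g" and ?n = "dimx g"
  interpret brownian M W
    using assms(1,3) by (simp add: brownian_def brownian_axioms_def)
  interpret hierarchical_game g P \<eta> \<zeta> \<rho>
    by unfold_locales (fact assms)+
  note hat = assms(12)[unfolded level3_state_def]
  note bar = assms(6)[unfolded team_trajectory_def is_state_def]
  \<comment> \<open>Admissibility is part of both Nash conditions and gives the dimensions and the
    joint measurability used below.\<close>
  have adm: "L2F M W ?T (dim3 g j i) (u3bar j i)" "L2F M W ?T (dim3 g j i) (team_u3 g P xbar j i)"
    if "i \<in> {1..2}" "j \<in> {1..3}" for i j
    using assms(9,11) that unfolding level2_nash_def level3_nash_def admissible3_def by blast+
  have pointwise: "AE \<omega> in M. u3bar j i t \<omega> = team_u3 g P xbar j i t \<omega>"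
    if ij: "i \<in> {1..2}" "j \<in> {1..3}" and t: "t \<in> {0..?T}" for i j t
    using assms(13)[OF ij(2) t] AE_space
  proof eventually_elim
    case (elim \<omega>)
    have 1: "(1::nat) \<in> {1..2}" by simp
    have "u3bar j 1 t \<omega> \<in> carrier_vec (dim3 g j 1)" "team_u3 g P xbar j 1 t \<omega> \<in> carrier_vec (dim3 g j 1)"
      using adm[OF 1 ij(2)] t elim(2) unfolding L2F_def by blast+
    \<comment> \<open>Equality of the stacked vectors splits into blocks because their first blocks
      have equal length.\<close>
    hence "u3bar j 1 t \<omega> = team_u3 g P xbar j 1 t \<omega> \<and> u3bar j 2 t \<omega> = team_u3 g P xbar j 2 t \<omega>"
      using elim(1) unfolding stack3_def by (subst (asm) append_vec_eq)
    moreover have "i = 1 \<or> i = 2" using ij(1) by auto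
    ultimately show ?case by auto
  qed
  \<comment> \<open>\<open>L2F_AE_AE_eq\<close> exchanges the quantifiers for each of the six index
    pairs; the finitely many exceptional null sets are then united, first over paths and then over
    times.\<close>
  have controls: "AE \<omega> in M. AE t in lborel. \<forall>p\<in>{1..2} \<times> {1..3}. t \<in> {0..?T} \<longrightarrow>
      u3bar (snd p) (fst p) t \<omega> = team_u3 g P xbar (snd p) (fst p) t \<omega>"
  proof -
    have "AE \<omega> in M. \<forall>p\<in>{1..2} \<times> {1..3}. AE t in lborel. t \<in> {0..?T} \<longrightarrow>
      u3bar (snd p) (fst p) t \<omega> = team_u3 g P xbar (snd p) (fst p) t \<omega>"
    proof (rule AE_ball_countable')
      fix p assume "p \<in> {1..2::nat} \<times> {1..3::nat}"
      then obtain i j where p: "p = (i, j)" "i \<in> {1..2}" "j \<in> {1..3}" by (rule SigmaE)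
      show "AE \<omega> in M. AE t in lborel. t \<in> {0..?T} \<longrightarrow> u3bar (snd p) (fst p) t \<omega> = team_u3 g P xbar (snd p) (fst p) t \<omega>"
        unfolding p(1) fst_conv snd_conv
        by (rule L2F_AE_AE_eq[OF less_imp_le[OF horizon_pos] adm[OF p(2,3)] pointwise[OF p(2,3)]])
    qed (intro countable_finite finite_cartesian_product finite_atLeastAtMost)
    thus ?thesis
      by eventually_elim (intro AE_ball_countable' countable_finite finite_cartesian_product finite_atLeastAtMost, blast)
  qed
  obtain \<kappa>1 where \<kappa>1: "0 \<le> \<kappa>1" "\<forall>t\<in>{0..?T}. \<forall>x\<in>carrier_vec ?n. \<forall>y\<in>carrier_vec ?n. \<forall>k<?n.
      \<bar>(A_hat g P \<eta> \<zeta> \<rho> t *\<^sub>v x) $ k - (A_hat g P \<eta> \<zeta> \<rho> t *\<^sub>v y) $ k\<bar> \<le> \<kappa>1 * (\<Sum>l<?n. \<bar>x $ l - y $ l\<bar>)"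
    using mbounded_lipschitz[OF A_hat_mbounded] by blast
  obtain \<kappa>2 where \<kappa>2: "0 \<le> \<kappa>2" "\<forall>t\<in>{0..?T}. \<forall>x\<in>carrier_vec ?n. \<forall>y\<in>carrier_vec ?n. \<forall>k<?n.
      \<bar>(C_hat g P \<eta> \<zeta> \<rho> t *\<^sub>v x) $ k - (C_hat g P \<eta> \<zeta> \<rho> t *\<^sub>v y) $ k\<bar> \<le> \<kappa>2 * (\<Sum>l<?n. \<bar>x $ l - y $ l\<bar>)"
    using mbounded_lipschitz[OF C_hat_mbounded] by blast
  have L2: "L2F M W ?T ?n xhat" "L2F M W ?T ?n xbar"
    using hat bar unfolding ito_process_def by blast+
  show ?thesis
  \<comment> \<open>One constant has to serve both drift and diffusion, hence the sum of the
    two.\<close>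
  proof (rule ito_process_unique[OF horizon_pos _ hat bar, of "\<kappa>1 + \<kappa>2"])
    show "0 \<le> \<kappa>1 + \<kappa>2" using \<kappa>1(1) \<kappa>2(1) by simp
    show "AE \<omega> in M. AE t in lborel. t \<in> {0..?T} \<longrightarrow> (\<forall>k<?n.
        \<bar>(A_hat g P \<eta> \<zeta> \<rho> t *\<^sub>v xhat t \<omega> + vsum ?n (\<lambda>j. B3_hat_row g \<eta> \<zeta> \<rho> j t *\<^sub>v stack3 u3bar j t \<omega>) {1..3}) $ k
          - drift g t (xbar t \<omega>) (\<lambda>i. team_u1 g P xbar i t \<omega>) (\<lambda>i j. team_u2 g P xbar i j t \<omega>)
              (\<lambda>j i. team_u3 g P xbar j i t \<omega>) (worst_v g P xbar t \<omega>) $ k\<bar>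
          \<le> (\<kappa>1 + \<kappa>2) * (\<Sum>l<?n. \<bar>xhat t \<omega> $ l - xbar t \<omega> $ l\<bar>) \<and>
        \<bar>(C_hat g P \<eta> \<zeta> \<rho> t *\<^sub>v xhat t \<omega> + vsum ?n (\<lambda>j. D3_hat_row g \<eta> \<zeta> \<rho> j t *\<^sub>v stack3 u3bar j t \<omega>) {1..3}) $ k
          - diffusion g t (xbar t \<omega>) (\<lambda>i. team_u1 g P xbar i t \<omega>) (\<lambda>i j. team_u2 g P xbar i j t \<omega>)
              (\<lambda>j i. team_u3 g P xbar j i t \<omega>) $ k\<bar>
          \<le> (\<kappa>1 + \<kappa>2) * (\<Sum>l<?n. \<bar>xhat t \<omega> $ l - xbar t \<omega> $ l\<bar>))"
      using controls AE_space
    proof eventually_elim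
      case (elim \<omega>)
      show ?case using elim(1)
      proof eventually_elim
        case (elim t)
        show ?case
        proof (intro impI allI)
          fix k assume t: "t \<in> {0..?T}" and k: "k < ?n"
          define x y where "x = xhat t \<omega>" and "y = xbar t \<omega>"
          have c: "x \<in> carrier_vec ?n" "y \<in> carrier_vec ?n"
            unfolding x_def y_def using L2 t \<open>\<omega> \<in> space M\<close> unfolding L2F_def by blast+
          have st: "stack3 u3bar j t \<omega> = - (K3 g P j 1 t *\<^sub>v y) @\<^sub>v - (K3 g P j 2 t *\<^sub>v y)" if "j \<in> {1..3}" for j
          proof -
            have "(1::nat, j) \<in> {1..2} \<times> {1..3}" "(2::nat, j) \<in> {1..2} \<times> {1..3}" using that by auto
            from elim[rule_format, OF this(1) t] elim[rule_format, OF this(2) t] show ?thesis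
              unfolding stack3_def team_u3_def y_def by simp
          qed
          have vB: "vsum ?n (\<lambda>j. B3_hat_row g \<eta> \<zeta> \<rho> j t *\<^sub>v stack3 u3bar j t \<omega>) {1..3}
              = vsum ?n (\<lambda>j. B3_hat_row g \<eta> \<zeta> \<rho> j t *\<^sub>v (- (K3 g P j 1 t *\<^sub>v y) @\<^sub>v - (K3 g P j 2 t *\<^sub>v y))) {1..3}"
            unfolding vsum_def by (intro arg_cong[where f = "vec ?n"] ext sum.cong refl) (simp only: st)
          have vD: "vsum ?n (\<lambda>j. D3_hat_row g \<eta> \<zeta> \<rho> j t *\<^sub>v stack3 u3bar j t \<omega>) {1..3}
              = vsum ?n (\<lambda>j. D3_hat_row g \<eta> \<zeta> \<rho> j t *\<^sub>v (- (K3 g P j 1 t *\<^sub>v y) @\<^sub>v - (K3 g P j 2 t *\<^sub>v y))) {1..3}"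
            unfolding vsum_def by (intro arg_cong[where f = "vec ?n"] ext sum.cong refl) (simp only: st)
          have split: "(w + vsum ?n f S) $ k = w $ k + vsum ?n f S $ k" for w :: "real vec" and f :: "nat \<Rightarrow> real vec" and S
            using vsum_carrier[of ?n f S] k by simp
          let ?s = "\<Sum>l<?n. \<bar>x $ l - y $ l\<bar>"
          have s: "0 \<le> ?s" by (rule sum_nonneg) simp
          have "\<bar>(A_hat g P \<eta> \<zeta> \<rho> t *\<^sub>v x) $ k - (A_hat g P \<eta> \<zeta> \<rho> t *\<^sub>v y) $ k\<bar> \<le> \<kappa>1 * ?s"
            using \<kappa>1(2) t c k by blast
          moreover have "\<bar>(C_hat g P \<eta> \<zeta> \<rho> t *\<^sub>v x) $ k - (C_hat g P \<eta> \<zeta> \<rho> t *\<^sub>v y) $ k\<bar> \<le> \<kappa>2 * ?s"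
            using \<kappa>2(2) t c k by blast
          moreover have "0 \<le> \<kappa>1 * ?s" "0 \<le> \<kappa>2 * ?s"
            using mult_nonneg_nonneg[OF \<kappa>1(1) s] mult_nonneg_nonneg[OF \<kappa>2(1) s] .
          ultimately show "\<bar>(A_hat g P \<eta> \<zeta> \<rho> t *\<^sub>v xhat t \<omega> + vsum ?n (\<lambda>j. B3_hat_row g \<eta> \<zeta> \<rho> j t *\<^sub>v stack3 u3bar j t \<omega>) {1..3}) $ k
          - drift g t (xbar t \<omega>) (\<lambda>i. team_u1 g P xbar i t \<omega>) (\<lambda>i j. team_u2 g P xbar i j t \<omega>)
              (\<lambda>j i. team_u3 g P xbar j i t \<omega>) (worst_v g P xbar t \<omega>) $ k\<bar>
          \<le> (\<kappa>1 + \<kappa>2) * (\<Sum>l<?n. \<bar>xhat t \<omega> $ l - xbar t \<omega> $ l\<bar>) \<and>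
        \<bar>(C_hat g P \<eta> \<zeta> \<rho> t *\<^sub>v xhat t \<omega> + vsum ?n (\<lambda>j. D3_hat_row g \<eta> \<zeta> \<rho> j t *\<^sub>v stack3 u3bar j t \<omega>) {1..3}) $ k
          - diffusion g t (xbar t \<omega>) (\<lambda>i. team_u1 g P xbar i t \<omega>) (\<lambda>i j. team_u2 g P xbar i j t \<omega>)
              (\<lambda>j i. team_u3 g P xbar j i t \<omega>) $ k\<bar>
          \<le> (\<kappa>1 + \<kappa>2) * (\<Sum>l<?n. \<bar>xhat t \<omega> $ l - xbar t \<omega> $ l\<bar>)"
            \<comment> \<open>The team coefficients at \<open>y\<close> are rewritten with
              \<open>A_hat\<close>, \<open>C_hat\<close> and the stacked team controls. The control
              terms then coincide with those of the hat state and cancel, which leaves the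
              differences bounded through \<open>\<kappa>1\<close> and
              \<open>\<kappa>2\<close>.\<close>
            unfolding team_u1_def team_u2_def team_u3_def worst_v_def x_def[symmetric] y_def[symmetric] vB vD
              closed_loop_drift[OF t c(2) k, symmetric] closed_loop_diffusion[OF t c(2) k, symmetric]
              split distrib_right
            by linarith
        qed
      qed
    qed
  qed
qed

end
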